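(* Let $d \ge 2$ and let $\mathbb{M}^d$ be a $d$-dimensional compact two-point homogeneous space with normalized distance $\rho$ and associated Jacobi parameters $(\alpha,\beta)$. Assume that $\{Z(\mathbf{x}), \mathbf{x} \in \mathbb{M}^d\}$ is a (real-valued) isotropic and mean square continuous Gaussian random field, taken in a version with continuous sample paths, with covariance function $$\operatorname{cov}(Z(\mathbf{x}_1),Z(\mathbf{x}_2)) = \sum_{l=0}^\infty b_l\, \frac{P_l^{(\alpha,\beta)}(\cos \rho(\mathbf{x}_1,\mathbf{x}_2))}{P_l^{(\alpha,\beta)}(1)}, \qquad \mathbf{x}_1,\mathbf{x}_2\in \mathbb{M}^d,$$ where $\{b_l, l \in \mathbb{N}_0\}$ is a summable sequence of nonnegative constants. If there are $l_0 \in \mathbb{N}$ and positive constants $\gamma_1, \gamma_2$ and $\nu \in (0,2)$ such that $$\gamma_1 \le b_l (1+l)^{1+\nu} \le \gamma_2, \qquad \forall\, l \ge l_0,$$ then there is a positive and finite constant $\kappa$ such that, with probability $1$, $$\lim_{\varepsilon \to 0^+}\ \sup_{\substack{\mathbf{x}_1, \mathbf{x}_2 \in \mathbb{M}^d \\ 0<\rho(\mathbf{x}_1, \mathbf{x}_2) \le \varepsilon}} \frac{|Z(\mathbf{x}_1) - Z(\mathbf{x}_2)|}{\rho(\mathbf{x}_1, \mathbf{x}_2)^{\nu/2} \sqrt{|\ln \rho(\mathbf{x}_1, \mathbf{x}_2)|}} = \kappa.$$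
   Context: $\mathbb{N}=\{1,2,\dots\}$, $\mathbb{N}_0=\{0,1,2,\dots\}$. Compact two-point homogeneous spaces. $\mathbb{M}^d$ ($d\ge 2$) is one of the following $d$-dimensional compact rank-one Riemannian symmetric spaces, with associated parameters $\alpha=\frac{d-2}{2}$ and $\beta$: the unit sphere $\mathbb{S}^d$ ($d\ge 2$), $\beta=\frac{d-2}{2}$; the real projective space $\mathbb{P}^d(\mathbb{R})$ ($d=2,3,\ldots$), $\beta=-\frac12$; the complex projective space $\mathbb{P}^d(\mathbb{C})$ ($d=4,6,\ldots$), $\beta=0$; the quaternionic projective space $\mathbb{P}^d(\mathbb{H})$ ($d=8,12,\ldots$), $\beta=1$; the Cayley elliptic plane $\mathbb{P}^{16}(Cay)$ ($d=16$, $\alpha=7$), $\beta=3$. Here $d$ is the real dimension. The distance $\rho$ on $\mathbb{M}^d$ is the geodesic distance normalized so that every closed geodesic has length $2\pi$, so $0\le\rho\le\pi$ (on $\mathbb{S}^d$, $\rho(\mathbf{x}_1,\mathbf{x}_2)=\arccos(\mathbf{x}_1'\mathbf{x}_2)$). Jacobi polynomials: for $n\in\mathbb{N}_0$, $$P_n^{(\alpha,\beta)}(x)=\frac{\Gamma(\alpha+n+1)}{n!\,\Gamma(\alpha+\beta+n+1)}\sum_{k=0}^n\binom{n}{k}\frac{\Gamma(\alpha+\beta+n+k+1)}{\Gamma(\alpha+k+1)}\Big(\frac{x-1}{2}\Big)^k,\qquad P_n^{(\alpha,\beta)}(1)=\frac{\Gamma(\alpha+n+1)}{n!\,\Gamma(\alpha+1)}.$$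 A second-order random field on $\mathbb{M}^d$ is isotropic if its mean is constant and its covariance depends only on $\rho(\mathbf{x}_1,\mathbf{x}_2)$; it is mean square continuous if $\mathrm{E}|Z(\mathbf{x}_1)-Z(\mathbf{x}_2)|^2\to0$ as $\rho(\mathbf{x}_1,\mathbf{x}_2)\to0$. Under the assumptions of the claim such a field has a version with continuous sample paths. *)

theory Defs
  imports "HOL-Probability.Probability"
begin

text \<open>
  The Cayley--Dickson double of an algebra with multiplication \<open>mul\<close> and conjugation \<open>cj\<close>.
  Addition, norm and inner product are those of the product type, i.e. the Euclidean ones.
\<close>

definition cd_mult :: "('a::ab_group_add \<Rightarrow> 'a \<Rightarrow> 'a) \<Rightarrow> ('a \<Rightarrow> 'a) \<Rightarrow> 'a \<times> 'a \<Rightarrow> 'a \<times> 'a \<Rightarrow> 'a \<times> 'a"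
  where "cd_mult mul cj p q = (case (p, q) of ((a, b), (c, d)) \<Rightarrow>
    (mul a c - mul d (cj b), mul (cj a) d + mul c b))"

definition cd_cnj :: "('a::ab_group_add \<Rightarrow> 'a) \<Rightarrow> 'a \<times> 'a \<Rightarrow> 'a \<times> 'a"
  where "cd_cnj cj p = (cj (fst p), - snd p)"

type_synonym quaternion = "complex \<times> complex"
type_synonym octonion = "quaternion \<times> quaternion"

definition quat_mult :: "quaternion \<Rightarrow> quaternion \<Rightarrow> quaternion"
  where "quat_mult = cd_mult (*) cnj"

definition quat_cnj :: "quaternion \<Rightarrow> quaternion"
  where "quat_cnj = cd_cnj cnj"

definition oct_mult :: "octonion \<Rightarrow> octonion \<Rightarrow> octonion"
  where "oct_mult = cd_mult quat_mult quat_cnj"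

definition oct_cnj :: "octonion \<Rightarrow> octonion"
  where "oct_cnj = cd_cnj quat_cnj"

definition oct_one :: octonion
  where "oct_one = ((1, 0), (0, 0))"

text \<open>Vectors with \<open>n + 1\<close> coordinates, indexed by \<open>0, \<dots>, n\<close>, are functions vanishing beyond \<open>n\<close>.\<close>

definition unit_vectors :: "nat \<Rightarrow> (nat \<Rightarrow> 'a::real_normed_vector) set"
  where "unit_vectors n = {x. (\<forall>i>n. x i = 0) \<and> (\<Sum>i\<le>n. (norm (x i))\<^sup>2) = 1}"

definition is_sphere :: "nat \<Rightarrow> 'p metric \<Rightarrow> bool"
  where "is_sphere d M \<longleftrightarrow>
    (\<exists>\<pi> :: (nat \<Rightarrow> real) \<Rightarrow> 'p. bij_betw \<pi> (unit_vectors d) (mspace M) \<and>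
      (\<forall>x\<in>unit_vectors d. \<forall>y\<in>unit_vectors d.
        mdist M (\<pi> x) (\<pi> y) = arccos (\<Sum>i\<le>d. x i * y i)))"

text \<open>
  The projective space of the right module \<open>F^(n+1)\<close> over a field or skew field \<open>F\<close>: the map \<open>\<pi>\<close>
  assigns to a unit vector the line it spans, so its fibres are the orbits of the unit scalars.
  The distance is twice the angle between two lines: a closed geodesic (the lines in a real plane
  spanned by two vectors with real Hermitian product) would have length \<open>pi\<close> for the angle itself.
\<close>

definition herm :: "('f \<Rightarrow> 'f \<Rightarrow> 'f) \<Rightarrow> ('f \<Rightarrow> 'f) \<Rightarrow> nat \<Rightarrow> (nat \<Rightarrow> 'f) \<Rightarrow> (nat \<Rightarrow> 'f) \<Rightarrow> 'f::real_normed_vector"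
  where "herm mul cj n x y = (\<Sum>i\<le>n. mul (cj (x i)) (y i))"

definition is_projective_space ::
    "('f::real_normed_vector \<Rightarrow> 'f \<Rightarrow> 'f) \<Rightarrow> ('f \<Rightarrow> 'f) \<Rightarrow> nat \<Rightarrow> 'p metric \<Rightarrow> bool"
  where "is_projective_space mul cj n M \<longleftrightarrow>
    (\<exists>\<pi> :: (nat \<Rightarrow> 'f) \<Rightarrow> 'p. \<pi> ` unit_vectors n = mspace M \<and>
      (\<forall>x\<in>unit_vectors n. \<forall>y\<in>unit_vectors n.
        (\<pi> x = \<pi> y \<longleftrightarrow> (\<exists>u. norm u = 1 \<and> (\<forall>i. y i = mul (x i) u))) \<and>
        mdist M (\<pi> x) (\<pi> y) = 2 * arccos (norm (herm mul cj n x y))))"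

text \<open>
  The points of the Cayley plane are the idempotents of trace 1 in the Albert algebra of Hermitian
  octonionic \<open>3 \<times> 3\<close> matrices. (The Jordan square of a matrix is its ordinary matrix square.)
\<close>

definition cayley_points :: "(octonion^3^3) set"
  where "cayley_points = {A.
    (\<forall>i j. A $ j $ i = oct_cnj (A $ i $ j)) \<and>
    (\<forall>i j. (\<Sum>k\<in>UNIV. oct_mult (A $ i $ k) (A $ k $ j)) = A $ i $ j) \<and>
    (\<Sum>i\<in>UNIV. A $ i $ i) = oct_one}"

text \<open>
  The Euclidean inner product \<open>A \<bullet> B\<close> of Hermitian matrices is the trace of their Jordan product.
  If \<open>A\<close> and \<open>B\<close> are the projections onto the lines of unit vectors \<open>x\<close> and \<open>y\<close> it is the square of
  the norm of the Hermitian product of \<open>x\<close> and \<open>y\<close>, so this is the same distance as above.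
\<close>

definition is_cayley_plane :: "'p metric \<Rightarrow> bool"
  where "is_cayley_plane M \<longleftrightarrow>
    (\<exists>\<pi> :: octonion^3^3 \<Rightarrow> 'p. bij_betw \<pi> cayley_points (mspace M) \<and>
      (\<forall>A\<in>cayley_points. \<forall>B\<in>cayley_points.
        mdist M (\<pi> A) (\<pi> B) = 2 * arccos (sqrt (A \<bullet> B))))"

text \<open>
  \<open>d\<close> is the real dimension, and \<open>\<alpha>\<close>, \<open>\<beta>\<close> are the Jacobi parameters.
  Each space is taken up to isometry, with its geodesic distance in closed form, normalized so that
  closed geodesics have length \<open>2 * pi\<close>.
\<close>

inductive compact_two_point_homogeneous :: "nat \<Rightarrow> real \<Rightarrow> real \<Rightarrow> 'p metric \<Rightarrow> bool" where
  sphere: "d \<ge> 2 \<Longrightarrow> is_sphere d M \<Longrightarrow>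
    compact_two_point_homogeneous d ((real d - 2) / 2) ((real d - 2) / 2) M"
| real_projective: "d \<ge> 2 \<Longrightarrow> is_projective_space ((*) :: real \<Rightarrow> _) (\<lambda>x. x) d M \<Longrightarrow>
    compact_two_point_homogeneous d ((real d - 2) / 2) (- 1 / 2) M"
| complex_projective: "d = 2 * n \<Longrightarrow> n \<ge> 2 \<Longrightarrow> is_projective_space (*) cnj n M \<Longrightarrow>
    compact_two_point_homogeneous d ((real d - 2) / 2) 0 M"
| quaternionic_projective: "d = 4 * n \<Longrightarrow> n \<ge> 2 \<Longrightarrow> is_projective_space quat_mult quat_cnj n M \<Longrightarrow>
    compact_two_point_homogeneous d ((real d - 2) / 2) 1 M"
| cayley: "d = 16 \<Longrightarrow> is_cayley_plane M \<Longrightarrow>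
    compact_two_point_homogeneous d ((real d - 2) / 2) 3 M"

definition jacobi :: "real \<Rightarrow> real \<Rightarrow> nat \<Rightarrow> real \<Rightarrow> real"
  where "jacobi \<alpha> \<beta> n x =
    Gamma (\<alpha> + real n + 1) / (fact n * Gamma (\<alpha> + \<beta> + real n + 1)) *
    (\<Sum>k\<le>n. real (n choose k) * (Gamma (\<alpha> + \<beta> + real n + real k + 1) / Gamma (\<alpha> + real k + 1)) *
      ((x - 1) / 2) ^ k)"

definition covariance :: "'w measure \<Rightarrow> ('w \<Rightarrow> real) \<Rightarrow> ('w \<Rightarrow> real) \<Rightarrow> real"
  where "covariance P X Y =
    (\<integral>\<omega>. (X \<omega> - (\<integral>\<omega>'. X \<omega>' \<partial>P)) * (Y \<omega> - (\<integral>\<omega>'. Y \<omega>' \<partial>P)) \<partial>P)"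

definition second_order_field :: "'w measure \<Rightarrow> 'p set \<Rightarrow> ('p \<Rightarrow> 'w \<Rightarrow> real) \<Rightarrow> bool"
  where "second_order_field P S Z \<longleftrightarrow>
    (\<forall>x\<in>S. Z x \<in> borel_measurable P \<and> integrable P (\<lambda>\<omega>. (Z x \<omega>)\<^sup>2))"

definition isotropic_field :: "'w measure \<Rightarrow> 'p metric \<Rightarrow> ('p \<Rightarrow> 'w \<Rightarrow> real) \<Rightarrow> bool"
  where "isotropic_field P M Z \<longleftrightarrow>
    second_order_field P (mspace M) Z \<and>
    (\<exists>m. \<forall>x\<in>mspace M. (\<integral>\<omega>. Z x \<omega> \<partial>P) = m) \<and>
    (\<exists>C. \<forall>x\<in>mspace M. \<forall>y\<in>mspace M. covariance P (Z x) (Z y) = C (mdist M x y))"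

definition mean_square_continuous :: "'w measure \<Rightarrow> 'p metric \<Rightarrow> ('p \<Rightarrow> 'w \<Rightarrow> real) \<Rightarrow> bool"
  where "mean_square_continuous P M Z \<longleftrightarrow>
    (\<forall>e>0. \<exists>\<delta>>0. \<forall>x\<in>mspace M. \<forall>y\<in>mspace M.
      mdist M x y < \<delta> \<longrightarrow> (\<integral>\<omega>. \<bar>Z x \<omega> - Z y \<omega>\<bar>\<^sup>2 \<partial>P) < e)"

text \<open>Normal random variables, including the degenerate ones of variance zero.\<close>

definition gaussian_rv :: "'w measure \<Rightarrow> ('w \<Rightarrow> real) \<Rightarrow> bool"
  where "gaussian_rv P X \<longleftrightarrow> X \<in> borel_measurable P \<and>
    (\<exists>\<mu> \<sigma>. (\<sigma> > 0 \<and> distributed P lborel X (normal_density \<mu> \<sigma>)) \<or>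
            (\<sigma> = 0 \<and> (AE \<omega> in P. X \<omega> = \<mu>)))"

definition gaussian_field :: "'w measure \<Rightarrow> 'p set \<Rightarrow> ('p \<Rightarrow> 'w \<Rightarrow> real) \<Rightarrow> bool"
  where "gaussian_field P S Z \<longleftrightarrow>
    (\<forall>F c. finite F \<and> F \<subseteq> S \<longrightarrow> gaussian_rv P (\<lambda>\<omega>. \<Sum>x\<in>F. c x * Z x \<omega>))"

text \<open>The supremum is taken in the extended reals, where it always exists.\<close>

definition modulus_sup :: "'p metric \<Rightarrow> real \<Rightarrow> ('p \<Rightarrow> real) \<Rightarrow> real \<Rightarrow> ereal"
  where "modulus_sup M \<nu> z \<epsilon> =
    (SUP (x, y)\<in>{(x, y). x \<in> mspace M \<and> y \<in> mspace M \<and> 0 < mdist M x y \<and> mdist M x y \<le> \<epsilon>}.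
      ereal (\<bar>z x - z y\<bar> / (mdist M x y powr (\<nu> / 2) * sqrt \<bar>ln (mdist M x y)\<bar>)))"

end

theory Submission
  imports Defs
begin

text \<open>
  The normalized Jacobi polynomials \<open>R\<^sub>l (cos t)\<close> are convex combinations of \<open>cos (k * t)\<close>, \<open>k \<le> l\<close>:
  solving the three-term recurrence that the Jacobi equation imposes on the cosine coefficients
  downwards from \<open>k = l\<close> only produces nonnegative numbers when \<open>\<alpha> \<ge> \<beta>\<close>. Hence
  \<open>0 \<le> 1 - R\<^sub>l (cos t) \<le> (l t)^2 / 2\<close>, the variance of \<open>Z x - Z y\<close> is \<open>O(\<rho>^\<nu>)\<close>, and chaining over
  polynomially growing nets bounds the limit from above by a constant.

  For the lower bound take \<open>N\<close> increments over distance \<open>r \<approx> N^-q\<close> along a geodesic. Every \<open>R\<^sub>l\<close> is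
  positive semidefinite on the geodesic, so it is enough to keep the degrees \<open>l \<approx> N^q\<close>; there
  \<open>R\<^sub>l (cos t)\<close> decays in \<open>l t\<close> and the Gram matrix of the increments is diagonally dominant. The
  Gram--Schmidt innovations then have variance at least of order \<open>r^\<nu>\<close>, and the largest of the \<open>N\<close>
  increments exceeds a multiple of \<open>r powr (\<nu> / 2) * sqrt (ln N)\<close> with probability tending to 1.

  The limit exists by monotonicity. It is constant because Gram--Schmidt orthogonalization of \<open>Z\<close> on a
  dense sequence writes \<open>Z\<close> as a sum of independent terms \<open>a\<^sub>i(x) \<xi>\<^sub>i\<close> with
  \<open>a\<^sub>i(x) - a\<^sub>i(y) = O(\<rho> powr (\<nu> / 2))\<close> by the Cauchy--Schwarz inequality: thanks to the logarithm
  in the gauge, no finite number of terms affects the limit, and Kolmogorov's zero-one law applies.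
\<close>

section \<open>Geodesic arcs and nets\<close>

text \<open>What shapes the proof is how little is asked of the space: one isometric copy of
  \<open>[0, 1]\<close>, nets whose size is at most exponential in the scale index, and three
  inequalities for \<open>\<alpha>\<close> and \<open>\<beta>\<close>. No addition theorem or
  isometry group enters, because nonnegative cosine coefficients already give positive
  semidefiniteness along an arc.

  The decay exponent \<open>m\<close> of the Jacobi polynomials may be far from the true one: the
  lower bound is free to take \<open>q\<close> large, and since \<open>|ln r|\<close> grows like
  \<open>q * ln N\<close>, a large \<open>q\<close> costs only a factor \<open>sqrt q\<close> in the
  constant. \<open>\<kappa>\<close> is not computed; it is squeezed between some
  \<open>c > 0\<close> and some finite \<open>C\<close>, so all constants may be crude.

  Joint normality is available only through linear combinations, so independence of the Gram-Schmidt
  terms is drawn from characteristic functions. The limit is first studied on a dense sequence,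
  where measurability is clear; continuity of the sample paths carries it to all pairs.\<close>

lemma sin_ge_half:
  assumes "0 \<le> t" "t \<le> (1::real)" shows "t / 2 \<le> sin t"
proof -
  have "sin 0 - 0 / 2 \<le> sin t - t / 2"
  proof (rule DERIV_nonneg_imp_nondecreasing[where f = "\<lambda>t. sin t - t / 2"])
    fix x :: real assume x: "0 \<le> x" "x \<le> t"
    have "cos x \<ge> cos (pi/3)" using x assms pi_gt3 by (intro cos_monotone_0_pi_le) auto
    then show "\<exists>y. ((\<lambda>t. sin t - t / 2) has_real_derivative y) (at x) \<and> 0 \<le> y"
      by (intro exI[of _ "cos x - 1 / 2"]) (auto intro!: derivative_eq_intros simp: cos_60)
  qed fact
  then show ?thesis by simp
qed

text \<open>Past 1 the sine is at least 1/2, while \<open>t / 4 \<le> pi / 8 < 1 / 2\<close>. A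
  Lipschitz comparison is all that is wanted, so the constant is crude.\<close>

lemma sin_ge_quarter:
  assumes "0 \<le> t" "t \<le> pi / 2" shows "t / 4 \<le> sin t"
proof (cases "t \<le> 1")
  case True
  then show ?thesis using sin_ge_half[of t] assms by simp
next
  case False
  have "1 / 2 \<le> sin (1::real)" using sin_ge_half[of 1] by simp
  also have "\<dots> \<le> sin t" using False assms by (intro sin_monotone_2pi_le) auto
  finally show ?thesis using assms pi_less_4 by linarith
qed

text \<open>The root is the chord between unit vectors with inner product \<open>c\<close>, that is
  \<open>2 * sin (r / 2)\<close>. Angles are thereby controlled by Euclidean distances, hence by
  coordinates.\<close>

lemma arccos_le_sqrt:
  assumes "\<bar>c\<bar> \<le> 1" shows "arccos c \<le> 4 * sqrt (2 - 2 * c)"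
proof -
  define r where "r = arccos c"
  have r: "0 \<le> r" "r \<le> pi" "cos r = c" using assms arccos[of c] by (auto simp: r_def)
  have "2 - 2 * c = (2 * sin (r / 2))\<^sup>2"
    using cos_double_sin[of "r / 2"] r by (simp add: power_mult_distrib)
  moreover have "sin (r / 2) \<ge> r / 2 / 4" using r by (intro sin_ge_quarter) auto
  ultimately show ?thesis using r by (simp only: r_def[symmetric] real_sqrt_abs)
qed

text \<open>Length 1 stays well below \<open>pi\<close>, the largest distance, so one arc works for
  all five families.\<close>

definition has_geodesic_arc :: "'p metric \<Rightarrow> bool" where
  "has_geodesic_arc M \<longleftrightarrow> (\<exists>p. \<forall>s\<in>{0..1::real}. \<forall>t\<in>{0..1}. p s \<in> mspace M \<and> mdist M (p s) (p t) = \<bar>s - t\<bar>)"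

text \<open>At scale \<open>2 ^ (- k)\<close> the bound \<open>A * B ^ k\<close> is polynomial in
  the inverse radius. \<open>B\<close> is not tied to the dimension: chaining only uses that the
  logarithm of the size is linear in \<open>k\<close>.\<close>

definition has_polynomial_nets :: "'p metric \<Rightarrow> bool" where
  "has_polynomial_nets M \<longleftrightarrow> (\<exists>A B. A > 0 \<and> B > 0 \<and> (\<forall>k. \<exists>T. finite T \<and> T \<subseteq> mspace M \<and>
     real (card T) \<le> A * B ^ k \<and> (\<forall>x\<in>mspace M. \<exists>y\<in>T. mdist M x y \<le> (1 / 2) ^ k)))"

text \<open>Pigeonhole: multiply the coordinates by \<open>m\<close>, round down, and keep one point
  of each occupied cell. Two points of a cell differ by at most \<open>1 / m\<close> in every
  coordinate, and taking representatives from \<open>S\<close> keeps the net inside the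
  space.\<close>

lemma polynomial_nets_coords:
  fixes c :: "'i \<Rightarrow> 'b \<Rightarrow> real"
  assumes I: "finite I" and S: "\<pi> ` S = mspace M"
    and c1: "\<And>i x. i \<in> I \<Longrightarrow> x \<in> S \<Longrightarrow> \<bar>c i x\<bar> \<le> 1"
    and d: "\<And>x y. x \<in> S \<Longrightarrow> y \<in> S \<Longrightarrow> mdist M (\<pi> x) (\<pi> y) \<le> C * (\<Sum>i\<in>I. \<bar>c i x - c i y\<bar>)"
    and C: "C > 0"
  shows "has_polynomial_nets M"
proof -
  \<comment> \<open>\<open>N\<close> absorbs \<open>C * card I\<close>, so that mesh
    \<open>m = N * 2 ^ k\<close> yields error at most \<open>2 ^ (- k)\<close>. With
    \<open>2 * m + 1 \<le> 3 * m\<close> the cell count takes the form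
    \<open>A * B ^ k\<close>.\<close>
  define N where "N = nat \<lceil>C * real (card I)\<rceil> + 1"
  have N: "C * real (card I) \<le> real N" "N \<ge> 1" unfolding N_def by (auto, linarith)
  show ?thesis
    unfolding has_polynomial_nets_def
  proof (rule exI[of _ "real ((3 * N) ^ card I)"], rule exI[of _ "real (2 ^ card I)"], intro conjI allI)
    fix k :: nat
    define m where "m = N * 2 ^ k"
    have m: "m > 0" using N by (simp add: m_def)
    define cell where "cell x = restrict (\<lambda>i. \<lfloor>real m * c i x\<rfloor>) I" for x
    have cell: "cell ` S \<subseteq> I \<rightarrow>\<^sub>E {- int m..int m}"
    proof (rule image_subsetI)
      fix x assume x: "x \<in> S"
      have "\<lfloor>real m * c i x\<rfloor> \<in> {- int m..int m}" if "i \<in> I" for i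
      proof -
        have "\<bar>real m * c i x\<bar> \<le> real m * 1" unfolding abs_mult using c1[OF that x] by (intro mult_mono) auto
        then show ?thesis by (auto simp: floor_le_iff le_floor_iff abs_le_iff)
      qed
      then show "cell x \<in> I \<rightarrow>\<^sub>E {- int m..int m}" by (auto simp: cell_def)
    qed
    define g where "g = inv_into S cell"
    define T where "T = \<pi> ` g ` cell ` S"
    have fin: "finite (cell ` S)" using cell I by (meson finite_PiE finite_atLeastAtMost_int finite_subset)
    have gS: "g z \<in> S" "cell (g z) = z" if "z \<in> cell ` S" for z
      using that by (auto simp: g_def inv_into_into f_inv_into_f)
    show "\<exists>T. finite T \<and> T \<subseteq> mspace M \<and> real (card T) \<le> real ((3 * N) ^ card I) * real (2 ^ card I) ^ k \<and>
        (\<forall>x\<in>mspace M. \<exists>y\<in>T. mdist M x y \<le> (1 / 2) ^ k)"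
    proof (rule exI[of _ T], intro conjI ballI)
      show "finite T" using fin by (simp add: T_def)
      show "T \<subseteq> mspace M" using gS S by (auto simp: T_def)
      have "card T \<le> card (cell ` S)" unfolding T_def using fin
        by (meson card_image_le finite_imageI le_trans)
      also have "\<dots> \<le> card (I \<rightarrow>\<^sub>E {- int m..int m})" using cell I by (intro card_mono finite_PiE) auto
      also have "\<dots> = (2 * m + 1) ^ card I" using I by (simp add: card_PiE nat_add_distrib nat_mult_distrib)
      also have "\<dots> \<le> (3 * m) ^ card I" using m by (intro power_mono) auto
      also have "\<dots> = (3 * N) ^ card I * (2 ^ card I) ^ k"
        by (simp add: m_def power_mult_distrib power_mult[symmetric] mult.commute)
      finally have "real (card T) \<le> real ((3 * N) ^ card I * (2 ^ card I) ^ k)" by (simp only: of_nat_le_iff)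
      then show "real (card T) \<le> real ((3 * N) ^ card I) * real (2 ^ card I) ^ k" by simp
      fix x assume "x \<in> mspace M"
      then obtain z where z: "z \<in> S" "x = \<pi> z" using S by auto
      have y: "g (cell z) \<in> S" "cell (g (cell z)) = cell z" using gS z by auto
      have "\<bar>c i z - c i (g (cell z))\<bar> \<le> 1 / real m" if i: "i \<in> I" for i
      proof -
        have "\<lfloor>real m * c i z\<rfloor> = \<lfloor>real m * c i (g (cell z))\<rfloor>"
          using fun_cong[OF y(2), of i] i by (simp add: cell_def)
        then have "\<bar>real m * c i z - real m * c i (g (cell z))\<bar> \<le> 1" by linarith
        then have "real m * \<bar>c i z - c i (g (cell z))\<bar> \<le> 1"
          by (metis abs_mult abs_of_nat right_diff_distrib)
        then show ?thesis using m by (simp add: field_simps)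
      qed
      then have "(\<Sum>i\<in>I. \<bar>c i z - c i (g (cell z))\<bar>) \<le> (\<Sum>i\<in>I. 1 / real m)" by (rule sum_mono)
      then have "C * (\<Sum>i\<in>I. \<bar>c i z - c i (g (cell z))\<bar>) \<le> C * real (card I) / real m"
        using C mult_left_mono[of _ _ C] by fastforce
      also have "\<dots> \<le> real N / real m" using N by (intro divide_right_mono) auto
      also have "\<dots> = (1 / 2) ^ k" using N by (simp add: m_def power_one_over)
      finally have "mdist M x (\<pi> (g (cell z))) \<le> (1 / 2) ^ k" using d[OF z(1) y(1)] z by simp
      then show "\<exists>y\<in>T. mdist M x y \<le> (1 / 2) ^ k" using z by (auto simp: T_def)
    qed
  qed (use N in auto)
qed

section \<open>Spheres and projective spaces through unit vectors\<close>

lemma unit_vectors_inner: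
  fixes x y :: "nat \<Rightarrow> 'a::euclidean_space"
  assumes "x \<in> unit_vectors n" "y \<in> unit_vectors n"
  shows "\<bar>\<Sum>i\<le>n. x i \<bullet> y i\<bar> \<le> 1"
    "arccos (\<Sum>i\<le>n. x i \<bullet> y i) \<le> 4 * (\<Sum>(i, b)\<in>{..n} \<times> Basis. \<bar>x i \<bullet> b - y i \<bullet> b\<bar>)"
proof -
  define c where "c = (\<Sum>i\<le>n. x i \<bullet> y i)"
  have xy: "(\<Sum>i\<le>n. (norm (x i))\<^sup>2) = 1" "(\<Sum>i\<le>n. (norm (y i))\<^sup>2) = 1"
    using assms by (auto simp: unit_vectors_def)
  have diff: "(\<Sum>i\<le>n. (norm (x i - y i))\<^sup>2) = 2 - 2 * c"
  proof -
    have "(\<Sum>i\<le>n. (norm (x i - y i))\<^sup>2) = (\<Sum>i\<le>n. (norm (x i))\<^sup>2 + (norm (y i))\<^sup>2 - 2 * (x i \<bullet> y i))"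
      by (simp add: power2_norm_eq_inner inner_diff inner_commute algebra_simps)
    then show ?thesis by (simp add: sum.distrib sum_subtractf xy c_def sum_distrib_left)
  qed
  have add: "(\<Sum>i\<le>n. (norm (x i + y i))\<^sup>2) = 2 + 2 * c"
  proof -
    have "(\<Sum>i\<le>n. (norm (x i + y i))\<^sup>2) = (\<Sum>i\<le>n. (norm (x i))\<^sup>2 + (norm (y i))\<^sup>2 + 2 * (x i \<bullet> y i))"
      by (simp add: power2_norm_eq_inner inner_add inner_commute algebra_simps)
    then show ?thesis by (simp add: sum.distrib xy c_def sum_distrib_left)
  qed
  \<comment> \<open>Both are sums of squares, which gives Cauchy-Schwarz for unit vectors.\<close>
  have "0 \<le> 2 - 2 * c" "0 \<le> 2 + 2 * c" unfolding diff[symmetric] add[symmetric] by (auto intro!: sum_nonneg)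
  then have c: "\<bar>c\<bar> \<le> 1" by auto
  then show "\<bar>\<Sum>i\<le>n. x i \<bullet> y i\<bar> \<le> 1" by (simp add: c_def)
  have "arccos c \<le> 4 * sqrt (2 - 2 * c)" using c by (rule arccos_le_sqrt)
  also have "sqrt (2 - 2 * c) = L2_set (\<lambda>i. norm (x i - y i)) {..n}" by (simp add: L2_set_def diff)
  also have "\<dots> \<le> (\<Sum>i\<le>n. norm (x i - y i))" by (rule L2_set_le_sum) auto
  also have "\<dots> \<le> (\<Sum>i\<le>n. \<Sum>b\<in>Basis. \<bar>x i \<bullet> b - y i \<bullet> b\<bar>)"
    by (intro sum_mono order.trans[OF norm_le_l1]) (simp add: inner_diff_left)
  also have "\<dots> = (\<Sum>(i, b)\<in>{..n} \<times> Basis. \<bar>x i \<bullet> b - y i \<bullet> b\<bar>)" by (simp add: sum.cartesian_product)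
  finally show "arccos (\<Sum>i\<le>n. x i \<bullet> y i) \<le> 4 * (\<Sum>(i, b)\<in>{..n} \<times> Basis. \<bar>x i \<bullet> b - y i \<bullet> b\<bar>)"
    by (simp add: c_def)
qed

lemma unit_vectors_coord:
  fixes x :: "nat \<Rightarrow> 'a::euclidean_space"
  assumes "x \<in> unit_vectors n" "i \<le> n" "b \<in> Basis"
  shows "\<bar>x i \<bullet> b\<bar> \<le> 1"
proof -
  have "(norm (x i))\<^sup>2 \<le> (\<Sum>i\<le>n. (norm (x i))\<^sup>2)" using assms by (intro member_le_sum) auto
  also have "\<dots> = 1" using assms by (simp add: unit_vectors_def)
  finally have "norm (x i) \<le> 1" by (simp add: power2_le_imp_le abs_square_le_1[of "norm (x i)", simplified])
  then show ?thesis using Basis_le_norm[OF assms(3), of "x i"] by linarith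
qed

text \<open>Twice the angle between representatives dominates both distances: on the sphere
  trivially, on projective spaces because the modulus of the Hermitian product is at least its real
  part.\<close>

lemma nets_unit_vectors:
  fixes \<pi> :: "(nat \<Rightarrow> 'a::euclidean_space) \<Rightarrow> 'p"
  assumes "\<pi> ` unit_vectors n = mspace M"
    and "\<And>x y. x \<in> unit_vectors n \<Longrightarrow> y \<in> unit_vectors n \<Longrightarrow> mdist M (\<pi> x) (\<pi> y) \<le> 2 * arccos (\<Sum>i\<le>n. x i \<bullet> y i)"
  shows "has_polynomial_nets M"
proof (rule polynomial_nets_coords[where I = "{..n} \<times> Basis" and S = "unit_vectors n" and \<pi> = \<pi> and C = 8
      and c = "\<lambda>(i, b) x. x i \<bullet> b"])
  fix x y :: "nat \<Rightarrow> 'a" assume xy: "x \<in> unit_vectors n" "y \<in> unit_vectors n"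
  have "mdist M (\<pi> x) (\<pi> y) \<le> 2 * arccos (\<Sum>i\<le>n. x i \<bullet> y i)" by (rule assms(2)[OF xy])
  also have "\<dots> \<le> 2 * (4 * (\<Sum>(i, b)\<in>{..n} \<times> Basis. \<bar>x i \<bullet> b - y i \<bullet> b\<bar>))"
    using unit_vectors_inner(2)[OF xy] by simp
  finally show "mdist M (\<pi> x) (\<pi> y) \<le> 8 * (\<Sum>i\<in>{..n} \<times> Basis. \<bar>(case i of (i, b) \<Rightarrow> \<lambda>x. x i \<bullet> b) x - (case i of (i, b) \<Rightarrow> \<lambda>x. x i \<bullet> b) y\<bar>)"
    by (simp add: case_prod_unfold)
qed (use assms(1) unit_vectors_coord in auto)

text \<open>A great circle in a real coordinate plane. With \<open>e\<close> the unit of the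
  algebra, Hermitian products along it are real multiples of \<open>e\<close>.\<close>

definition circle_vector :: "'a::real_normed_vector \<Rightarrow> real \<Rightarrow> nat \<Rightarrow> 'a" where
  "circle_vector e t i = (if i = 0 then cos t else if i = 1 then sin t else 0) *\<^sub>R e"

lemma sum_first_two:
  fixes f :: "nat \<Rightarrow> 'a::comm_monoid_add"
  assumes "n \<ge> 1" "\<And>i. i \<ge> 2 \<Longrightarrow> f i = 0" shows "(\<Sum>i\<le>n. f i) = f 0 + f 1"
proof -
  have "(\<Sum>i\<le>n. f i) = (\<Sum>i\<in>{0,1}. f i)"
    using assms by (intro sum.mono_neutral_right) (auto simp: not_less_eq_eq numeral_2_eq_2)
  then show ?thesis by simp
qed

lemma circle_vector_unit:
  assumes "norm e = 1" "n \<ge> 1" shows "circle_vector e t \<in> unit_vectors n"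
proof -
  have "(\<Sum>i\<le>n. (norm (circle_vector e t i))\<^sup>2) = (norm (circle_vector e t 0))\<^sup>2 + (norm (circle_vector e t 1))\<^sup>2"
    using assms(2) by (intro sum_first_two) (auto simp: circle_vector_def)
  then show ?thesis using assms by (auto simp: unit_vectors_def circle_vector_def)
qed

lemma arccos_cos_diff:
  assumes "s \<in> {0..1}" "t \<in> {0..1}" shows "arccos (cos (s - t)) = \<bar>s - t\<bar>"
proof -
  have "arccos (cos \<bar>s - t\<bar>) = \<bar>s - t\<bar>" using assms pi_gt3 by (intro arccos_cos) auto
  then show ?thesis by simp
qed

lemma is_sphere_geometry:
  assumes "is_sphere d M" "d \<ge> 1"
  shows "has_geodesic_arc M \<and> has_polynomial_nets M"
proof -
  from assms obtain \<pi> :: "(nat \<Rightarrow> real) \<Rightarrow> _" where bij: "bij_betw \<pi> (unit_vectors d) (mspace M)"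
    and d: "\<And>x y. x \<in> unit_vectors d \<Longrightarrow> y \<in> unit_vectors d \<Longrightarrow> mdist M (\<pi> x) (\<pi> y) = arccos (\<Sum>i\<le>d. x i * y i)"
    unfolding is_sphere_def by blast
  have im: "\<pi> ` unit_vectors d = mspace M" using bij by (simp add: bij_betw_def)
  have "has_polynomial_nets M"
  proof (rule nets_unit_vectors[OF im])
    fix x y :: "nat \<Rightarrow> real" assume xy: "x \<in> unit_vectors d" "y \<in> unit_vectors d"
    have "0 \<le> arccos (\<Sum>i\<le>d. x i \<bullet> y i)" using unit_vectors_inner(1)[OF xy] by (intro arccos_lbound) auto
    then show "mdist M (\<pi> x) (\<pi> y) \<le> 2 * arccos (\<Sum>i\<le>d. x i \<bullet> y i)" using d[OF xy] by simp
  qed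
  moreover have "has_geodesic_arc M"
    unfolding has_geodesic_arc_def
  proof (intro exI[of _ "\<lambda>t. \<pi> (circle_vector 1 t)"] ballI)
    fix s t :: real assume st: "s \<in> {0..1}" "t \<in> {0..1}"
    have u: "circle_vector (1::real) t \<in> unit_vectors d" for t by (rule circle_vector_unit) (use assms in auto)
    have "(\<Sum>i\<le>d. circle_vector (1::real) s i * circle_vector 1 t i) = cos (s - t)"
      using assms by (subst sum_first_two) (auto simp: circle_vector_def cos_diff)
    then show "\<pi> (circle_vector 1 s) \<in> mspace M \<and> mdist M (\<pi> (circle_vector 1 s)) (\<pi> (circle_vector 1 t)) = \<bar>s - t\<bar>"
      using d[OF u u, of s t] im u arccos_cos_diff[OF st] by auto
  qed
  ultimately show ?thesis by simp
qed

text \<open>The algebra enters through three facts: the norm bound keeps the Hermitian product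
  within the domain of \<open>arccos\<close>; its \<open>e\<close>-part is the Euclidean inner
  product, so lines enclose no larger angle than their representatives; and real multiples of
  \<open>e\<close> multiply like reals, which gives the arc.\<close>

lemma is_projective_space_geometry:
  fixes mul :: "'f::euclidean_space \<Rightarrow> 'f \<Rightarrow> 'f"
  assumes P: "is_projective_space mul cj n M" and n: "n \<ge> 1" and e: "norm e = 1"
    and norm_mul: "\<And>a b. norm (mul (cj a) b) \<le> norm a * norm b"
    and inner_mul: "\<And>a b. mul (cj a) b \<bullet> e = a \<bullet> b"
    and scale: "\<And>r s. mul (cj (r *\<^sub>R e)) (s *\<^sub>R e) = (r * s) *\<^sub>R e"
  shows "has_geodesic_arc M \<and> has_polynomial_nets M"
proof -
  from P obtain \<pi> :: "(nat \<Rightarrow> 'f) \<Rightarrow> _" where im: "\<pi> ` unit_vectors n = mspace M"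
    and d: "\<And>x y. x \<in> unit_vectors n \<Longrightarrow> y \<in> unit_vectors n \<Longrightarrow>
        mdist M (\<pi> x) (\<pi> y) = 2 * arccos (norm (herm mul cj n x y))"
    unfolding is_projective_space_def by blast
  have "has_polynomial_nets M"
  proof (rule nets_unit_vectors[OF im])
    fix x y :: "nat \<Rightarrow> 'f" assume xy: "x \<in> unit_vectors n" "y \<in> unit_vectors n"
    have "(\<Sum>i\<le>n. x i \<bullet> y i) = herm mul cj n x y \<bullet> e" by (simp add: herm_def inner_sum_left inner_mul)
    also have "\<dots> \<le> norm (herm mul cj n x y)" using norm_cauchy_schwarz[of "herm mul cj n x y" e] e by simp
    finally have 1: "(\<Sum>i\<le>n. x i \<bullet> y i) \<le> norm (herm mul cj n x y)" .
    have "norm (herm mul cj n x y) \<le> (\<Sum>i\<le>n. norm (x i) * norm (y i))"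
      unfolding herm_def by (intro order.trans[OF norm_sum] sum_mono norm_mul)
    also have "\<dots> \<le> (\<Sum>i\<le>n. (norm (x i))\<^sup>2 / 2 + (norm (y i))\<^sup>2 / 2)"
      by (intro sum_mono) (use sum_squares_bound[of "norm (x _)" "norm (y _)"] in \<open>simp add: field_simps\<close>)
    also have "\<dots> = 1" using xy by (simp add: sum.distrib sum_divide_distrib[symmetric] unit_vectors_def)
    finally have 2: "norm (herm mul cj n x y) \<le> 1" .
    show "mdist M (\<pi> x) (\<pi> y) \<le> 2 * arccos (\<Sum>i\<le>n. x i \<bullet> y i)"
      unfolding d[OF xy] using 1 2 unit_vectors_inner(1)[OF xy] by (intro mult_left_mono arccos_le_arccos) auto
  qed
  moreover have "has_geodesic_arc M"
    unfolding has_geodesic_arc_def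
  \<comment> \<open>Parameter \<open>t / 2\<close>, since the distance is twice the angle. The half
    angles differ by at most 1/2, so the cosine is nonnegative and the norm does not change
    it.\<close>
  proof (intro exI[of _ "\<lambda>t. \<pi> (circle_vector e (t / 2))"] ballI)
    fix s t :: real assume st: "s \<in> {0..1}" "t \<in> {0..1}"
    have u: "circle_vector e t \<in> unit_vectors n" for t by (rule circle_vector_unit) (use n e in auto)
    have z: "mul (cj 0) 0 = 0" using scale[of 0 0] by simp
    have "herm mul cj n (circle_vector e (s / 2)) (circle_vector e (t / 2)) = cos (s / 2 - t / 2) *\<^sub>R e"
      unfolding herm_def using n
      by (subst sum_first_two) (auto simp: circle_vector_def cos_diff scale scaleR_add_left z)
    moreover have "cos (s / 2 - t / 2) \<ge> 0" using st pi_gt3 by (intro cos_ge_zero) auto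
    moreover have "arccos (cos (s / 2 - t / 2)) = \<bar>s / 2 - t / 2\<bar>" using st by (intro arccos_cos_diff) auto
    moreover have "2 * \<bar>s / 2 - t / 2\<bar> = \<bar>s - t\<bar>" by (simp add: abs_if field_simps)
    ultimately show "\<pi> (circle_vector e (s / 2)) \<in> mspace M \<and>
        mdist M (\<pi> (circle_vector e (s / 2))) (\<pi> (circle_vector e (t / 2))) = \<bar>s - t\<bar>"
      using d[OF u u, of "s / 2" "t / 2"] im u e by auto
  qed
  ultimately show ?thesis by simp
qed

section \<open>Quaternion and octonion identities, and the Cayley plane\<close>

lemma cd_mult_Pair: "cd_mult mul cj (a, b) (c, d) = (mul a c - mul d (cj b), mul (cj a) d + mul c b)"
  by (simp add: cd_mult_def)
lemma cd_cnj_Pair: "cd_cnj cj (a, b) = (cj a, - b)" by (simp add: cd_cnj_def)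

text \<open>Euler's four-square identity, verified as a polynomial identity in real and imaginary
  parts.\<close>

lemma quat_norm_mult: "norm (quat_mult (quat_cnj a) b) = norm a * norm b"
proof -
  obtain a1 a2 b1 b2 where ab: "a = (a1, a2)" "b = (b1, b2)" by (metis surj_pair)
  have "(cmod (cnj a1 * b1 + b2 * cnj a2))\<^sup>2 + (cmod (a1 * b2 - b1 * a2))\<^sup>2 = ((cmod a1)\<^sup>2 + (cmod a2)\<^sup>2) * ((cmod b1)\<^sup>2 + (cmod b2)\<^sup>2)"
    unfolding cmod_power2 by simp algebra
  then have "(norm (quat_mult (quat_cnj a) b))\<^sup>2 = (norm a * norm b)\<^sup>2"
    unfolding ab quat_mult_def quat_cnj_def cd_mult_Pair cd_cnj_Pair power_mult_distrib norm_Pair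
    by simp
  then show ?thesis by (simp add: power2_eq_iff_nonneg)
qed
text \<open>Lets the trace of the square of a Hermitian octonionic matrix be read as its squared
  Euclidean norm.\<close>

lemma oct_mult_cnj_inner_one: "oct_mult a (oct_cnj a) \<bullet> oct_one = a \<bullet> (a::octonion)"
proof -
    obtain a1 a2 a3 a4 where a: "a = ((a1, a2), (a3, a4))" by (metis surj_pair)
    show ?thesis unfolding a oct_mult_def oct_cnj_def oct_one_def quat_mult_def quat_cnj_def cd_mult_Pair cd_cnj_Pair
     by (simp add: inner_complex_def cd_mult_Pair)
qed

text \<open>Idempotency and trace 1 put the points on the Euclidean unit sphere of the matrix space.
  Chords then control distances, and real rank-one projections supply the arc.\<close>

lemma is_cayley_plane_geometry:
  assumes "is_cayley_plane M"
  shows "has_geodesic_arc M \<and> has_polynomial_nets M"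
proof -
  from assms obtain \<pi> :: "octonion^3^3 \<Rightarrow> _" where bij: "bij_betw \<pi> cayley_points (mspace M)"
    and d: "\<And>A B. A \<in> cayley_points \<Longrightarrow> B \<in> cayley_points \<Longrightarrow> mdist M (\<pi> A) (\<pi> B) = 2 * arccos (sqrt (A \<bullet> B))"
    unfolding is_cayley_plane_def by blast
  have im: "\<pi> ` cayley_points = mspace M" using bij by (simp add: bij_betw_def)
  have one: "oct_one \<bullet> oct_one = 1" by (simp add: oct_one_def inner_complex_def)
  have norm1: "norm A = 1" if A: "A \<in> cayley_points" for A
  proof -
    have h: "A $ j $ i = oct_cnj (A $ i $ j)" for i j using A unfolding cayley_points_def by blast
    have i: "(\<Sum>k\<in>UNIV. oct_mult (A $ i $ k) (A $ k $ j)) = A $ i $ j" for i j using A unfolding cayley_points_def by blast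
    have t: "(\<Sum>i\<in>UNIV. A $ i $ i) = oct_one" using A unfolding cayley_points_def by blast
    \<comment> \<open>By Hermitian symmetry the squared norm is the trace of the matrix square;
      idempotency reduces it to the trace of \<open>A\<close>, which is 1.\<close>
    have "A \<bullet> A = (\<Sum>i\<in>UNIV. \<Sum>k\<in>UNIV. A $ i $ k \<bullet> A $ i $ k)" by (simp add: inner_vec_def)
    also have "\<dots> = (\<Sum>i\<in>UNIV. \<Sum>k\<in>UNIV. oct_mult (A $ i $ k) (A $ k $ i) \<bullet> oct_one)"
      by (intro sum.cong refl) (metis h oct_mult_cnj_inner_one)
    also have "\<dots> = (\<Sum>i\<in>UNIV. A $ i $ i) \<bullet> oct_one" by (simp add: inner_sum_left[symmetric] i)
    also have "\<dots> = 1" using t one by simp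
    finally show ?thesis by (simp add: norm_eq_sqrt_inner)
  qed
  have "has_polynomial_nets M"
  proof (rule polynomial_nets_coords[where I = "Basis :: (octonion^3^3) set" and S = cayley_points and \<pi> = \<pi> and C = 8
      and c = "\<lambda>b x. x \<bullet> b"])
    fix A B assume AB: "A \<in> cayley_points" "B \<in> cayley_points"
    have n1: "norm A = 1" "norm B = 1" using AB norm1 by auto
    define c where "c = A \<bullet> B"
    have c: "\<bar>c\<bar> \<le> 1" using Cauchy_Schwarz_ineq2[of A B] n1 by (simp add: c_def)
    have nd: "(norm (A - B))\<^sup>2 = 2 - 2 * c"
      using n1 by (simp add: power2_norm_eq_inner inner_diff inner_commute c_def norm_eq_1)
    have "arccos (sqrt c) \<le> 4 * norm (A - B)"
    proof (cases "c \<ge> 0")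
      case True
      have "c * c \<le> c * 1" using True c by (intro mult_left_mono) auto
      then have "c \<le> sqrt c" by (intro real_le_rsqrt) (simp add: power2_eq_square)
      moreover have "sqrt c \<le> 1" using c by simp
      ultimately have "arccos (sqrt c) \<le> arccos c" using True by (intro arccos_le_arccos) auto
      also have "\<dots> \<le> 4 * sqrt (2 - 2 * c)" using c by (rule arccos_le_sqrt)
      finally show ?thesis by (simp add: nd[symmetric])
    next
      \<comment> \<open>The sign of \<open>A \<bullet> B\<close> is not determined here. For
        \<open>c < 0\<close> the odd extension of \<open>sqrt\<close> still yields an angle at most
        \<open>pi < 4\<close>, while the chord is at least 1.\<close>
      case False
      have "sqrt (- c) \<le> 1" using c by (subst real_sqrt_le_1_iff) linarith
      moreover have "sqrt c \<le> 0" using False by simp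
      ultimately have "\<bar>sqrt c\<bar> \<le> 1" by (simp add: real_sqrt_minus)
      then have "arccos (sqrt c) \<le> pi" by (intro arccos_ubound) linarith+
      moreover have "1\<^sup>2 \<le> (norm (A - B))\<^sup>2" unfolding nd using False by simp
      then have "1 \<le> norm (A - B)" by (rule power2_le_imp_le) simp
      ultimately show ?thesis using pi_less_4 by linarith
    qed
    then have "mdist M (\<pi> A) (\<pi> B) \<le> 8 * norm (A - B)" using d[OF AB] by (simp add: c_def)
    also have "\<dots> \<le> 8 * (\<Sum>b\<in>Basis. \<bar>A \<bullet> b - B \<bullet> b\<bar>)"
      using norm_le_l1[of "A - B"] by (simp add: inner_diff_left)
    finally show "mdist M (\<pi> A) (\<pi> B) \<le> 8 * (\<Sum>b\<in>Basis. \<bar>A \<bullet> b - B \<bullet> b\<bar>)" .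
  next
    fix b A assume "b \<in> (Basis :: (octonion^3^3) set)" "A \<in> cayley_points"
    then show "\<bar>A \<bullet> b\<bar> \<le> 1" using Basis_le_norm[of b A] norm1[of A] by simp
  qed (use im in auto)
  moreover have "has_geodesic_arc M"
  proof -
    \<comment> \<open>\<open>A t\<close> is the projection onto a rotating real unit vector. Inner
      products are squared cosines of half-angle differences, and the root in the distance undoes
      the square.\<close>
    define v where "v t = (\<chi> i::3. if i = 1 then cos (t / 2) else if i = 2 then sin (t / 2) else 0)" for t :: real
    define A where "A t = (\<chi> i j. (v t $ i * v t $ j) *\<^sub>R oct_one)" for t
    have vv: "(\<Sum>k\<in>UNIV. v s $ k * v t $ k) = cos (s / 2 - t / 2)" for s t
      by (simp add: v_def sum_3 cos_diff)
    have mul: "oct_mult (r *\<^sub>R oct_one) (s *\<^sub>R oct_one) = (r * s) *\<^sub>R oct_one" for r s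
      by (simp add: oct_mult_def oct_one_def quat_mult_def cd_mult_def quat_cnj_def cd_cnj_def prod_eq_iff)
    have cnj: "oct_cnj (r *\<^sub>R oct_one) = r *\<^sub>R oct_one" for r
      by (simp add: oct_one_def oct_cnj_def quat_cnj_def cd_cnj_def prod_eq_iff)
    have A: "A t \<in> cayley_points" for t
    proof -
      have "(\<Sum>k\<in>UNIV. oct_mult (A t $ i $ k) (A t $ k $ j)) = A t $ i $ j" for i j
      proof -
        have "(\<Sum>k\<in>UNIV. oct_mult (A t $ i $ k) (A t $ k $ j)) = (\<Sum>k\<in>UNIV. (v t $ i * v t $ j) * (v t $ k * v t $ k)) *\<^sub>R oct_one"
          by (simp add: A_def mul scaleR_sum_left mult_ac)
        then show ?thesis unfolding sum_distrib_left[symmetric] vv by (simp add: A_def)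
      qed
      moreover have "(\<Sum>i\<in>UNIV. A t $ i $ i) = oct_one"
        using vv[of t t] by (simp add: A_def scaleR_sum_left[symmetric])
      ultimately show ?thesis by (auto simp: cayley_points_def A_def cnj mult.commute)
    qed
    have inner: "A s \<bullet> A t = (cos (s / 2 - t / 2))\<^sup>2" for s t
    proof -
      have "A s \<bullet> A t = (\<Sum>i\<in>UNIV. \<Sum>j\<in>UNIV. (v s $ i * v t $ i) * (v s $ j * v t $ j))"
        by (simp add: inner_vec_def A_def one mult_ac)
      then show ?thesis unfolding sum_distrib_left[symmetric] sum_distrib_right[symmetric] vv
        by (simp add: power2_eq_square)
    qed
    show ?thesis
      unfolding has_geodesic_arc_def
    proof (intro exI[of _ "\<lambda>t. \<pi> (A t)"] ballI)
      fix s t :: real assume st: "s \<in> {0..1}" "t \<in> {0..1}"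
      have "cos (s / 2 - t / 2) \<ge> 0" using st pi_gt3 by (intro cos_ge_zero) auto
      moreover have "arccos (cos (s / 2 - t / 2)) = \<bar>s / 2 - t / 2\<bar>" using st by (intro arccos_cos_diff) auto
      moreover have "2 * \<bar>s / 2 - t / 2\<bar> = \<bar>s - t\<bar>" by (simp add: abs_if field_simps)
      ultimately show "\<pi> (A s) \<in> mspace M \<and> mdist M (\<pi> (A s)) (\<pi> (A t)) = \<bar>s - t\<bar>"
        using d[OF A A, of s t] im A by (auto simp: inner)
    qed
  qed
  ultimately show ?thesis by simp
qed

text \<open>Beyond this point the five families are indistinguishable. The tightest instance of
  \<open>\<alpha> + \<beta> + 1 > 0\<close> is the real projective plane, with value 1/2.\<close>

lemma compact_two_point_homogeneous_geometry:
  assumes "compact_two_point_homogeneous d \<alpha> \<beta> M"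
  shows "has_geodesic_arc M" "has_polynomial_nets M" "\<alpha> + \<beta> + 1 > 0" "\<alpha> > -1" "\<beta> \<le> \<alpha>"
proof -
  have "(has_geodesic_arc M \<and> has_polynomial_nets M) \<and> \<alpha> + \<beta> + 1 > 0 \<and> \<alpha> > -1 \<and> \<beta> \<le> \<alpha>"
    using assms
  proof cases
    case sphere
    then show ?thesis using is_sphere_geometry[of d M] by (auto simp: field_simps)
  next
    case real_projective
    then show ?thesis using is_projective_space_geometry[of "(*) :: real \<Rightarrow> _" "\<lambda>x. x" d M 1]
      by (auto simp: abs_mult field_simps)
  next
    case (complex_projective n)
    have "has_geodesic_arc M \<and> has_polynomial_nets M"
      by (rule is_projective_space_geometry[OF complex_projective(5), of 1])
        (use complex_projective in \<open>auto simp: norm_mult inner_complex_def\<close>)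
    then show ?thesis using complex_projective by (auto simp: field_simps)
  next
    case (quaternionic_projective n)
    have "has_geodesic_arc M \<and> has_polynomial_nets M"
      by (rule is_projective_space_geometry[OF quaternionic_projective(5), of "(1, 0)"])
        (use quaternionic_projective eq_refl[OF quat_norm_mult] in \<open>auto simp: norm_Pair inner_complex_def quat_mult_def quat_cnj_def
          cd_mult_def cd_cnj_def prod_eq_iff split: prod.splits\<close>)
    then show ?thesis using quaternionic_projective by (auto simp: field_simps)
  next
    case cayley
    then show ?thesis using is_cayley_plane_geometry by auto
  qed
  then show "has_geodesic_arc M" "has_polynomial_nets M" "\<alpha> + \<beta> + 1 > 0" "\<alpha> > -1" "\<beta> \<le> \<alpha>" by auto
qed

section \<open>Cosine expansion of Jacobi polynomials\<close>

text \<open>Chebyshev polynomials in the variable \<open>u = (x - 1) / 2\<close> of the Jacobi sum,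
  where \<open>2 * x\<close> becomes \<open>2 + 4 * u\<close>.\<close>

fun cheb :: "nat \<Rightarrow> real poly" where
  "cheb 0 = 1"
| "cheb (Suc 0) = [:1, 2:]"
| "cheb (Suc (Suc k)) = [:2, 4:] * cheb (Suc k) - cheb k"

lemma poly_cheb: "poly (cheb k) ((cos t - 1) / 2) = cos (real k * t)"
proof (induction k rule: cheb.induct)
  case (3 k)
  have "cos (real (Suc (Suc k)) * t) = 2 * cos t * cos (real (Suc k) * t) - cos (real k * t)"
  proof -
    have "real (Suc (Suc k)) * t = real (Suc k) * t + t" "real k * t = real (Suc k) * t - t"
      by (simp_all add: algebra_simps)
    then show ?thesis by (simp only: cos_add cos_diff) simp
  qed
  moreover have "poly (cheb (Suc (Suc k))) u = (2 + u * 4) * poly (cheb (Suc k)) u - poly (cheb k) u" for u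
    by (simp add: distrib_right mult.assoc)
  moreover have "2 + (cos t - 1) / 2 * 4 = 2 * cos t" by (simp add: field_simps)
  ultimately show ?case by (simp only: 3)
qed (simp_all add: field_simps)

lemma degree_cheb: "degree (cheb k) \<le> k"
proof (induction k rule: cheb.induct)
  case (3 k)
  have "degree ([:2, 4:] * cheb (Suc k)) \<le> degree ([:2, 4:] :: real poly) + degree (cheb (Suc k))"
    by (rule degree_mult_le)
  also have "\<dots> \<le> 1 + Suc k" using 3(1) by (intro add_mono) simp_all
  finally show ?case using 3(2) by (auto intro!: degree_diff_le)
qed simp_all

text \<open>
  The Jacobi differential equation for \<open>y = (\<Sum>k\<le>l. a k * cos (k * t))\<close> amounts to a three-term
  recurrence for \<open>a\<close>; solved downwards from \<open>a l = 1\<close> it has nonnegative coefficients when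
  \<open>\<alpha> \<ge> \<beta>\<close>. The constant term is halved because \<open>sin (-t) = - sin t\<close> folds two contributions into one.
\<close>

fun cos_rec :: "real \<Rightarrow> real \<Rightarrow> nat \<Rightarrow> nat \<Rightarrow> real" where
  "cos_rec \<delta> s l 0 = 1"
| "cos_rec \<delta> s l (Suc 0) = 2 * \<delta> * real l / (2 * real l - 1 + s)"
| "cos_rec \<delta> s l (Suc (Suc n)) =
    (2 * \<delta> * (real l - real n - 1) * cos_rec \<delta> s l (Suc n)
      + (2 * real l - real n) * (real n + s) * cos_rec \<delta> s l n)
    / ((real n + 2) * (2 * real l - real n - 2 + s))"

text \<open>Up to index \<open>l\<close> every factor of the recursion is nonnegative and every
  denominator positive. This is where \<open>\<alpha> \<ge> \<beta>\<close> and
  \<open>\<alpha> + \<beta> + 1 > 0\<close> are spent.\<close>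

lemma cos_rec_nonneg:
  assumes "\<delta> \<ge> 0" "s > 0"
  shows "n \<le> l \<Longrightarrow> cos_rec \<delta> s l n \<ge> 0"
proof (induction n rule: induct_nat_012)
  case (ge2 n)
  then show ?case using assms
    by (auto intro!: divide_nonneg_nonneg add_nonneg_nonneg mult_nonneg_nonneg)
qed (use assms in auto)

text \<open>\<open>cos_rec\<close> runs downwards from the top frequency, hence the index
  \<open>l - k\<close>.\<close>

definition cos_coeff :: "real \<Rightarrow> real \<Rightarrow> nat \<Rightarrow> nat \<Rightarrow> real" where
  "cos_coeff \<delta> s l k = (if k > l then 0 else if k = 0 then cos_rec \<delta> s l l / 2 else cos_rec \<delta> s l (l - k))"

lemma cos_coeff_nonneg: "\<delta> \<ge> 0 \<Longrightarrow> s > 0 \<Longrightarrow> cos_coeff \<delta> s l k \<ge> 0"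
  by (auto simp: cos_coeff_def intro!: cos_rec_nonneg)

lemma cos_coeff_sum_pos:
  assumes "\<delta> \<ge> 0" "s > 0" shows "(\<Sum>k\<le>l. cos_coeff \<delta> s l k) > 0"
proof -
  have "cos_coeff \<delta> s l l > 0" by (auto simp: cos_coeff_def)
  moreover have "cos_coeff \<delta> s l l \<le> (\<Sum>k\<le>l. cos_coeff \<delta> s l k)"
    by (rule member_le_sum) (auto intro!: cos_coeff_nonneg assms)
  ultimately show ?thesis by linarith
qed

text \<open>This is the coefficient of \<open>sin (j * t)\<close> in the Jacobi equation, solved for
  the lower neighbour. The factor 2 at \<open>j = 1\<close> undoes the halving of the constant
  term.\<close>

lemma cos_coeff_rec:
  fixes \<delta> s :: real and l j :: nat
  assumes "s > 0" "j \<ge> 1" "j \<le> l"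
  defines "L \<equiv> real l * (real l + s)" and "a \<equiv> cos_coeff \<delta> s l"
  shows "(if j = 1 then 2 else 1) * ((L - (real j - 1)\<^sup>2 - s * (real j - 1)) * a (j - 1)) =
    2 * \<delta> * real j * a j + (L - (real j + 1)\<^sup>2 + s * (real j + 1)) * a (Suc j)"
proof -
  \<comment> \<open>The eigenvalue \<open>L = l * (l + s)\<close> makes both quadratics split, which
    is why the recursion has explicit factors.\<close>
  have fac: "L - (real j - 1)\<^sup>2 - s * (real j - 1) = (real l - real j + 1) * (real l + real j - 1 + s)"
    "L - (real j + 1)\<^sup>2 + s * (real j + 1) = (real l + real j + 1) * (real l - real j - 1 + s)"
    by (simp_all add: L_def power2_eq_square algebra_simps)
  have b: "(if j = 1 then 2 else 1) * a (j - 1) = cos_rec \<delta> s l (Suc l - j)"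
    using assms(2,3) by (auto simp: a_def cos_coeff_def Suc_diff_le)
  have "cos_rec \<delta> s l (Suc l - j) * ((real l - real j + 1) * (real l + real j - 1 + s)) =
     2 * \<delta> * real j * a j + (real l + real j + 1) * (real l - real j - 1 + s) * a (Suc j)"
  proof (cases "j = l")
    \<comment> \<open>The top equation is the second clause of the recursion, as
      \<open>a (Suc l) = 0\<close>.\<close>
    case True
    then show ?thesis using assms(1-3) by (auto simp: a_def cos_coeff_def field_simps)
  next
    case False
    then obtain n where n: "l = j + Suc n" using assms(3) less_iff_Suc_add[of j l] by auto
    define X Y Z where "X = cos_rec \<delta> s l (Suc (Suc n))" and "Y = cos_rec \<delta> s l (Suc n)" and "Z = cos_rec \<delta> s l n"
    have rl: "real l = real j + real n + 1" using n by simp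
    have "Suc l - j = Suc (Suc n)" using n by simp
    then have XYZ: "cos_rec \<delta> s l (Suc l - j) = X" "a j = Y" "a (Suc j) = Z"
      using assms(2) n by (auto simp: a_def cos_coeff_def X_def Y_def Z_def)
    have "(real n + 2) * (2 * real l - real n - 2 + s) \<noteq> 0"
      using assms(1,2) n by auto
    then have "X * ((real n + 2) * (2 * real l - real n - 2 + s)) =
       2 * \<delta> * (real l - real n - 1) * Y + (2 * real l - real n) * (real n + s) * Z"
      by (simp add: X_def Y_def Z_def)
    then show ?thesis unfolding XYZ rl by (simp add: algebra_simps)
  qed
  then show ?thesis unfolding fac using b by (simp add: algebra_simps)
qed

text \<open>Trigonometric Jacobi equation, cleared of its denominator \<open>sin t\<close>.
  Product-to-sum formulas make the left side a sine polynomial, whose coefficients vanish by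
  \<open>cos_coeff_rec\<close>.\<close>

lemma cos_coeff_ode:
  fixes \<delta> s t :: real and l :: nat
  assumes "s > 0"
  defines "L \<equiv> real l * (real l + s)" and "a \<equiv> cos_coeff \<delta> s l"
  shows "sin t * (\<Sum>k\<le>l. a k * (- (real k)\<^sup>2 * cos (real k * t)))
    + (\<delta> + s * cos t) * (\<Sum>k\<le>l. a k * (- real k * sin (real k * t)))
    + L * sin t * (\<Sum>k\<le>l. a k * cos (real k * t)) = 0"
proof -
  define u where "u k = (L - (real k)\<^sup>2 - s * real k) * a k" for k
  define v where "v k = (L - (real k)\<^sup>2 + s * real k) * a k" for k
  define w where "w k = 2 * \<delta> * real k * a k" for k
  define S where "S k = sin (real k * t)" for k
  have ss: "sin t * cos (x * t) = (sin ((x+1) * t) - sin ((x-1)*t)) / 2"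
    "cos t * sin (x * t) = (sin ((x+1) * t) + sin ((x-1)*t)) / 2" for x
    by (simp_all add: sin_add sin_diff algebra_simps)
  have "2 * (sin t * (\<Sum>k\<le>l. a k * (- (real k)\<^sup>2 * cos (real k * t)))
    + (\<delta> + s * cos t) * (\<Sum>k\<le>l. a k * (- real k * sin (real k * t)))
    + L * sin t * (\<Sum>k\<le>l. a k * cos (real k * t))) =
    (\<Sum>k\<le>l. 2 * ((L - (real k)\<^sup>2) * a k * (sin t * cos (real k * t)) - s * real k * a k * (cos t * sin (real k * t)) - \<delta> * real k * a k * S k))"
    by (simp add: S_def sum_distrib_left sum.distrib sum_subtractf sum_negf algebra_simps)
  also have "\<dots> = (\<Sum>k\<le>l. u k * sin ((real k + 1) * t) - v k * sin ((real k - 1) * t) - w k * S k)"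
    unfolding ss by (intro sum.cong refl) (simp add: u_def v_def w_def field_simps)
  also have "\<dots> = (\<Sum>k\<le>l. u k * S (Suc k)) - (\<Sum>k\<le>l. v k * sin ((real k - 1) * t)) - (\<Sum>k\<le>l. w k * S k)"
    by (simp add: S_def sum_subtractf add.commute)
  also have "\<dots> = 0"
  proof (cases "l = 0")
    case True then show ?thesis by (simp add: u_def v_def w_def S_def L_def)
  next
    case False
    have z: "a k = 0" if "k > l" for k using that by (simp add: a_def cos_coeff_def)
    \<comment> \<open>The eigenvalue is such that frequency \<open>l + 1\<close> drops out.\<close>
    have ul: "u l = 0" by (simp add: u_def L_def power2_eq_square algebra_simps)
    have A: "(\<Sum>k\<le>l. u k * S (Suc k)) = (\<Sum>j=1..l. u (j - 1) * S j)"
    proof -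
      have "(\<Sum>k\<le>l. u k * S (Suc k)) = (\<Sum>k<l. u k * S (Suc k))"
        using ul by (simp add: lessThan_Suc_atMost[symmetric])
      also have "\<dots> = (\<Sum>j=1..l. u (j - 1) * S j)"
        by (rule sum.reindex_bij_witness[where i="\<lambda>j. j - 1" and j=Suc]) auto
      finally show ?thesis .
    qed
    \<comment> \<open>The \<open>k = 0\<close> term has frequency -1. Since
      \<open>v 0 = u 0\<close>, it returns to frequency 1 as a second copy of the \<open>u 0\<close>
      term.\<close>
    have B: "(\<Sum>k\<le>l. v k * sin ((real k - 1) * t)) = - u 0 * S 1 + (\<Sum>j=1..l. v (Suc j) * S j)"
    proof -
      have "(\<Sum>k\<le>l. v k * sin ((real k - 1) * t)) = v 0 * sin (- t) + (\<Sum>k<l. v (Suc k) * S k)"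
        unfolding sum.atMost_shift by (simp add: S_def)
      also have "(\<Sum>k<l. v (Suc k) * S k) = (\<Sum>k\<le>l. v (Suc k) * S k)"
        by (simp add: lessThan_Suc_atMost[symmetric] v_def z)
      also have "\<dots> = (\<Sum>j=1..l. v (Suc j) * S j)"
        by (rule sum.mono_neutral_right) (auto simp: S_def Suc_le_eq)
      finally show ?thesis by (simp add: u_def v_def S_def)
    qed
    have C: "(\<Sum>k\<le>l. w k * S k) = (\<Sum>j=1..l. w j * S j)"
      by (rule sum.mono_neutral_right) (auto simp: S_def Suc_le_eq)
    have D: "u 0 * S 1 = (\<Sum>j=1..l. (if j = 1 then u 0 * S j else 0))"
      using False by (subst sum.delta) auto
    have "(\<Sum>j=1..l. u (j - 1) * S j) - (- u 0 * S 1 + (\<Sum>j=1..l. v (Suc j) * S j)) - (\<Sum>j=1..l. w j * S j)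
      = (\<Sum>j=1..l. ((if j = 1 then 2 else 1) * u (j - 1) - v (Suc j) - w j) * S j)"
    proof -
      have "(\<Sum>j=1..l. ((if j = 1 then 2 else 1) * u (j - 1) - v (Suc j) - w j) * S j) =
        (\<Sum>j=1..l. (u (j - 1) * S j + (if j = 1 then u 0 * S j else 0)) - v (Suc j) * S j - w j * S j)"
        by (intro sum.cong refl) (simp add: algebra_simps)
      also have "\<dots> = ((\<Sum>j=1..l. u (j - 1) * S j) + u 0 * S 1) - (\<Sum>j=1..l. v (Suc j) * S j) - (\<Sum>j=1..l. w j * S j)"
        unfolding D sum_subtractf sum.distrib ..
      finally show ?thesis by simp
    qed
    also have "\<dots> = 0"
    proof (rule sum.neutral, rule ballI)
      fix j assume j: "j \<in> {1..l}"
      have "(if j = 1 then 2 else 1) * u (j - 1) = w j + v (Suc j)"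
        using cos_coeff_rec[of s j l \<delta>] j assms(1)
        by (auto simp: u_def v_def w_def L_def a_def of_nat_diff add.commute)
      then show "((if j = 1 then 2 else 1) * u (j - 1) - v (Suc j) - w j) * S j = 0" by simp
    qed
    finally show ?thesis unfolding A B C .
  qed
  finally show ?thesis by (simp only: mult_eq_0_iff) simp
qed

section \<open>Identification of the cosine sums with Jacobi polynomials\<close>

definition cos_poly :: "real \<Rightarrow> real \<Rightarrow> nat \<Rightarrow> real poly" where
  "cos_poly \<delta> s l = (\<Sum>k\<le>l. smult (cos_coeff \<delta> s l k) (cheb k))"

lemma poly_cos_poly: "poly (cos_poly \<delta> s l) ((cos t - 1) / 2) = (\<Sum>k\<le>l. cos_coeff \<delta> s l k * cos (real k * t))"
  by (simp add: cos_poly_def poly_sum poly_cheb)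

lemma degree_cos_poly: "degree (cos_poly \<delta> s l) \<le> l"
  unfolding cos_poly_def
  by (intro degree_sum_le order.trans[OF degree_smult_le] order.trans[OF degree_cheb]) auto

lemma cos_sum_deriv:
  fixes a :: "nat \<Rightarrow> real"
  shows "((\<lambda>t. \<Sum>k\<le>l. a k * cos (real k * t)) has_real_derivative (\<Sum>k\<le>l. a k * (- real k * sin (real k * t)))) (at t)"
    "((\<lambda>t. \<Sum>k\<le>l. a k * (- real k * sin (real k * t))) has_real_derivative
      (\<Sum>k\<le>l. a k * (- (real k)\<^sup>2 * cos (real k * t)))) (at t)"
  by (auto intro!: derivative_eq_intros sum.cong simp: power2_eq_square algebra_simps)

text \<open>In \<open>u = (cos t - 1) / 2\<close> the trigonometric equation becomes a
  hypergeometric one after division by \<open>sin t\<close>. It holds at infinitely many points,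
  hence as an identity of polynomials.\<close>

lemma cos_poly_ode:
  fixes \<alpha> \<beta> :: real and l :: nat
  assumes s: "\<alpha> + \<beta> + 1 > 0"
  defines "s \<equiv> \<alpha> + \<beta> + 1" and "L \<equiv> real l * (real l + (\<alpha> + \<beta> + 1))"
  defines "q \<equiv> cos_poly (\<alpha> - \<beta>) s l"
  shows "[:0, 1, 1:] * pderiv (pderiv q) + [:\<alpha> + 1, s + 1:] * pderiv q = smult L q" (is "?p = _")
proof -
  have eq: "poly (?p - smult L q) ((cos t - 1) / 2) = 0" if t: "t \<in> {0<..<pi}" for t
  proof -
    define u where "u t = (cos t - 1) / 2" for t :: real
    define y where "y t = (\<Sum>k\<le>l. cos_coeff (\<alpha> - \<beta>) s l k * cos (real k * t))" for t
    define y1 where "y1 t = (\<Sum>k\<le>l. cos_coeff (\<alpha> - \<beta>) s l k * (- real k * sin (real k * t)))" for t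
    define y2 where "y2 t = (\<Sum>k\<le>l. cos_coeff (\<alpha> - \<beta>) s l k * (- (real k)\<^sup>2 * cos (real k * t)))" for t
    have y: "y = (\<lambda>t. poly q (u t))" by (simp add: fun_eq_iff y_def u_def q_def poly_cos_poly)
    have d1: "(y has_real_derivative y1 t) (at t)" for t unfolding y_def y1_def by (rule cos_sum_deriv)
    have d2: "(y1 has_real_derivative y2 t) (at t)" for t unfolding y1_def y2_def by (rule cos_sum_deriv)
    have du: "(u has_real_derivative - sin t / 2) (at t)" for t
      unfolding u_def by (auto intro!: derivative_eq_intros)
    have e1: "y1 t = poly (pderiv q) (u t) * (- sin t / 2)" for t
    proof -
      have "(y has_real_derivative poly (pderiv q) (u t) * (- sin t / 2)) (at t)"
        unfolding y by (rule DERIV_chain2[OF poly_DERIV du])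
      with d1 show ?thesis by (rule DERIV_unique)
    qed
    have e2: "y2 t = poly (pderiv (pderiv q)) (u t) * (- sin t / 2) * (- sin t / 2) + poly (pderiv q) (u t) * (- cos t / 2)" for t
    proof -
      have "y1 = (\<lambda>t. poly (pderiv q) (u t) * (- sin t / 2))" using e1 by auto
      moreover have "((\<lambda>t. poly (pderiv q) (u t) * (- sin t / 2)) has_real_derivative
         poly (pderiv (pderiv q)) (u t) * (- sin t / 2) * (- sin t / 2) + poly (pderiv q) (u t) * (- cos t / 2)) (at t)"
        by (rule derivative_eq_intros DERIV_chain2[OF poly_DERIV du] | simp)+
      ultimately show ?thesis using d2[of t] by (metis DERIV_unique)
    qed
    have ode: "sin t * y2 t + ((\<alpha> - \<beta>) + s * cos t) * y1 t + L * sin t * y t = 0"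
      using cos_coeff_ode[OF s, where t=t and l=l and \<delta>="\<alpha> - \<beta>"] unfolding y_def y1_def y2_def L_def s_def by simp
    have c: "cos t = 1 + 2 * u t" by (simp add: u_def field_simps)
    have ss: "sin t * sin t = - 4 * (u t * (1 + u t))"
    proof -
      have "sin t * sin t = 1 - cos t * cos t" using sin_cos_squared_add[of t] by (simp add: power2_eq_square)
      then show ?thesis unfolding c by (simp add: algebra_simps)
    qed
    have "sin t > 0" using t by (auto intro: sin_gt_zero)
    have "y2 t = - (u t * (1 + u t)) * poly (pderiv (pderiv q)) (u t) - (1 + 2 * u t) / 2 * poly (pderiv q) (u t)"
    proof -
      have "y2 t = (sin t * sin t) / 4 * poly (pderiv (pderiv q)) (u t) - cos t / 2 * poly (pderiv q) (u t)"
        unfolding e2 by (simp add: field_simps)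
      then show ?thesis unfolding ss c by simp
    qed
    then have "0 = sin t * (- (u t * (1 + u t)) * poly (pderiv (pderiv q)) (u t) - (1 + 2 * u t) / 2 * poly (pderiv q) (u t))
       + ((\<alpha> - \<beta>) + s * (1 + 2 * u t)) * (poly (pderiv q) (u t) * (- sin t / 2)) + L * sin t * poly q (u t)"
      using ode unfolding e1 by (simp add: y c)
    also have "\<dots> = - sin t * poly (?p - smult L q) (u t)"
      by (simp add: s_def field_simps)
    finally show ?thesis using \<open>sin t > 0\<close> by (simp add: u_def)
  qed
  have "?p - smult L q = 0"
  proof (rule ccontr)
    assume "?p - smult L q \<noteq> 0"
    then have fin: "finite {x. poly (?p - smult L q) x = 0}" by (rule poly_roots_finite)
    have "inj_on (\<lambda>t. (cos t - 1) / 2) {0<..<pi}"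
      by (auto simp: inj_on_def cos_inj_pi)
    moreover have "infinite {0<..<pi}" by simp
    ultimately have "infinite ((\<lambda>t. (cos t - 1) / 2) ` {0<..<pi})" using finite_imageD by blast
    moreover have "(\<lambda>t. (cos t - 1) / 2) ` {0<..<pi} \<subseteq> {x. poly (?p - smult L q) x = 0}"
      using eq by auto
    ultimately show False using fin finite_subset by blast
  qed
  then show ?thesis by simp
qed

text \<open>A two-term recursion, which fixes a polynomial up to a scalar. The Gamma quotients of
  the Jacobi sum obey the same one.\<close>

lemma cos_poly_coeff:
  fixes \<alpha> \<beta> :: real and l :: nat
  assumes s: "\<alpha> + \<beta> + 1 > 0"
  defines "s \<equiv> \<alpha> + \<beta> + 1"
  defines "q \<equiv> cos_poly (\<alpha> - \<beta>) s l"
  shows "(real k + 1) * (real k + \<alpha> + 1) * coeff q (Suc k) = (real l - real k) * (real l + real k + s) * coeff q k"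
proof -
  define L where "L = real l * (real l + s)"
  have "[:0, 1, 1:] * pderiv (pderiv q) + [:\<alpha> + 1, s + 1:] * pderiv q = smult L q"
    using cos_poly_ode[OF s, of l] by (simp add: q_def L_def s_def)
  then have "coeff ([:0, 1, 1:] * pderiv (pderiv q) + [:\<alpha> + 1, s + 1:] * pderiv q) k = L * coeff q k"
    by simp
  then show ?thesis
    by (cases k; cases "k - 1") (simp_all add: coeff_pderiv coeff_pCons L_def algebra_simps split: nat.splits)
qed

text \<open>Equal coefficient recursions make the two polynomials proportional; dividing by the
  value at \<open>x = 1\<close>, that is \<open>u = 0\<close>, removes the unknown factor and the
  Gamma prefactor.\<close>

lemma jacobi_ratio_cos:
  fixes \<alpha> \<beta> :: real and l :: nat
  assumes s: "\<alpha> + \<beta> + 1 > 0" and a: "\<alpha> > -1" and ab: "\<alpha> \<ge> \<beta>"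
  defines "s \<equiv> \<alpha> + \<beta> + 1"
  defines "q \<equiv> cos_poly (\<alpha> - \<beta>) s l"
  shows "jacobi \<alpha> \<beta> l x / jacobi \<alpha> \<beta> l 1 = poly q ((x - 1) / 2) / poly q 0"
proof -
  define J where "J k = real (l choose k) * (Gamma (\<alpha> + \<beta> + real l + real k + 1) / Gamma (\<alpha> + real k + 1))" for k
  have G: "Gamma (\<alpha> + real k + 1) > 0" "Gamma (\<alpha> + \<beta> + real l + real k + 1) > 0" for k
    using s a by (auto intro!: Gamma_real_pos)
  have J0: "J 0 > 0" using G[of 0] by (simp add: J_def)
  have Jrec: "(real k + 1) * (real k + \<alpha> + 1) * J (Suc k) = (real l - real k) * (real l + real k + s) * J k" if "k < l" for k
  proof -
    have 1: "Gamma (\<alpha> + real (Suc k) + 1) = (\<alpha> + real k + 1) * Gamma (\<alpha> + real k + 1)"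
      using Gamma_plus1[of "\<alpha> + real k + 1"] a by (auto simp: add_ac nonpos_Ints_def)
    have 2: "Gamma (\<alpha> + \<beta> + real l + real (Suc k) + 1) = (\<alpha> + \<beta> + real l + real k + 1) * Gamma (\<alpha> + \<beta> + real l + real k + 1)"
      using Gamma_plus1[of "\<alpha> + \<beta> + real l + real k + 1"] s by (auto simp: add_ac nonpos_Ints_def)
    have 3: "(real k + 1) * real (l choose Suc k) = (real l - real k) * real (l choose k)"
    proof -
      have "Suc k * (l choose Suc k) = (l - k) * (l choose k)"
        by (metis Suc_times_binomial_eq binomial_absorb_comp mult.commute binomial_absorption)
      then have "real (Suc k * (l choose Suc k)) = real ((l - k) * (l choose k))" by simp
      then show ?thesis using that by (simp add: of_nat_diff algebra_simps)
    qed
    have nz: "\<alpha> + real k + 1 > 0" using a by simp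
    have "(real k + 1) * (real k + \<alpha> + 1) * J (Suc k) = ((real k + 1) * real (l choose Suc k)) *
       ((\<alpha> + \<beta> + real l + real k + 1) * (Gamma (\<alpha> + \<beta> + real l + real k + 1) / Gamma (\<alpha> + real k + 1)))"
    proof -
      have "(r + 1) * z' * (C * (w * g / (z * h))) = (r + 1) * C * (w * (g / h))" if "z > 0" "z' = z" for r z z' C w g h :: real
        using that by simp
      from this[OF nz, of "real k + \<alpha> + 1"] show ?thesis unfolding J_def 1 2 by simp
    qed
    also have "\<dots> = (real l - real k) * (real l + real k + s) * J k"
      unfolding 3 J_def s_def by (simp add: add_ac mult_ac)
    finally show ?thesis .
  qed
  \<comment> \<open>Cross-multiplied form of \<open>coeff q k / coeff q 0 = J k / J 0\<close>,
    available before \<open>coeff q 0\<close> is known to be nonzero.\<close>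
  have qJ: "coeff q k * J 0 = coeff q 0 * J k" if "k \<le> l" for k
    using that
  proof (induction k)
    case (Suc k)
    have "(real k + 1) * (real k + \<alpha> + 1) * (coeff q (Suc k) * J 0) = (real l - real k) * (real l + real k + s) * (coeff q k * J 0)"
      using cos_poly_coeff[OF s, of k l] by (simp add: q_def s_def)
    also have "\<dots> = coeff q 0 * ((real l - real k) * (real l + real k + s) * J k)" using Suc by simp
    also have "\<dots> = (real k + 1) * (real k + \<alpha> + 1) * (coeff q 0 * J (Suc k))"
      using Jrec[of k] Suc.prems by simp
    finally show ?case using a by (simp add: add_eq_0_iff)
  qed simp
  have p: "poly q u * J 0 = coeff q 0 * (\<Sum>k\<le>l. J k * u ^ k)" for u
  proof -
    have "poly q u = (\<Sum>k\<le>l. coeff q k * u ^ k)"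
      unfolding poly_altdef
      by (rule sum.mono_neutral_left) (use degree_cos_poly in \<open>auto simp: q_def coeff_eq_0\<close>)
    then have "poly q u * J 0 = (\<Sum>k\<le>l. (coeff q k * J 0) * u ^ k)"
      by (simp add: sum_distrib_left mult_ac)
    also have "\<dots> = (\<Sum>k\<le>l. (coeff q 0 * J k) * u ^ k)"
      by (intro sum.cong refl) (simp add: qJ)
    finally show ?thesis by (simp add: sum_distrib_left mult.assoc)
  qed
  \<comment> \<open>\<open>u = 0\<close> is \<open>t = 0\<close>, where all cosines are 1.\<close>
  have q0: "coeff q 0 > 0"
  proof -
    have "coeff q 0 = poly q ((cos 0 - 1) / 2)" by (simp add: poly_0_coeff_0)
    also have "\<dots> > 0" using cos_coeff_sum_pos[of "\<alpha> - \<beta>" s l] ab s unfolding q_def poly_cos_poly s_def by simp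
    finally show ?thesis .
  qed
  define pre where "pre = Gamma (\<alpha> + real l + 1) / (fact l * Gamma (\<alpha> + \<beta> + real l + 1))"
  have "pre \<noteq> 0" using G(1)[of l] G(2)[of 0] by (simp add: pre_def)
  have j: "jacobi \<alpha> \<beta> l x = pre * (\<Sum>k\<le>l. J k * ((x - 1) / 2) ^ k)" for x
    by (simp add: jacobi_def pre_def J_def)
  have "(\<Sum>k\<le>l. J k * u ^ k) = poly q u * J 0 / coeff q 0" for u using p[of u] q0 by (simp add: field_simps)
  then show ?thesis unfolding j using \<open>pre \<noteq> 0\<close> J0 q0 by (simp only: mult_divide_mult_cancel_left_if) (simp add: poly_0_coeff_0 power_0_left)
qed

definition jac_coeff :: "real \<Rightarrow> real \<Rightarrow> nat \<Rightarrow> nat \<Rightarrow> real" where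
  "jac_coeff \<alpha> \<beta> l k = cos_coeff (\<alpha> - \<beta>) (\<alpha> + \<beta> + 1) l k / (\<Sum>k\<le>l. cos_coeff (\<alpha> - \<beta>) (\<alpha> + \<beta> + 1) l k)"

definition jac_cos :: "real \<Rightarrow> real \<Rightarrow> nat \<Rightarrow> real \<Rightarrow> real" where
  "jac_cos \<alpha> \<beta> l t = (\<Sum>k\<le>l. jac_coeff \<alpha> \<beta> l k * cos (real k * t))"

locale jacobi_params =
  fixes \<alpha> \<beta> :: real
  assumes s_pos: "\<alpha> + \<beta> + 1 > 0" and alpha_gt: "\<alpha> > -1" and beta_le: "\<beta> \<le> \<alpha>"
begin

lemma jacobi_eq_jac_cos: "jacobi \<alpha> \<beta> l (cos t) / jacobi \<alpha> \<beta> l 1 = jac_cos \<alpha> \<beta> l t"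
proof -
  have "poly (cos_poly (\<alpha> - \<beta>) (\<alpha> + \<beta> + 1) l) 0 = (\<Sum>k\<le>l. cos_coeff (\<alpha> - \<beta>) (\<alpha> + \<beta> + 1) l k)"
    using poly_cos_poly[of "\<alpha> - \<beta>" "\<alpha> + \<beta> + 1" l 0] by simp
  then show ?thesis
    using jacobi_ratio_cos[OF s_pos alpha_gt beta_le, of l "cos t"]
    by (simp add: poly_cos_poly jac_cos_def jac_coeff_def sum_divide_distrib)
qed

lemma jac_coeff_nonneg: "jac_coeff \<alpha> \<beta> l k \<ge> 0"
  using s_pos beta_le unfolding jac_coeff_def
  by (intro divide_nonneg_nonneg sum_nonneg cos_coeff_nonneg) auto

lemma jac_coeff_sum: "(\<Sum>k\<le>l. jac_coeff \<alpha> \<beta> l k) = 1"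
  using cos_coeff_sum_pos[of "\<alpha> - \<beta>" "\<alpha> + \<beta> + 1" l] s_pos beta_le
  by (simp add: jac_coeff_def sum_divide_distrib[symmetric])

lemma jac_cos_0 [simp]: "jac_cos \<alpha> \<beta> l 0 = 1" by (simp add: jac_cos_def jac_coeff_sum)

lemma jac_cos_minus [simp]: "jac_cos \<alpha> \<beta> l (- t) = jac_cos \<alpha> \<beta> l t" by (simp add: jac_cos_def)

lemma jac_cos_abs [simp]: "jac_cos \<alpha> \<beta> l \<bar>t\<bar> = jac_cos \<alpha> \<beta> l t" by (cases "t \<ge> 0") auto

lemma jac_sum_bound:
  assumes "\<And>k. k \<le> l \<Longrightarrow> \<bar>f k\<bar> \<le> B"
  shows "\<bar>\<Sum>k\<le>l. jac_coeff \<alpha> \<beta> l k * f k\<bar> \<le> B"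
proof -
  have "\<bar>\<Sum>k\<le>l. jac_coeff \<alpha> \<beta> l k * f k\<bar> \<le> (\<Sum>k\<le>l. jac_coeff \<alpha> \<beta> l k * B)"
    using assms jac_coeff_nonneg
    by (intro order.trans[OF sum_abs] sum_mono) (auto simp: abs_mult intro!: mult_left_mono)
  then show ?thesis by (simp add: sum_distrib_right[symmetric] jac_coeff_sum)
qed

lemma jac_cos_bound: "\<bar>jac_cos \<alpha> \<beta> l t\<bar> \<le> 1"
  unfolding jac_cos_def by (rule jac_sum_bound) simp

lemma one_minus_jac_cos: "1 - jac_cos \<alpha> \<beta> l t \<le> (real l * t)\<^sup>2 / 2"
proof -
  have "1 - jac_cos \<alpha> \<beta> l t = (\<Sum>k\<le>l. jac_coeff \<alpha> \<beta> l k * (1 - cos (real k * t)))"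
    by (simp add: jac_cos_def sum_subtractf right_diff_distrib jac_coeff_sum)
  also have "\<dots> \<le> (real l * t)\<^sup>2 / 2"
  proof (rule order.trans[OF abs_ge_self jac_sum_bound])
    fix k assume "k \<le> l"
    have "1 - cos (real k * t) = 2 * (sin (real k * t / 2))\<^sup>2"
      using cos_double_sin[of "real k * t / 2"] by simp
    also have "\<bar>sin (real k * t / 2)\<bar> \<le> \<bar>real k * t / 2\<bar>" by (rule abs_sin_x_le_abs_x)
    then have "(sin (real k * t / 2))\<^sup>2 \<le> (real k * t / 2)\<^sup>2" by (simp only: abs_le_square_iff)
    also have "\<dots> \<le> (real l * t / 2)\<^sup>2"
      using \<open>k \<le> l\<close> by (simp add: power_mult_distrib power_divide mult_right_mono power_mono)
    finally show "\<bar>1 - cos (real k * t)\<bar> \<le> (real l * t)\<^sup>2 / 2"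
      by (simp add: power_divide)
  qed
  finally show ?thesis .
qed

end

section \<open>Decay of Jacobi polynomials\<close>

context jacobi_params begin

text \<open>
  A Sonin-type monotone functional: \<open>t powr m * (y'^2 + L * y^2) + m * t powr (m - 1) * y * y' + m * t powr (m - 2) * y^2\<close>
  decreases along solutions of the Jacobi equation once \<open>m\<close> is small enough.
\<close>

lemma jac_cos_decay:
  "\<exists>m C. m > 0 \<and> C > 0 \<and> (\<forall>l t. l \<ge> 1 \<longrightarrow> 0 < t \<longrightarrow> t \<le> 1 \<longrightarrow> \<bar>jac_cos \<alpha> \<beta> l t\<bar> \<le> C * (real l * t) powr - m)"
proof -
  define s where "s = \<alpha> + \<beta> + 1"
  \<comment> \<open>\<open>q1\<close> and \<open>q2\<close> bound \<open>P t\<close>, which is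
    \<open>t\<close> times the damping coefficient, on \<open>(0, 1]\<close>: there
    \<open>1 / 2 \<le> cos t \<le> 1\<close> and \<open>1 \<le> t / sin t \<le> 2\<close>. The extra
    1 ensures \<open>q2 \<ge> 1\<close>.\<close>
  define q1 where "q1 = s / 2"
  define q2 where "q2 = 2 * (\<alpha> - \<beta> + s) + 1"
  \<comment> \<open>The value at which the mixed term of the derivative is exactly absorbed by a
    completed square.\<close>
  define m where "m = 4 * q1 / (2 + q2)\<^sup>2"
  have s: "s > 0" using s_pos by (simp add: s_def)
  have q: "q1 > 0" "q2 \<ge> 1" "q1 \<le> q2" using s beta_le by (auto simp: q1_def q2_def)
  have m0: "m > 0" using q by (simp add: m_def)
  have mq: "m * (2 + q2)\<^sup>2 = 4 * q1" using q by (simp add: m_def)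
  have sq9: "(2 + q2)\<^sup>2 \<ge> 8"
  proof -
    have "(3::real)\<^sup>2 \<le> (2 + q2)\<^sup>2" using q by (intro power_mono) auto
    then show ?thesis by simp
  qed
  have m_le1: "m \<le> 1"
  proof -
    have "(2 + q2)\<^sup>2 \<ge> 4 * q2" using q by (simp add: power2_eq_square algebra_simps)
    then have "m * (2 + q2)\<^sup>2 \<le> 1 * (2 + q2)\<^sup>2" using mq q by simp
    then show ?thesis by (rule mult_right_le_imp_le) (use sq9 in linarith)
  qed
  have m_leq: "m \<le> q1 / 2"
  proof -
    have "q1 / 2 * (2 + q2)\<^sup>2 \<ge> q1 / 2 * 8" using q sq9 by (intro mult_left_mono) auto
    then have "m * (2 + q2)\<^sup>2 \<le> q1 / 2 * (2 + q2)\<^sup>2" unfolding mq by simp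
    then show ?thesis by (rule mult_right_le_imp_le) (use sq9 in linarith)
  qed
  have main: "(jac_cos \<alpha> \<beta> l t)\<^sup>2 \<le> 4 * (real l * t) powr - m" if l: "l \<ge> 1" and t: "0 < t" "t \<le> 1" for l t
  proof -
    define a where "a = jac_coeff \<alpha> \<beta> l"
    define L where "L = real l * (real l + s)"
    define y where "y = jac_cos \<alpha> \<beta> l"
    define y1 where "y1 t = (\<Sum>k\<le>l. a k * (- real k * sin (real k * t)))" for t
    define y2 where "y2 t = (\<Sum>k\<le>l. a k * (- (real k)\<^sup>2 * cos (real k * t)))" for t
    define P where "P t = t * ((\<alpha> - \<beta>) + s * cos t) / sin t" for t
    have d1: "(y has_real_derivative y1 t) (at t)" for t
      unfolding y_def y1_def jac_cos_def[abs_def] a_def by (rule cos_sum_deriv)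
    have d2: "(y1 has_real_derivative y2 t) (at t)" for t unfolding y1_def y2_def by (rule cos_sum_deriv)
    have ode: "sin t * y2 t + ((\<alpha> - \<beta>) + s * cos t) * y1 t + L * sin t * y t = 0" for t
    proof -
      define D where "D = (\<Sum>k\<le>l. cos_coeff (\<alpha> - \<beta>) s l k)"
      have "y2 t = (\<Sum>k\<le>l. cos_coeff (\<alpha> - \<beta>) s l k * (- (real k)\<^sup>2 * cos (real k * t))) / D"
        "y1 t = (\<Sum>k\<le>l. cos_coeff (\<alpha> - \<beta>) s l k * (- real k * sin (real k * t))) / D"
        "y t = (\<Sum>k\<le>l. cos_coeff (\<alpha> - \<beta>) s l k * cos (real k * t)) / D"
        by (simp_all add: y1_def y2_def y_def jac_cos_def a_def jac_coeff_def s_def[symmetric] D_def[symmetric] sum_divide_distrib)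
      then have "sin t * y2 t + ((\<alpha> - \<beta>) + s * cos t) * y1 t + L * sin t * y t = 0 / D"
        unfolding cos_coeff_ode[OF s, where t=t and l=l and \<delta>="\<alpha> - \<beta>", symmetric] L_def
        by (simp only: add_divide_distrib times_divide_eq_right)
      then show ?thesis by simp
    qed
    have sin_bounds: "sin t > 0" "sin t \<le> t" "sin t \<ge> t / 2" if "0 < t" "t \<le> 1" for t :: real
    proof -
      show "sin t > 0" using that pi_gt3 by (intro sin_gt_zero) auto
      show "sin t \<le> t" using that by (intro sin_x_le_x) auto
      show "sin t \<ge> t / 2" using that by (intro sin_ge_half) auto
    qed
    have cosb: "cos t \<ge> 1 / 2" "cos t \<le> 1" if "0 < t" "t \<le> 1" for t :: real
    proof -
      have "cos t \<ge> cos (pi/3)" using that pi_gt3 by (intro cos_monotone_0_pi_le) auto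
      then show "cos t \<ge> 1 / 2" by (simp add: cos_60)
    qed simp
    have P: "q1 \<le> P t" "P t \<le> q2" if "0 < t" "t \<le> 1" for t
    proof -
      note sb = sin_bounds[OF that] and cb = cosb[OF that]
      have "s * cos t \<ge> s * (1/2)" using cb s by (intro mult_left_mono) auto
      then have pb: "(\<alpha> - \<beta>) + s * cos t \<ge> q1" using beta_le by (simp add: q1_def)
      have "q1 * sin t \<le> ((\<alpha> - \<beta>) + s * cos t) * t" using pb q sb that by (intro mult_mono) auto
      then show "q1 \<le> P t" using sb by (simp add: P_def field_simps)
      have "s * cos t \<le> s * 1" using cb s by (intro mult_left_mono) auto
      then have "((\<alpha> - \<beta>) + s * cos t) * t \<le> (\<alpha> - \<beta> + s) * (2 * sin t)"
        using sb that beta_le s by (intro mult_mono) auto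
      also have "\<dots> \<le> q2 * sin t" using sb by (simp add: q2_def algebra_simps)
      finally show "P t \<le> q2" using sb by (simp add: P_def field_simps)
    qed
    have y2: "t * t * y2 t = - P t * (t * y1 t) - L * (t * t) * y t" if "0 < t" "t \<le> 1" for t
    proof -
      define g where "g = ((\<alpha> - \<beta>) + s * cos t) / sin t"
      have h: "(\<alpha> - \<beta>) + s * cos t = sin t * g" using sin_bounds(1)[OF that] by (simp add: g_def)
      have "sin t * (y2 t + g * y1 t + L * y t) = 0"
        using ode[of t] unfolding h by (simp add: algebra_simps)
      then have y2: "y2 t = - g * y1 t - L * y t" using sin_bounds(1)[OF that] by simp
      have "P t = t * g" by (simp add: P_def g_def)
      then show ?thesis unfolding y2 by (simp add: algebra_simps)
    qed
    \<comment> \<open>\<open>F\<close> is the functional described above, written with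
      \<open>t * y1 t\<close> so that the singular coefficient enters only through the bounded
      \<open>P t\<close>.\<close>
    define H where "H t = (t * y1 t)\<^sup>2 + L * (t * y t)\<^sup>2 + m * (t * y1 t) * y t + m * (y t)\<^sup>2" for t
    define F where "F t = t powr (m - 2) * H t" for t
    have L1: "L \<ge> 1"
    proof -
      have "1 * 1 \<le> real l * (real l + s)" using l s by (intro mult_mono) auto
      then show ?thesis by (simp add: L_def)
    qed
    have lL: "real l \<le> sqrt L" using l s by (intro real_le_rsqrt) (simp add: L_def power2_eq_square algebra_simps)
    have F_mono: "F b \<le> F a" if ab: "0 < a" "a \<le> b" "b \<le> 1" for a b
    proof (rule DERIV_nonpos_imp_nonincreasing[where f = F, OF ab(2)])
      fix x assume "a \<le> x" "x \<le> b"
      then have x: "0 < x" "x \<le> 1" using ab by auto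
      define H' where "H' = 2 * (x * y1 x) * (y1 x + x * y2 x) + L * (2 * (x * y x) * (y x + x * y1 x))
        + m * ((y1 x + x * y2 x) * y x + (x * y1 x) * y1 x) + m * (2 * y x * y1 x)"
      have dH: "(H has_real_derivative H') (at x)"
        unfolding H_def by (auto intro!: derivative_eq_intros d1 d2 simp: H'_def power2_eq_square algebra_simps)
      have dF: "(F has_real_derivative (m - 2) * x powr (m - 2 - 1) * H x + x powr (m - 2) * H') (at x)"
        unfolding F_def using x by (auto intro!: derivative_eq_intros dH simp: algebra_simps)
      have fac: "(m - 2) * x powr (m - 2 - 1) * H x + x powr (m - 2) * H' = x powr (m - 3) * ((m - 2) * H x + x * H')"
      proof -
        have "x powr (m - 2) = x powr (m - 3) * x" using x powr_add[of x "m - 3" 1] by simp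
        then show ?thesis by (simp add: algebra_simps)
      qed
      define Y where "Y = x * y1 x"
      define p where "p = P x"
      have xxy2: "x * x * y2 x = - p * Y - L * (x * x) * y x" using y2[OF x] by (simp add: Y_def p_def)
      have "x * H' = 2 * Y * (Y + x * x * y2 x) + 2 * L * (x * x) * y x * (y x + Y)
          + m * ((Y + x * x * y2 x) * y x + Y * Y) + 2 * m * y x * Y"
        by (simp add: H'_def Y_def algebra_simps)
      \<comment> \<open>All terms with \<open>L\<close> cancel: the mixed term of \<open>H\<close>
        contributes \<open>- m * L * (x * y x)^2\<close>. What is left is a form in \<open>Y\<close>
        and \<open>y x\<close> with bounds uniform in \<open>l\<close>.\<close>
      then have "(m - 2) * H x + x * H' = (2 * m - 2 * p) * Y\<^sup>2 + m * (m + 1 - p) * (Y * y x) + m * (m - 2) * (y x)\<^sup>2"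
        unfolding xxy2 H_def Y_def[symmetric] by (simp add: power2_eq_square algebra_simps)
      also have "\<dots> \<le> 0"
      proof -
        have p: "q1 \<le> p" "p \<le> q2" using P[OF x] by (auto simp: p_def)
        define z where "z = y x"
        have a1: "\<bar>m + 1 - p\<bar> \<le> 2 + q2" using m0 m_le1 p q by auto
        have "\<bar>m * (m + 1 - p) * (Y * z)\<bar> \<le> m * (2 + q2) * (\<bar>Y\<bar> * \<bar>z\<bar>)"
          unfolding abs_mult using a1 m0 by (intro mult_mono) auto
        moreover have "(m * (2 + q2) * \<bar>Y\<bar>) * \<bar>z\<bar> \<le> q1 * Y\<^sup>2 + m * z\<^sup>2"
        proof -
          have "(m * (2 + q2) * A) * B \<le> q1 * A\<^sup>2 + m * B\<^sup>2" for A B :: real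
          proof -
            \<comment> \<open>Completed square; \<open>m * (2 + q2)^2 = 4 * q1\<close> makes the
              last coefficient match.\<close>
            have "0 \<le> (q1 * 2 * A - m * (2 + q2) * B)\<^sup>2" by simp
            also have "\<dots> = 4 * q1 * (q1 * A\<^sup>2) - 4 * q1 * ((m * (2 + q2) * A) * B) + (m * (2 + q2)\<^sup>2) * (m * B\<^sup>2)"
              by (simp add: power2_eq_square algebra_simps)
            also have "\<dots> = 4 * q1 * (q1 * A\<^sup>2 - (m * (2 + q2) * A) * B + m * B\<^sup>2)"
              unfolding mq by (simp add: algebra_simps)
            finally show ?thesis using q by (simp add: zero_le_mult_iff)
          qed
          from this[of "\<bar>Y\<bar>" "\<bar>z\<bar>"] show ?thesis by simp
        qed
        moreover have "(2 * m - 2 * p) * Y\<^sup>2 \<le> - q1 * Y\<^sup>2" using m_leq p q by (intro mult_right_mono) auto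
        moreover have "m * (m - 2) * z\<^sup>2 \<le> m * (- 1) * z\<^sup>2" using m0 m_le1 by (intro mult_right_mono mult_left_mono) auto
        ultimately show ?thesis unfolding z_def[symmetric] by (simp add: mult.assoc)
      qed
      finally have "(m - 2) * H x + x * H' \<le> 0" .
      then show "\<exists>y. (F has_real_derivative y) (at x) \<and> y \<le> 0"
        using dF unfolding fac
        by (intro exI[of _ "x powr (m - 3) * ((m - 2) * H x + x * H')"] conjI mult_nonneg_nonpos) auto
    qed
    \<comment> \<open>The monotonicity is started at \<open>1 / sqrt L\<close>, the scale of one
      oscillation, where all four terms of \<open>H\<close> are at most 1.\<close>
    define t1 where "t1 = 1 / sqrt L"
    have t1: "0 < t1" "t1 \<le> 1" using L1 by (auto simp: t1_def)
    have yb: "\<bar>y t\<bar> \<le> 1" for t unfolding y_def by (rule jac_cos_bound)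
    have y1b: "\<bar>y1 t\<bar> \<le> real l" for t
      unfolding y1_def a_def
    proof (rule jac_sum_bound)
      fix k assume "k \<le> l"
      have "\<bar>real k * sin (real k * t)\<bar> \<le> real k * 1" unfolding abs_mult by (intro mult_mono) auto
      then show "\<bar>- real k * sin (real k * t)\<bar> \<le> real l" using \<open>k \<le> l\<close> by simp
    qed
    have lt: "real l * t > 0" using l t by simp
    show "(y t)\<^sup>2 \<le> 4 * (real l * t) powr - m"
    proof (cases "real l * t \<le> 1")
      case True
      have "(y t)\<^sup>2 \<le> 1" using yb[of t] by (simp add: abs_square_le_1)
      also have "1 \<le> (real l * t) powr - m" using True lt m0
        using powr_mono2'[of "- m" "real l * t" 1] by simp
      finally show ?thesis using powr_ge_zero[of "real l * t" "- m"] by linarith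
    next
      case False
      then have "t1 \<le> t"
      proof -
        have "1 \<le> sqrt L * t" using False t mult_right_mono[OF lL, of t] by linarith
        then show ?thesis using L1 by (simp add: t1_def field_simps)
      qed
      have "t powr m * L * (y t)\<^sup>2 \<le> F t"
      proof -
        \<comment> \<open>The rest of \<open>H\<close> is a nonnegative quadratic form, because
          \<open>0 < m \<le> 1\<close>.\<close>
        have "0 \<le> (t * y1 t)\<^sup>2 + m * (t * y1 t) * y t + m * (y t)\<^sup>2"
        proof -
          have "0 \<le> (t * y1 t + m / 2 * y t)\<^sup>2 + (m - m * m / 4) * (y t)\<^sup>2"
            using m0 m_le1 mult_mono[of m 1 m 1] by (intro add_nonneg_nonneg mult_nonneg_nonneg) auto
          then show ?thesis by (simp add: power2_eq_square algebra_simps)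
        qed
        then have "L * (t * y t)\<^sup>2 \<le> H t" by (simp add: H_def)
        then have "t powr (m - 2) * (L * (t * y t)\<^sup>2) \<le> F t" unfolding F_def by (intro mult_left_mono) auto
        moreover have "t powr m = t powr (m - 2) * t\<^sup>2"
          using t powr_add[of t "m - 2" 2] by (simp add: powr_numeral)
        ultimately show ?thesis by (simp add: power_mult_distrib mult_ac)
      qed
      also have "F t \<le> F t1" using t1 \<open>t1 \<le> t\<close> t by (intro F_mono)
      also have "F t1 \<le> t1 powr (m - 2) * 4"
      proof -
        have Y: "\<bar>t1 * y1 t1\<bar> \<le> 1"
        proof -
          have "\<bar>y1 t1\<bar> \<le> sqrt L" using y1b[of t1] lL by linarith
          then have "t1 * \<bar>y1 t1\<bar> \<le> t1 * sqrt L" using t1 by (intro mult_left_mono) auto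
          then show ?thesis using t1 L1 by (simp add: abs_mult t1_def)
        qed
        have "(t1 * y1 t1)\<^sup>2 \<le> 1" using Y by (simp add: abs_square_le_1)
        moreover have "L * (t1 * y t1)\<^sup>2 \<le> 1"
        proof -
          have "L * (t1 * y t1)\<^sup>2 = (y t1)\<^sup>2" using L1 by (simp add: t1_def power_divide power_mult_distrib)
          then show ?thesis using yb[of t1] by (simp add: abs_square_le_1)
        qed
        moreover have "m * (t1 * y1 t1) * y t1 \<le> 1"
        proof -
          have "\<bar>m * (t1 * y1 t1) * y t1\<bar> \<le> 1 * 1 * 1" unfolding abs_mult[of _ "y t1"] abs_mult[of m]
            using m0 m_le1 Y yb[of t1] by (intro mult_mono) auto
          then show ?thesis by simp
        qed
        moreover have "m * (y t1)\<^sup>2 \<le> 1 * 1" using m0 m_le1 yb[of t1] by (intro mult_mono) (auto simp: abs_square_le_1)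
        ultimately have "H t1 \<le> 4" unfolding H_def by linarith
        then show ?thesis unfolding F_def by (intro mult_left_mono) auto
      qed
      also have "t1 powr (m - 2) = L * (sqrt L) powr - m"
      proof -
        have "t1 powr (m - 2) = sqrt L powr (2 - m)" using L1 by (simp add: t1_def powr_divide powr_minus_divide[symmetric] )
        also have "\<dots> = sqrt L powr 2 * sqrt L powr - m" using powr_add[of "sqrt L" 2 "-m"] by simp
        finally show ?thesis using L1 by (simp add: powr_numeral)
      qed
      finally have "t powr m * (y t)\<^sup>2 \<le> 4 * sqrt L powr - m" using L1 by (simp add: mult_ac)
      also have "\<dots> \<le> 4 * real l powr - m" using lL l m0 by (intro mult_left_mono powr_mono2') auto
      finally have "t powr - m * (t powr m * (y t)\<^sup>2) \<le> t powr - m * (4 * real l powr - m)"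
        by (intro mult_left_mono) auto
      moreover have "t powr - m * t powr m = 1" using t by (simp add: powr_minus)
      ultimately show ?thesis using t l by (simp add: powr_mult mult.assoc[symmetric]) (simp add: mult_ac)
    qed
  qed
  show ?thesis
  \<comment> \<open>\<open>main\<close> bounds the square, so exponent and constant pass through a
    square root.\<close>
  proof (rule exI[of _ "m / 2"], rule exI[of _ 2], intro conjI allI impI)
    fix l t assume lt: "(1::nat) \<le> l" "0 < t" "t \<le> (1::real)"
    have "sqrt ((jac_cos \<alpha> \<beta> l t)\<^sup>2) \<le> sqrt (4 * (real l * t) powr - m)" by (rule real_sqrt_le_mono[OF main[OF lt]])
    also have "\<dots> = 2 * (real l * t) powr (- (m / 2))"
      using lt by (simp add: real_sqrt_mult powr_half_sqrt[symmetric] powr_powr)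
    finally show "\<bar>jac_cos \<alpha> \<beta> l t\<bar> \<le> 2 * (real l * t) powr - (m / 2)" by simp
  qed (use m0 in auto)
qed

end

section \<open>Variogram estimates\<close>

lemma powr_step_MVT:
  fixes a x :: real
  assumes "x > 0"
  obtains \<xi> where "x < \<xi>" "\<xi> < x + 1" "(x + 1) powr a - x powr a = a * \<xi> powr (a - 1)"
proof -
  have "\<exists>z. x < z \<and> z < x + 1 \<and> (x + 1) powr a - x powr a = (x + 1 - x) * (a * z powr (a - 1))"
    using assms by (intro MVT2) (auto intro!: derivative_eq_intros)
  then show ?thesis using that by auto
qed

text \<open>For \<open>a \<ge> 1\<close> the last term dominates; for \<open>a < 1\<close> the
  summand decreases and is compared with telescoping differences of \<open>x powr a / a\<close>. One
  constant serves both cases.\<close>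

lemma sum_powr_le:
  fixes a :: real
  assumes "a > 0"
  shows "(\<Sum>l<N. (1 + real l) powr (a - 1)) \<le> (1 + 1 / a) * real N powr a"
proof (cases "a \<ge> 1")
  case True
  have "(\<Sum>l<N. (1 + real l) powr (a - 1)) \<le> (\<Sum>l<N. real N powr (a - 1))"
    using True by (intro sum_mono powr_mono2) auto
  also have "\<dots> = real N * real N powr (a - 1)" by simp
  also have "\<dots> = real N powr a" using powr_add[of "real N" 1 "a - 1"] by (cases "N = 0") auto
  also have "1 * \<dots> \<le> (1 + 1 / a) * real N powr a" using assms by (intro mult_right_mono) auto
  finally show ?thesis by simp
next
  case False
  have st: "(1 + real l) powr (a - 1) \<le> (real (Suc l) powr a - real l powr a) / a" for l
  \<comment> \<open>The mean value theorem needs a positive left endpoint; at 0 the claim is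
    \<open>1 \<le> 1 / a\<close>.\<close>
  proof (cases "l = 0")
    case True then show ?thesis using False assms by simp
  next
    case l: False
    then obtain \<xi> where xi: "real l < \<xi>" "\<xi> < real l + 1" "(real l + 1) powr a - real l powr a = a * \<xi> powr (a - 1)"
      using powr_step_MVT[of "real l" a] by auto
    have "(1 + real l) powr (a - 1) \<le> \<xi> powr (a - 1)" using xi False l by (intro powr_mono2') auto
    then show ?thesis using xi(3) assms by (simp add: add.commute)
  qed
  have "(\<Sum>l<N. (1 + real l) powr (a - 1)) \<le> (\<Sum>l<N. (real (Suc l) powr a - real l powr a) / a)"
    by (intro sum_mono st)
  also have "\<dots> = (real N powr a - real 0 powr a) / a"
    by (simp only: sum_divide_distrib[symmetric] sum_lessThan_telescope[of "\<lambda>l. real l powr a"])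
  also have "\<dots> \<le> (1 + 1 / a) * real N powr a" using assms by (simp add: distrib_right)
  finally show ?thesis .
qed

lemma sum_powr_tail_le:
  fixes a :: real
  assumes "a > 0" "N \<ge> 1"
  shows "(\<Sum>l=N..<L. (1 + real l) powr (- 1 - a)) \<le> real N powr (- a) / a"
proof (cases "N \<le> L")
  case True
  have st: "(1 + real l) powr (- 1 - a) \<le> - (real (Suc l) powr (-a) - real l powr (-a)) / a" if l: "l \<ge> N" for l
  proof -
    obtain \<xi> where xi: "real l < \<xi>" "\<xi> < real l + 1" "(real l + 1) powr (-a) - real l powr (-a) = - a * \<xi> powr (- a - 1)"
      using powr_step_MVT[of "real l" "-a"] l assms by auto
    have "(1 + real l) powr (- 1 - a) \<le> \<xi> powr (- 1 - a)" using xi assms l by (intro powr_mono2') auto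
    moreover have "\<xi> powr (- a - 1) = \<xi> powr (- 1 - a)" by (rule arg_cong[where f = "\<lambda>z. \<xi> powr z"]) simp
    ultimately show ?thesis using xi(3) assms by (simp add: add.commute)
  qed
  have "(\<Sum>l=N..<L. (1 + real l) powr (- 1 - a)) \<le> (\<Sum>l=N..<L. - (real (Suc l) powr (-a) - real l powr (-a)) / a)"
    by (intro sum_mono st) auto
  also have "\<dots> = - (\<Sum>l=N..<L. real (Suc l) powr (-a) - real l powr (-a)) / a"
    by (simp only: sum_divide_distrib[symmetric] sum_negf)
  also have "\<dots> = (real N powr (-a) - real L powr (-a)) / a"
    using True by (simp only: sum_Suc_diff'[of N L "\<lambda>l. real l powr (-a)"]) simp
  also have "\<dots> \<le> real N powr (-a) / a" using assms by (intro divide_right_mono) auto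
  finally show ?thesis .
qed (use assms in auto)

context jacobi_params begin

text \<open>Split at \<open>N\<close>, about \<open>1 / r\<close>: below it the quadratic bound on
  \<open>1 - R_l\<close> is used, above it the trivial bound 2. \<open>\<nu> < 2\<close> lets the
  first sum grow with its upper limit, \<open>\<nu> > 0\<close> makes the second converge, and both
  are of order \<open>r powr \<nu>\<close>.\<close>

lemma variogram_upper:
  assumes b0: "\<And>l. b l \<ge> 0" and bs: "summable b" and nu: "0 < \<nu>" "\<nu> < 2"
    and b: "\<And>l. l \<ge> l0 \<Longrightarrow> b l * (1 + real l) powr (1 + \<nu>) \<le> \<gamma>2"
  shows "\<exists>K>0. \<forall>r. 0 < r \<longrightarrow> r \<le> 1 \<longrightarrow> (\<Sum>l. b l * (1 - jac_cos \<alpha> \<beta> l r)) \<le> K * r powr \<nu>"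
proof -
  \<comment> \<open>Extends the upper bound on \<open>b l\<close> from \<open>l \<ge> l0\<close> to
    all \<open>l\<close>, using \<open>b l \<le> suminf b\<close> below \<open>l0\<close>.\<close>
  define C0 where "C0 = max (max \<gamma>2 1) (suminf b * (1 + real l0) powr (1 + \<nu>))"
  have C0: "C0 > 0" by (simp add: C0_def)
  have bC: "b l \<le> C0 * (1 + real l) powr (- 1 - \<nu>)" for l
  proof -
    have "b l * (1 + real l) powr (1 + \<nu>) \<le> C0"
    proof (cases "l \<ge> l0")
      case True then show ?thesis using b[OF True] by (simp add: C0_def)
    next
      case False
      have "b l \<le> suminf b" using sum_le_suminf[OF bs, of "{l}"] b0 by simp
      then have "b l * (1 + real l) powr (1 + \<nu>) \<le> suminf b * (1 + real l0) powr (1 + \<nu>)"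
        using False nu b0 by (intro mult_mono powr_mono2) (auto intro: order.trans[OF b0])
      then show ?thesis by (simp add: C0_def)
    qed
    then have "b l * (1 + real l) powr (1 + \<nu>) * (1 + real l) powr (- 1 - \<nu>) \<le> C0 * (1 + real l) powr (- 1 - \<nu>)"
      by (intro mult_right_mono) auto
    moreover have "(1 + real l) powr (1 + \<nu>) * (1 + real l) powr (- 1 - \<nu>) = 1"
      by (simp add: powr_add[symmetric])
    ultimately show ?thesis by (simp add: mult.assoc)
  qed
  \<comment> \<open>Low degrees contribute \<open>C0 / 2 * (1 + 1 / (2 - \<nu>))\<close> times
    \<open>2 powr (2 - \<nu>) \<le> 4\<close>; the tail contributes
    \<open>2 * C0 / \<nu>\<close>.\<close>
  define K where "K = C0 * (2 * (1 + 1 / (2 - \<nu>)) + 2 / \<nu>)"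
  have K: "K > 0" using C0 nu by (auto simp: K_def intro!: mult_pos_pos add_pos_pos)
  show ?thesis
  proof (intro exI[of _ K] conjI allI impI K)
    fix r :: real assume r: "0 < r" "r \<le> 1"
    define N where "N = nat \<lceil>1 / r\<rceil>"
    have N: "1 / r \<le> real N" "real N \<le> 2 / r" "N \<ge> 1"
    proof -
      have "1 \<le> 1 / r" using r by simp
      moreover show "1 / r \<le> real N" by (simp add: N_def real_nat_ceiling_ge)
      ultimately have "1 \<le> real N" by linarith
      then show "N \<ge> 1" by simp
      have "real N \<le> 1 / r + 1" using r by (simp add: N_def)
      also have "\<dots> \<le> 2 / r" using r by (simp add: field_simps)
      finally show "real N \<le> 2 / r" .
    qed
    define f where "f l = b l * (1 - jac_cos \<alpha> \<beta> l r)" for l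
    have f0: "f l \<ge> 0" for l using b0 jac_cos_bound[of l r] by (simp add: f_def)
    have f2: "f l \<le> 2 * C0 * (1 + real l) powr (- 1 - \<nu>)" for l
    proof -
      have "f l \<le> b l * 2" unfolding f_def using b0 jac_cos_bound[of l r] by (intro mult_left_mono) auto
      then show ?thesis using bC[of l] by simp
    qed
    have f1: "f l \<le> C0 * r\<^sup>2 / 2 * (1 + real l) powr (2 - \<nu> - 1)" for l
    proof -
      have "f l \<le> b l * ((real l * r)\<^sup>2 / 2)" unfolding f_def using b0 one_minus_jac_cos by (intro mult_left_mono)
      also have "\<dots> \<le> (C0 * (1 + real l) powr (- 1 - \<nu>)) * (((1 + real l) * r)\<^sup>2 / 2)"
        using bC r C0 b0 by (intro mult_mono divide_right_mono power_mono) auto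
      also have "\<dots> = C0 * r\<^sup>2 / 2 * ((1 + real l) powr (- 1 - \<nu>) * (1 + real l) powr 2)"
        by (simp add: power_mult_distrib powr_numeral)
      also have "(1 + real l) powr (- 1 - \<nu>) * (1 + real l) powr 2 = (1 + real l) powr (2 - \<nu> - 1)"
        by (subst powr_add[symmetric]) simp
      finally show ?thesis .
    qed
    have sumf: "summable f" unfolding f_def
    proof (rule summable_comparison_test'[of "\<lambda>l. 2 * b l"])
      show "summable (\<lambda>l. 2 * b l)" using bs by simp
      fix l show "norm (b l * (1 - jac_cos \<alpha> \<beta> l r)) \<le> 2 * b l"
      proof -
        have "b l * (1 - jac_cos \<alpha> \<beta> l r) \<le> b l * 2" "0 \<le> b l * (1 - jac_cos \<alpha> \<beta> l r)"
          using b0[of l] jac_cos_bound[of l r] by (auto intro!: mult_left_mono mult_nonneg_nonneg)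
        then show ?thesis by simp
      qed
    qed
    have "suminf f \<le> K * r powr \<nu>"
    proof (rule suminf_le_const[OF sumf])
      fix L
      have "(\<Sum>l<L. f l) \<le> (\<Sum>l<N. f l) + (\<Sum>l=N..<L. f l)"
      proof -
        have "(\<Sum>l<L. f l) \<le> (\<Sum>l\<in>{..<N} \<union> {N..<L}. f l)" using f0 by (intro sum_mono2) auto
        also have "\<dots> = (\<Sum>l<N. f l) + (\<Sum>l=N..<L. f l)" by (intro sum.union_disjoint) auto
        finally show ?thesis .
      qed
      also have "(\<Sum>l<N. f l) \<le> (\<Sum>l<N. C0 * r\<^sup>2 / 2 * (1 + real l) powr (2 - \<nu> - 1))" by (intro sum_mono f1)
      also have "\<dots> = C0 * r\<^sup>2 / 2 * (\<Sum>l<N. (1 + real l) powr (2 - \<nu> - 1))" by (simp add: sum_distrib_left)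
      also have "\<dots> \<le> C0 * r\<^sup>2 / 2 * ((1 + 1 / (2 - \<nu>)) * real N powr (2 - \<nu>))"
        using nu C0 by (intro mult_left_mono sum_powr_le) auto
      also have "\<dots> \<le> C0 * (2 * (1 + 1 / (2 - \<nu>))) * r powr \<nu>"
      proof -
        have "real N powr (2 - \<nu>) \<le> (2 / r) powr (2 - \<nu>)" using N nu by (intro powr_mono2) auto
        also have "\<dots> = 2 powr (2 - \<nu>) * r powr (\<nu> - 2)"
          using r powr_minus_divide[of r "2 - \<nu>"] by (simp add: powr_divide)
        also have "\<dots> \<le> 2 powr 2 * r powr (\<nu> - 2)" using nu by (intro mult_right_mono powr_mono) auto
        finally have "r\<^sup>2 * real N powr (2 - \<nu>) \<le> r\<^sup>2 * (4 * r powr (\<nu> - 2))" by (intro mult_left_mono) auto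
        also have "\<dots> = 4 * r powr \<nu>" using r powr_add[of r 2 "\<nu> - 2"] by (simp add: powr_numeral)
        finally have e: "r\<^sup>2 * real N powr (2 - \<nu>) \<le> 4 * r powr \<nu>" .
        have "C0 * r\<^sup>2 / 2 * ((1 + 1 / (2 - \<nu>)) * real N powr (2 - \<nu>)) = C0 / 2 * (1 + 1 / (2 - \<nu>)) * (r\<^sup>2 * real N powr (2 - \<nu>))"
          by (simp add: mult_ac)
        also have "\<dots> \<le> C0 / 2 * (1 + 1 / (2 - \<nu>)) * (4 * r powr \<nu>)"
          using nu C0 by (intro mult_left_mono e) auto
        also have "C0 / 2 * E * (4 * R) = C0 * (2 * E) * R" for E R by simp
        finally show ?thesis .
      qed
      also have "(\<Sum>l=N..<L. f l) \<le> (\<Sum>l=N..<L. 2 * C0 * (1 + real l) powr (- 1 - \<nu>))" by (intro sum_mono f2)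
      also have "\<dots> = 2 * C0 * (\<Sum>l=N..<L. (1 + real l) powr (- 1 - \<nu>))" by (simp add: sum_distrib_left)
      also have "\<dots> \<le> 2 * C0 * (real N powr (- \<nu>) / \<nu>)"
        using nu C0 N by (intro mult_left_mono sum_powr_tail_le) auto
      also have "\<dots> \<le> C0 * (2 / \<nu>) * r powr \<nu>"
      proof -
        have "real N powr (- \<nu>) \<le> (1 / r) powr (- \<nu>)" using N r nu by (intro powr_mono2') auto
        also have "\<dots> = r powr \<nu>" using r by (simp add: powr_divide powr_minus)
        finally show ?thesis using C0 nu by (simp add: divide_right_mono)
      qed
      finally show "(\<Sum>l<L. f l) \<le> K * r powr \<nu>" by (simp add: K_def algebra_simps)
    qed
    then show "(\<Sum>l. b l * (1 - jac_cos \<alpha> \<beta> l r)) \<le> K * r powr \<nu>" by (simp add: f_def[abs_def])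
  qed
qed

section \<open>Covariance of increments along an arc, degree by degree\<close>

definition incr_kernel :: "nat \<Rightarrow> real \<Rightarrow> real \<Rightarrow> real \<Rightarrow> real" where
  "incr_kernel l r s t = 2 * jac_cos \<alpha> \<beta> l (s - t) - jac_cos \<alpha> \<beta> l (s - t - r) - jac_cos \<alpha> \<beta> l (s - t + r)"

text \<open>Each \<open>cos (k * (s - t))\<close> is a Gram kernel of rank at most two, and
  differencing preserves that; the weights \<open>a k\<close> are nonnegative.\<close>

lemma incr_kernel_nonneg: "(\<Sum>i\<in>I. \<Sum>j\<in>I. c i * c j * incr_kernel l r (\<theta> i) (\<theta> j)) \<ge> 0"
proof -
  define a where "a = jac_coeff \<alpha> \<beta> l"
  define u where "u k i = cos (real k * \<theta> i) - cos (real k * (\<theta> i + r))" for k i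
  define v where "v k i = sin (real k * \<theta> i) - sin (real k * (\<theta> i + r))" for k i
  have "incr_kernel l r (\<theta> i) (\<theta> j) = (\<Sum>k\<le>l. a k * (u k i * u k j + v k i * v k j))" for i j
  proof -
    have c: "cos (real k * (s - t)) = cos (real k * s) * cos (real k * t) + sin (real k * s) * sin (real k * t)" for k s t
      by (simp add: right_diff_distrib cos_diff)
    have e: "\<theta> i - \<theta> j - r = \<theta> i - (\<theta> j + r)" "\<theta> i - \<theta> j + r = (\<theta> i + r) - \<theta> j" by simp_all
    \<comment> \<open>One copy of the doubled term is shifted by \<open>r\<close> in both arguments,
      so that the kernel becomes a product of two differences.\<close>
    have e2: "2 * jac_cos \<alpha> \<beta> l (\<theta> i - \<theta> j) = jac_cos \<alpha> \<beta> l (\<theta> i - \<theta> j) + jac_cos \<alpha> \<beta> l ((\<theta> i + r) - (\<theta> j + r))" by simp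
    show ?thesis unfolding incr_kernel_def e e2 unfolding jac_cos_def c a_def[symmetric] u_def v_def
      by (simp add: sum.distrib[symmetric] sum_subtractf[symmetric]) (intro sum.cong refl, simp add: algebra_simps)
  qed
  then have "(\<Sum>i\<in>I. \<Sum>j\<in>I. c i * c j * incr_kernel l r (\<theta> i) (\<theta> j)) =
    (\<Sum>i\<in>I. \<Sum>j\<in>I. \<Sum>k\<le>l. a k * ((c i * u k i) * (c j * u k j) + (c i * v k i) * (c j * v k j)))"
    by (simp add: sum_distrib_left algebra_simps)
  also have "\<dots> = (\<Sum>k\<le>l. \<Sum>i\<in>I. \<Sum>j\<in>I. a k * ((c i * u k i) * (c j * u k j) + (c i * v k i) * (c j * v k j)))"
    by (subst sum.swap[of _ "{..l}" I]) (intro sum.cong refl sum.swap)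
  also have "\<dots> = (\<Sum>k\<le>l. a k * ((\<Sum>i\<in>I. c i * u k i)\<^sup>2 + (\<Sum>i\<in>I. c i * v k i)\<^sup>2))"
    unfolding power2_eq_square sum_product by (simp add: sum_distrib_left sum.distrib distrib_left)
  also have "\<dots> \<ge> 0" unfolding a_def by (intro sum_nonneg mult_nonneg_nonneg jac_coeff_nonneg) auto
  finally show ?thesis .
qed

text \<open>Diagonal dominance: the diagonal is \<open>2 - 2 * R_l(r) \<ge> 1\<close>, and by
  \<open>2 * |x * y| \<le> x^2 + y^2\<close> the rest costs at most a fraction
  \<open>4 * \<eta> * card I \<le> 1 / 2\<close> of the sum of squares.\<close>

lemma incr_kernel_lower:
  assumes r: "\<bar>jac_cos \<alpha> \<beta> l r\<bar> \<le> 1 / 2" and I: "finite I" and eta: "4 * \<eta> * real (card I) \<le> 1 / 2" "\<eta> \<ge> 0"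
    and off: "\<And>i j. i \<in> I \<Longrightarrow> j \<in> I \<Longrightarrow> i \<noteq> j \<Longrightarrow> \<bar>incr_kernel l r (\<theta> i) (\<theta> j)\<bar> \<le> 4 * \<eta>"
  shows "(\<Sum>i\<in>I. \<Sum>j\<in>I. c i * c j * incr_kernel l r (\<theta> i) (\<theta> j)) \<ge> (\<Sum>i\<in>I. (c i)\<^sup>2) / 2"
proof -
  have diag: "incr_kernel l r (\<theta> i) (\<theta> i) \<ge> 1" for i using r by (simp add: incr_kernel_def)
  have pt: "c i * c j * incr_kernel l r (\<theta> i) (\<theta> j) \<ge> (if i = j then (c i)\<^sup>2 else 0) - 2 * \<eta> * ((c i)\<^sup>2 + (c j)\<^sup>2)"
    if "i \<in> I" "j \<in> I" for i j
  proof (cases "i = j")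
    case True
    have "(c i)\<^sup>2 * 1 \<le> (c i)\<^sup>2 * incr_kernel l r (\<theta> i) (\<theta> i)" by (intro mult_left_mono diag) auto
    moreover have "0 \<le> 2 * \<eta> * ((c i)\<^sup>2 + (c j)\<^sup>2)" using eta by (intro mult_nonneg_nonneg) auto
    ultimately show ?thesis using True by (simp add: power2_eq_square)
  next
    case False
    have "\<bar>c i * c j * incr_kernel l r (\<theta> i) (\<theta> j)\<bar> \<le> (((c i)\<^sup>2 + (c j)\<^sup>2) / 2) * (4 * \<eta>)"
      unfolding abs_mult[of "c i * c j"]
    proof (intro mult_mono off that False)
      show "\<bar>c i * c j\<bar> \<le> ((c i)\<^sup>2 + (c j)\<^sup>2) / 2"
        using sum_squares_bound[of "\<bar>c i\<bar>" "\<bar>c j\<bar>"] by (simp add: abs_mult)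
    qed auto
    then show ?thesis using False by simp
  qed
  define S where "S = (\<Sum>i\<in>I. (c i)\<^sup>2)"
  have S: "S \<ge> 0" by (auto simp: S_def intro: sum_nonneg)
  have "(\<Sum>i\<in>I. \<Sum>j\<in>I. c i * c j * incr_kernel l r (\<theta> i) (\<theta> j)) \<ge> (\<Sum>i\<in>I. \<Sum>j\<in>I. (if i = j then (c i)\<^sup>2 else 0) - 2 * \<eta> * ((c i)\<^sup>2 + (c j)\<^sup>2))"
    by (intro sum_mono pt)
  moreover have "(\<Sum>i\<in>I. \<Sum>j\<in>I. (if i = j then (c i)\<^sup>2 else 0) - 2 * \<eta> * ((c i)\<^sup>2 + (c j)\<^sup>2)) = S - 4 * \<eta> * real (card I) * S"
  proof -
    have "(\<Sum>i\<in>I. \<Sum>j\<in>I. if i = j then (c i)\<^sup>2 else 0) = S" using I by (simp add: S_def)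
    moreover have "(\<Sum>i\<in>I. \<Sum>j\<in>I. (c i)\<^sup>2 + (c j)\<^sup>2) = 2 * real (card I) * S"
      by (simp add: sum.distrib S_def sum_distrib_left[symmetric])
    ultimately show ?thesis by (simp add: sum_subtractf sum_distrib_left[symmetric])
  qed
  moreover have "4 * \<eta> * real (card I) * S \<le> 1 / 2 * S" using eta S by (intro mult_right_mono) auto
  ultimately show ?thesis by (simp add: S_def)
qed

end

section \<open>Independence from characteristic functions\<close>

text \<open>Change of measure: \<open>2 + h\<close> is a positive density up to normalization, and
  the factorization hypotheses say that \<open>X\<close> has the same characteristic function under
  it. Uniqueness in dimension one then decouples \<open>X\<close> from \<open>h\<close>, which will
  be the cosine or sine of \<open>Y\<close>.\<close>

lemma integral_iexp_density_indep:
  fixes X Y h :: "'w \<Rightarrow> real"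
  assumes "prob_space M" and X: "X \<in> borel_measurable M" and Y: "Y \<in> borel_measurable M"
    and plus: "\<And>s. (CLINT \<omega>|M. iexp (s * X \<omega> + Y \<omega>)) = (CLINT \<omega>|M. iexp (s * X \<omega>)) * (CLINT \<omega>|M. iexp (Y \<omega>))"
    and minus: "\<And>s. (CLINT \<omega>|M. iexp (s * X \<omega> - Y \<omega>)) = (CLINT \<omega>|M. iexp (s * X \<omega>)) * (CLINT \<omega>|M. iexp (- Y \<omega>))"
    and h: "h \<in> borel_measurable M" "\<And>\<omega>. \<bar>h \<omega>\<bar> \<le> 1"
      "\<And>\<omega>. complex_of_real (h \<omega>) = a * iexp (Y \<omega>) + b * iexp (- Y \<omega>)"
    and A: "A \<in> sets borel"
  shows "(\<integral>\<omega>. indicator A (X \<omega>) * h \<omega> \<partial>M) = measure M {\<omega>\<in>space M. X \<omega> \<in> A} * (\<integral>\<omega>. h \<omega> \<partial>M)"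
proof -
  interpret prob_space M by fact
  note [measurable] = X Y h(1) A
  have int: "integrable M (\<lambda>\<omega>. iexp (f \<omega>))" if "f \<in> borel_measurable M" for f :: "'w \<Rightarrow> real"
    using that by (intro integrable_const_bound[where B=1]) auto
  have int': "integrable M (\<lambda>\<omega>. exp (- (\<i> * complex_of_real (Y \<omega>))))" using int[of "\<lambda>\<omega>. - Y \<omega>"] by simp
  have int_h: "integrable M h" using h by (intro integrable_const_bound[where B=1]) auto
  have Eh: "complex_of_real (expectation h) = a * (CLINT \<omega>|M. iexp (Y \<omega>)) + b * (CLINT \<omega>|M. iexp (- Y \<omega>))"
  proof -
    have "complex_of_real (expectation h) = (CLINT \<omega>|M. complex_of_real (h \<omega>))"
      by (rule integral_complex_of_real[symmetric])
    also have "\<dots> = a * (CLINT \<omega>|M. iexp (Y \<omega>)) + b * (CLINT \<omega>|M. iexp (- Y \<omega>))"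
      unfolding h(3) by (subst Bochner_Integration.integral_add) (auto intro!: int int')
    finally show ?thesis .
  qed
  have int_mult: "integrable M (\<lambda>\<omega>. iexp (s * X \<omega>) * complex_of_real (h \<omega>))" for s
    using h(2) by (intro integrable_const_bound[where B=1]) (auto simp: norm_mult)
  have E: "(CLINT \<omega>|M. iexp (s * X \<omega>) * complex_of_real (h \<omega>)) = (CLINT \<omega>|M. iexp (s * X \<omega>)) * complex_of_real (expectation h)" for s
  proof -
    have "(CLINT \<omega>|M. iexp (s * X \<omega>) * complex_of_real (h \<omega>)) = (CLINT \<omega>|M. a * iexp (s * X \<omega> + Y \<omega>) + b * iexp (s * X \<omega> - Y \<omega>))"
      unfolding h(3) by (intro Bochner_Integration.integral_cong refl) (simp add: algebra_simps exp_add[symmetric] exp_diff exp_minus field_simps)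
    also have "\<dots> = a * (CLINT \<omega>|M. iexp (s * X \<omega> + Y \<omega>)) + b * (CLINT \<omega>|M. iexp (s * X \<omega> - Y \<omega>))"
      using int[of "\<lambda>\<omega>. s * X \<omega> + Y \<omega>"] int[of "\<lambda>\<omega>. s * X \<omega> - Y \<omega>"]
      by (subst Bochner_Integration.integral_add) auto
    finally show ?thesis unfolding plus minus Eh by (simp add: algebra_simps)
  qed
  \<comment> \<open>The total mass of the density \<open>2 + h\<close>; it is at least 1.\<close>
  define c where "c = 2 + expectation h"
  have "\<bar>expectation h\<bar> \<le> 1"
    using h by (intro order.trans[OF integral_abs_bound] integral_le_const) (auto intro: int_h)
  then have c: "c > 0" by (simp add: c_def)
  have hpos: "2 + h \<omega> > 0" for \<omega> using h(2)[of \<omega>] by linarith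
  define N where "N = density M (\<lambda>\<omega>. ennreal ((2 + h \<omega>) / c))"
  have int2: "integrable M (\<lambda>\<omega>. (2 + h \<omega>) / c)" using int_h by simp
  have N1: "(\<integral>\<omega>. (2 + h \<omega>) / c \<partial>M) = 1" using int_h c by (simp add: c_def prob_space)
  have "prob_space N"
  proof
    have "emeasure N (space N) = (\<integral>\<^sup>+\<omega>. ennreal ((2 + h \<omega>) / c) \<partial>M)"
      by (simp add: N_def emeasure_density cong: nn_integral_cong)
    also have "\<dots> = 1" using nn_integral_eq_integral[OF int2] hpos c N1 by (simp add: less_imp_le)
    finally show "emeasure N (space N) = 1" .
  qed
  then interpret N: prob_space N .
  have XN[measurable]: "X \<in> borel_measurable N" by (simp add: N_def)
  have "distr N borel X = distr M borel X"
  proof (rule Levy_uniqueness)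
    show "real_distribution (distr N borel X)" by (rule N.real_distribution_distr) fact
    show "real_distribution (distr M borel X)" by (rule real_distribution_distr) fact
    show "char (distr N borel X) = char (distr M borel X)"
    proof
      fix s
      have "char (distr N borel X) s = (CLINT \<omega>|N. iexp (s * X \<omega>))"
        unfolding char_def by (subst integral_distr) auto
      also have "\<dots> = (CLINT \<omega>|M. ((2 + h \<omega>) / c) *\<^sub>R iexp (s * X \<omega>))"
        unfolding N_def using hpos c by (subst integral_density) (auto simp: less_imp_le)
      also have "\<dots> = (CLINT \<omega>|M. (2 / of_real c) * iexp (s * X \<omega>) + (1 / of_real c) * (iexp (s * X \<omega>) * complex_of_real (h \<omega>)))"
        by (intro Bochner_Integration.integral_cong refl) (simp add: scaleR_conv_of_real add_divide_distrib algebra_simps)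
      also have "\<dots> = (2 / of_real c) * (CLINT \<omega>|M. iexp (s * X \<omega>)) + (1 / of_real c) * (CLINT \<omega>|M. iexp (s * X \<omega>) * complex_of_real (h \<omega>))"
        using int[of "\<lambda>\<omega>. s * X \<omega>"] int_mult[of s]
        by (subst Bochner_Integration.integral_add) auto
      also have "\<dots> = (CLINT \<omega>|M. iexp (s * X \<omega>)) * (2 + of_real (expectation h)) / of_real c"
        unfolding E by (simp add: add_divide_distrib algebra_simps)
      also have "\<dots> = (CLINT \<omega>|M. iexp (s * X \<omega>))"
      proof -
        have "2 + complex_of_real (expectation h) = complex_of_real c" by (simp add: c_def)
        then show ?thesis using c by (simp only:) simp
      qed
      also have "\<dots> = char (distr M borel X) s"
        unfolding char_def by (subst integral_distr) auto
      finally show "char (distr N borel X) s = char (distr M borel X) s" .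
    qed
  qed
  then have "measure N (X -` A \<inter> space N) = measure M (X -` A \<inter> space M)"
    using measure_distr[OF XN A] measure_distr[OF X A] by simp
  moreover have "measure N (X -` A \<inter> space N) = (\<integral>\<omega>. indicator A (X \<omega>) \<partial>N)"
  proof -
    have "(\<integral>\<omega>. indicator A (X \<omega>) \<partial>N) = (\<integral>\<omega>. indicator (X -` A \<inter> space N) \<omega> \<partial>N :: real)"
      by (intro Bochner_Integration.integral_cong) (auto simp: indicator_def)
    then show ?thesis by simp
  qed
  moreover have "(\<integral>\<omega>. indicator A (X \<omega>) \<partial>N) = (\<integral>\<omega>. ((2 + h \<omega>) / c) * indicator A (X \<omega>) \<partial>M :: real)"
    unfolding N_def using hpos c by (subst integral_density) (auto simp: less_imp_le)
  moreover have "(\<integral>\<omega>. ((2 + h \<omega>) / c) * indicator A (X \<omega>) \<partial>M :: real) = (2 * measure M (X -` A \<inter> space M) + (\<integral>\<omega>. indicator A (X \<omega>) * h \<omega> \<partial>M)) / c"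
  proof -
    have i1: "integrable M (\<lambda>\<omega>. indicator A (X \<omega>) * h \<omega>)"
      using h(2) by (intro integrable_const_bound[where B=1]) (auto simp: indicator_def)
    have i2: "integrable M (\<lambda>\<omega>. indicator A (X \<omega>) :: real)"
      by (intro integrable_const_bound[where B=1]) (auto simp: indicator_def)
    have "(\<integral>\<omega>. indicator A (X \<omega>) \<partial>M) = (\<integral>\<omega>. indicator (X -` A \<inter> space M) \<omega> \<partial>M :: real)"
      by (intro Bochner_Integration.integral_cong) (auto simp: indicator_def)
    then have e: "(\<integral>\<omega>. indicator A (X \<omega>) \<partial>M) = measure M (X -` A \<inter> space M)" by simp
    have "(\<integral>\<omega>. ((2 + h \<omega>) / c) * indicator A (X \<omega>) \<partial>M :: real) = (\<integral>\<omega>. (2 * indicator A (X \<omega>) + indicator A (X \<omega>) * h \<omega>) / c \<partial>M)"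
      by (intro Bochner_Integration.integral_cong refl) (simp add: algebra_simps)
    also have "\<dots> = (\<integral>\<omega>. 2 * indicator A (X \<omega>) + indicator A (X \<omega>) * h \<omega> \<partial>M) / c" by simp
    also have "(\<integral>\<omega>. 2 * indicator A (X \<omega>) + indicator A (X \<omega>) * h \<omega> \<partial>M) = 2 * measure M (X -` A \<inter> space M) + (\<integral>\<omega>. indicator A (X \<omega>) * h \<omega> \<partial>M)"
      using i1 i2 by (subst Bochner_Integration.integral_add) (auto simp: e)
    finally show ?thesis .
  qed
  ultimately have "2 * measure M (X -` A \<inter> space M) + (\<integral>\<omega>. indicator A (X \<omega>) * h \<omega> \<partial>M) = measure M (X -` A \<inter> space M) * c"
    using c by (simp add: field_simps)
  moreover have "X -` A \<inter> space M = {\<omega>\<in>space M. X \<omega> \<in> A}" by auto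
  ultimately show ?thesis by (simp add: c_def algebra_simps)
qed

lemma iexp_cos_sin: "iexp x = complex_of_real (cos x) + \<i> * complex_of_real (sin x)"
  by (simp add: exp_Euler cos_of_real sin_of_real)

lemma iexp_minus_cos_sin: "iexp (- x) = complex_of_real (cos x) - \<i> * complex_of_real (sin x)"
  using iexp_cos_sin[of "- x"] by simp

lemma integral_iexp_indicator_indep:
  fixes X Y :: "'w \<Rightarrow> real"
  assumes M: "prob_space M" and X: "X \<in> borel_measurable M" and Y: "Y \<in> borel_measurable M"
    and plus: "\<And>s. (CLINT \<omega>|M. iexp (s * X \<omega> + Y \<omega>)) = (CLINT \<omega>|M. iexp (s * X \<omega>)) * (CLINT \<omega>|M. iexp (Y \<omega>))"
    and minus: "\<And>s. (CLINT \<omega>|M. iexp (s * X \<omega> - Y \<omega>)) = (CLINT \<omega>|M. iexp (s * X \<omega>)) * (CLINT \<omega>|M. iexp (- Y \<omega>))"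
    and A: "A \<in> sets borel"
  shows "(CLINT \<omega>|M. indicator A (X \<omega>) *\<^sub>R iexp (Y \<omega>)) = measure M {\<omega>\<in>space M. X \<omega> \<in> A} *\<^sub>R (CLINT \<omega>|M. iexp (Y \<omega>))"
proof -
  interpret prob_space M by fact
  note [measurable] = X Y A
  note step = integral_iexp_density_indep[OF M X Y plus minus _ _ _ A]
  \<comment> \<open>Euler's formulas supply the coefficients \<open>a\<close> and \<open>b\<close>
    for cosine and sine.\<close>
  have c: "(\<integral>\<omega>. indicator A (X \<omega>) * cos (Y \<omega>) \<partial>M) = prob {\<omega>\<in>space M. X \<omega> \<in> A} * (\<integral>\<omega>. cos (Y \<omega>) \<partial>M)"
    by (rule step[where a = "1/2" and b = "1/2"]) (auto simp only: iexp_minus_cos_sin iexp_cos_sin, auto simp: field_simps)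
  have s: "(\<integral>\<omega>. indicator A (X \<omega>) * sin (Y \<omega>) \<partial>M) = prob {\<omega>\<in>space M. X \<omega> \<in> A} * (\<integral>\<omega>. sin (Y \<omega>) \<partial>M)"
    by (rule step[where a = "1/(2*\<i>)" and b = "-1/(2*\<i>)"]) (auto simp only: iexp_minus_cos_sin iexp_cos_sin, auto simp: field_simps)
  have int: "integrable M (\<lambda>\<omega>. f \<omega> :: real)" if "f \<in> borel_measurable M" "\<And>\<omega>. \<bar>f \<omega>\<bar> \<le> 1" for f
    using that by (intro integrable_const_bound[where B=1]) auto
  have bd: "\<bar>indicator A (X \<omega>) * cos (Y \<omega>)\<bar> \<le> 1" "\<bar>indicator A (X \<omega>) * sin (Y \<omega>)\<bar> \<le> 1" for \<omega>
    by (auto simp: indicator_def)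
  have split: "(CLINT \<omega>|M. of_real (f \<omega>) + \<i> * of_real (g \<omega>)) = of_real (\<integral>\<omega>. f \<omega> \<partial>M) + \<i> * of_real (\<integral>\<omega>. g \<omega> \<partial>M)"
    if "integrable M f" "integrable M g" for f g :: "'w \<Rightarrow> real"
    using that by (subst Bochner_Integration.integral_add) auto
  have "(CLINT \<omega>|M. indicator A (X \<omega>) *\<^sub>R iexp (Y \<omega>)) =
    (CLINT \<omega>|M. of_real (indicator A (X \<omega>) * cos (Y \<omega>)) + \<i> * of_real (indicator A (X \<omega>) * sin (Y \<omega>)))"
    unfolding iexp_cos_sin by (intro Bochner_Integration.integral_cong refl) (simp add: scaleR_conv_of_real algebra_simps)
  also have "\<dots> = of_real (prob {\<omega>\<in>space M. X \<omega> \<in> A} * (\<integral>\<omega>. cos (Y \<omega>) \<partial>M)) + \<i> * of_real (prob {\<omega>\<in>space M. X \<omega> \<in> A} * (\<integral>\<omega>. sin (Y \<omega>) \<partial>M))"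
    using bd by (subst split) (auto intro!: int simp: c s)
  also have "\<dots> = prob {\<omega>\<in>space M. X \<omega> \<in> A} *\<^sub>R (CLINT \<omega>|M. iexp (Y \<omega>))"
    unfolding iexp_cos_sin by (subst split) (auto intro!: int simp: scaleR_conv_of_real algebra_simps)
  finally show ?thesis .
qed

text \<open>
  Kac's theorem. Conditioning on one of the variables keeps the characteristic functions of the
  others, so that uniqueness of characteristic functions is only needed in dimension one.
\<close>

lemma char_factor_imp_indep:
  fixes X :: "'i \<Rightarrow> 'w \<Rightarrow> real"
  assumes "finite J" "prob_space M" "\<And>j. j \<in> J \<Longrightarrow> X j \<in> borel_measurable M"
    and "\<And>t. (CLINT \<omega>|M. iexp (\<Sum>j\<in>J. t j * X j \<omega>)) = (\<Prod>j\<in>J. CLINT \<omega>|M. iexp (t j * X j \<omega>))"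
    and "\<And>j. j \<in> J \<Longrightarrow> A j \<in> sets borel"
  shows "measure M {\<omega>\<in>space M. \<forall>j\<in>J. X j \<omega> \<in> A j} = (\<Prod>j\<in>J. measure M {\<omega>\<in>space M. X j \<omega> \<in> A j})"
  using assms
proof (induction J arbitrary: M rule: finite_induct)
  case empty
  then show ?case by (simp add: prob_space.prob_space)
next
  case (insert k J M)
  interpret prob_space M by fact
  have X[measurable]: "\<And>j. j \<in> insert k J \<Longrightarrow> X j \<in> borel_measurable M" and A[measurable]: "\<And>j. j \<in> insert k J \<Longrightarrow> A j \<in> sets borel"
    using insert.prems by auto
  have [measurable]: "X k \<in> borel_measurable M" "A k \<in> sets borel" using X A by auto
  define B where "B = {\<omega>\<in>space M. X k \<omega> \<in> A k}"
  have B[measurable]: "B \<in> sets M" unfolding B_def by measurable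
  have kJ: "k \<notin> J" "finite J" by fact+
  \<comment> \<open>The \<open>k\<close>-th coefficient is set free; putting it to 0 afterwards
    shows that the factorization passes to \<open>J\<close>.\<close>
  have factor_k: "(CLINT \<omega>|M. iexp (s * X k \<omega> + (\<Sum>j\<in>J. t j * X j \<omega>))) = (CLINT \<omega>|M. iexp (s * X k \<omega>)) * (\<Prod>j\<in>J. CLINT \<omega>|M. iexp (t j * X j \<omega>))" for s t
  proof -
    have "(\<Sum>j\<in>J. (t(k := s)) j * X j \<omega>) = (\<Sum>j\<in>J. t j * X j \<omega>)" for \<omega> using kJ by (intro sum.cong) auto
    moreover have "(\<Prod>j\<in>J. CLINT \<omega>|M. iexp ((t(k := s)) j * X j \<omega>)) = (\<Prod>j\<in>J. CLINT \<omega>|M. iexp (t j * X j \<omega>))"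
      using kJ by (intro prod.cong) auto
    ultimately show ?thesis using insert.prems(3)[of "t(k := s)"] kJ by simp
  qed
  have factor_J: "(CLINT \<omega>|M. iexp (\<Sum>j\<in>J. t j * X j \<omega>)) = (\<Prod>j\<in>J. CLINT \<omega>|M. iexp (t j * X j \<omega>))" for t
    using factor_k[of 0 t] by (simp add: prob_space)
  show ?case
  proof (cases "prob B = 0")
    case True
    have "prob {\<omega>\<in>space M. \<forall>j\<in>insert k J. X j \<omega> \<in> A j} \<le> prob B"
      by (intro finite_measure_mono) (auto simp: B_def)
    then have "prob {\<omega>\<in>space M. \<forall>j\<in>insert k J. X j \<omega> \<in> A j} = 0" using True by (simp add: measure_le_0_iff)
    then show ?thesis using True kJ by (simp add: B_def)
  next
    case False
    then have pB: "prob B > 0" by (simp add: zero_less_measure_iff)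
    \<comment> \<open>Conditioning on the event for \<open>X k\<close>. The induction hypothesis is
      applied to \<open>Q\<close>, which is why the measure is generalized in the induction.\<close>
    define Q where "Q = uniform_measure M B"
    have "prob_space Q" unfolding Q_def using pB by (intro prob_space_uniform_measure) (auto simp: emeasure_eq_measure)
    then interpret Q: prob_space Q .
    have XQ[measurable]: "X j \<in> borel_measurable Q" if "j \<in> J" for j using X that by (simp add: Q_def)
    have intQ: "(CLINT \<omega>|Q. f \<omega>) = (CLINT \<omega>|M. indicator B \<omega> *\<^sub>R f \<omega>) / prob B" if "f \<in> borel_measurable M" for f :: "'w \<Rightarrow> complex"
    proof -
      have "Q = density M (\<lambda>\<omega>. ennreal (indicator B \<omega> / prob B))"
        unfolding Q_def uniform_measure_def using pB
        by (intro density_cong) (auto simp: emeasure_eq_measure divide_ennreal indicator_def ennreal_1[symmetric] simp del: ennreal_1)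
      then have "(CLINT \<omega>|Q. f \<omega>) = (CLINT \<omega>|M. (indicator B \<omega> / prob B) *\<^sub>R f \<omega>)"
        using that pB by (simp add: integral_density)
      also have "\<dots> = (CLINT \<omega>|M. (indicator B \<omega> *\<^sub>R f \<omega>) / prob B)"
        by (intro Bochner_Integration.integral_cong refl) (simp add: scaleR_conv_of_real)
      finally show ?thesis by simp
    qed
    have charQ: "(CLINT \<omega>|Q. iexp (\<Sum>j\<in>J. t j * X j \<omega>)) = (CLINT \<omega>|M. iexp (\<Sum>j\<in>J. t j * X j \<omega>))" for t
    proof -
      define Y where "Y \<omega> = (\<Sum>j\<in>J. t j * X j \<omega>)" for \<omega>
      have Y[measurable]: "Y \<in> borel_measurable M" unfolding Y_def using X by measurable
      have mY: "- Y \<omega> = (\<Sum>j\<in>J. (- t j) * X j \<omega>)" for \<omega> by (simp add: Y_def sum_negf)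
      have "(CLINT \<omega>|M. indicator (A k) (X k \<omega>) *\<^sub>R iexp (Y \<omega>)) = prob {\<omega>\<in>space M. X k \<omega> \<in> A k} *\<^sub>R (CLINT \<omega>|M. iexp (Y \<omega>))"
      proof (rule integral_iexp_indicator_indep)
        fix s
        show "(CLINT \<omega>|M. iexp (s * X k \<omega> + Y \<omega>)) = (CLINT \<omega>|M. iexp (s * X k \<omega>)) * (CLINT \<omega>|M. iexp (Y \<omega>))"
          unfolding Y_def factor_J by (rule factor_k)
        show "(CLINT \<omega>|M. iexp (s * X k \<omega> - Y \<omega>)) = (CLINT \<omega>|M. iexp (s * X k \<omega>)) * (CLINT \<omega>|M. iexp (- Y \<omega>))"
          unfolding diff_conv_add_uminus mY factor_J by (rule factor_k)
      qed (use prob_space_axioms in auto)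
      moreover have "(CLINT \<omega>|M. indicator B \<omega> *\<^sub>R iexp (Y \<omega>)) = (CLINT \<omega>|M. indicator (A k) (X k \<omega>) *\<^sub>R iexp (Y \<omega>))"
        by (intro Bochner_Integration.integral_cong refl) (auto simp: B_def indicator_def)
      moreover have "(CLINT \<omega>|Q. iexp (Y \<omega>)) = (CLINT \<omega>|M. indicator B \<omega> *\<^sub>R iexp (Y \<omega>)) / prob B"
        by (rule intQ) measurable
      ultimately show ?thesis using pB unfolding Y_def[symmetric] B_def[symmetric] by (simp add: scaleR_conv_of_real)
    qed
    have char1: "(CLINT \<omega>|Q. iexp (s * X j \<omega>)) = (CLINT \<omega>|M. iexp (s * X j \<omega>))" if "j \<in> J" for j s
    proof -
      have "(\<Sum>i\<in>J. (if i = j then s else 0) * X i \<omega>) = s * X j \<omega>" for \<omega>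
        using that kJ by (subst if_distrib[of "\<lambda>x. x * _"]) (simp add: if_distribR sum.delta cong: if_cong)
      then show ?thesis using charQ[of "\<lambda>i. if i = j then s else 0"] by simp
    qed
    \<comment> \<open>The induction hypothesis delivers marginals under \<open>Q\<close>; they must
      agree with the original ones.\<close>
    have Q1: "measure Q {\<omega>\<in>space Q. X j \<omega> \<in> A j} = prob {\<omega>\<in>space M. X j \<omega> \<in> A j}" if j: "j \<in> J" for j
    proof -
      have [measurable]: "X j \<in> borel_measurable M" "A j \<in> sets borel" "X j \<in> borel_measurable Q" using j X A XQ by auto
      have "distr Q borel (X j) = distr M borel (X j)"
      proof (rule Levy_uniqueness)
        show "char (distr Q borel (X j)) = char (distr M borel (X j))"
          using char1[OF j] by (simp add: fun_eq_iff char_def integral_distr)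
      qed (auto intro!: Q.real_distribution_distr real_distribution_distr)
      then have "measure (distr Q borel (X j)) (A j) = measure (distr M borel (X j)) (A j)" by simp
      then have "measure Q (X j -` A j \<inter> space Q) = measure M (X j -` A j \<inter> space M)"
        by (simp add: measure_distr)
      moreover have "X j -` A j \<inter> space N = {\<omega>\<in>space N. X j \<omega> \<in> A j}" for N by auto
      ultimately show ?thesis by simp
    qed
    have "measure Q {\<omega>\<in>space Q. \<forall>j\<in>J. X j \<omega> \<in> A j} = (\<Prod>j\<in>J. measure Q {\<omega>\<in>space Q. X j \<omega> \<in> A j})"
    proof (rule insert.IH)
      show "(CLINT \<omega>|Q. iexp (\<Sum>j\<in>J. t j * X j \<omega>)) = (\<Prod>j\<in>J. CLINT \<omega>|Q. iexp (t j * X j \<omega>))" for t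
        unfolding charQ factor_J by (intro prod.cong refl char1[symmetric])
    qed (use XQ A Q.prob_space_axioms in auto)
    also have "\<dots> = (\<Prod>j\<in>J. prob {\<omega>\<in>space M. X j \<omega> \<in> A j})" by (intro prod.cong refl Q1)
    finally have e: "measure Q {\<omega>\<in>space Q. \<forall>j\<in>J. X j \<omega> \<in> A j} = (\<Prod>j\<in>J. prob {\<omega>\<in>space M. X j \<omega> \<in> A j})" .
    have [measurable]: "{\<omega>\<in>space M. \<forall>j\<in>J. X j \<omega> \<in> A j} \<in> sets M"
      using X A kJ by (intro sets.sets_Collect_finite_All) (auto intro!: measurable_sets_Collect)
    have "measure Q {\<omega>\<in>space Q. \<forall>j\<in>J. X j \<omega> \<in> A j} = prob (B \<inter> {\<omega>\<in>space M. \<forall>j\<in>J. X j \<omega> \<in> A j}) / prob B"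
      unfolding Q_def using pB by (subst measure_uniform_measure) (auto simp: emeasure_eq_measure)
    moreover have "B \<inter> {\<omega>\<in>space M. \<forall>j\<in>J. X j \<omega> \<in> A j} = {\<omega>\<in>space M. \<forall>j\<in>insert k J. X j \<omega> \<in> A j}"
      by (auto simp: B_def)
    ultimately have "prob {\<omega>\<in>space M. \<forall>j\<in>insert k J. X j \<omega> \<in> A j} = prob B * (\<Prod>j\<in>J. prob {\<omega>\<in>space M. X j \<omega> \<in> A j})"
      using e pB by (simp add: field_simps)
    then show ?thesis using kJ by (simp add: B_def)
  qed
qed

section \<open>Gaussian spaces\<close>

text \<open>Joint normality is encoded by linearity: every linear combination of members is again
  normal. Variances may vanish, so \<open>ip\<close> is only a semi-inner product and a null vector
  vanishes only almost surely.\<close>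

locale gaussian_space = prob_space P for P :: "'w measure" +
  fixes G :: "('w \<Rightarrow> real) set"
  assumes gaussian: "X \<in> G \<Longrightarrow> gaussian_rv P X"
    and centered: "X \<in> G \<Longrightarrow> expectation X = 0"
    and zero_mem: "(\<lambda>_. 0) \<in> G"
    and add_mem: "X \<in> G \<Longrightarrow> Y \<in> G \<Longrightarrow> (\<lambda>\<omega>. X \<omega> + Y \<omega>) \<in> G"
    and scale_mem: "X \<in> G \<Longrightarrow> (\<lambda>\<omega>. c * X \<omega>) \<in> G"
begin

definition ip :: "('w \<Rightarrow> real) \<Rightarrow> ('w \<Rightarrow> real) \<Rightarrow> real" where
  "ip X Y = expectation (\<lambda>\<omega>. X \<omega> * Y \<omega>)"

lemma meas_mem: "X \<in> G \<Longrightarrow> X \<in> borel_measurable P"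
  using gaussian by (auto simp: gaussian_rv_def)

lemma normal_cases:
  assumes "X \<in> G"
  obtains \<sigma> where "\<sigma> > 0" "distributed P lborel X (normal_density 0 \<sigma>)" | "AE \<omega> in P. X \<omega> = 0"
proof -
  from gaussian[OF assms] obtain \<mu> \<sigma> where
    "(\<sigma> > 0 \<and> distributed P lborel X (normal_density \<mu> \<sigma>)) \<or> (\<sigma> = 0 \<and> (AE \<omega> in P. X \<omega> = \<mu>))"
    unfolding gaussian_rv_def by auto
  then show ?thesis
  proof (elim disjE conjE)
    assume s: "\<sigma> > 0" "distributed P lborel X (normal_density \<mu> \<sigma>)"
    then have "expectation X = \<mu>" by (simp add: normal_distributed_expectation)
    then have "\<mu> = 0" using centered[OF assms] by simp
    then show ?thesis using s that(1) by blast
  next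
    assume a: "AE \<omega> in P. X \<omega> = \<mu>"
    have "expectation X = expectation (\<lambda>_. \<mu>)"
      using a meas_mem[OF assms] by (intro integral_cong_AE) auto
    then have "\<mu> = 0" using centered[OF assms] by (simp add: prob_space)
    then show ?thesis using a that(2) by blast
  qed
qed

lemma ip_normal:
  assumes "\<sigma> > 0" "distributed P lborel X (normal_density 0 \<sigma>)"
  shows "ip X X = \<sigma>\<^sup>2"
proof -
  have "expectation X = 0" using assms by (simp add: normal_distributed_expectation)
  then show ?thesis using normal_distributed_variance[OF assms]
    by (simp add: ip_def power2_eq_square)
qed

lemma sq_integrable:
  assumes "X \<in> G" shows "integrable P (\<lambda>\<omega>. X \<omega> * X \<omega>)"
  using assms
proof (cases rule: normal_cases)
  case (1 \<sigma>)
  \<comment> \<open>A nonzero Bochner integral already certifies integrability, since the integral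
    of a nonintegrable function is 0 by definition.\<close>
  then have "expectation (\<lambda>\<omega>. X \<omega> * X \<omega>) \<noteq> 0" using ip_normal[of \<sigma> X] by (simp add: ip_def)
  then show ?thesis using not_integrable_integral_eq by blast
next
  case 2
  have "integrable P (\<lambda>\<omega>. X \<omega> * X \<omega>) \<longleftrightarrow> integrable P (\<lambda>\<omega>. 0 :: real)"
    using 2 meas_mem[OF assms] by (intro integrable_cong_AE) auto
  then show ?thesis by simp
qed

lemma minus_mem: "X \<in> G \<Longrightarrow> (\<lambda>\<omega>. - X \<omega>) \<in> G"
  using scale_mem[of X "-1"] by simp

lemma diff_mem: "X \<in> G \<Longrightarrow> Y \<in> G \<Longrightarrow> (\<lambda>\<omega>. X \<omega> - Y \<omega>) \<in> G"
  using add_mem[OF _ minus_mem, of X Y] by simp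

lemma sum_mem:
  assumes "\<And>i. i \<in> I \<Longrightarrow> X i \<in> G" shows "(\<lambda>\<omega>. \<Sum>i\<in>I. c i * X i \<omega>) \<in> G"
  using assms
  by (induction I rule: infinite_finite_induct) (auto intro!: zero_mem add_mem scale_mem)

lemma ip_integrable:
  assumes "X \<in> G" "Y \<in> G" shows "integrable P (\<lambda>\<omega>. X \<omega> * Y \<omega>)"
proof -
  have "integrable P (\<lambda>\<omega>. ((X \<omega> + Y \<omega>) * (X \<omega> + Y \<omega>) - X \<omega> * X \<omega> - Y \<omega> * Y \<omega>) / 2)"
    using sq_integrable[OF add_mem[OF assms]] sq_integrable assms by auto
  moreover have "((X \<omega> + Y \<omega>) * (X \<omega> + Y \<omega>) - X \<omega> * X \<omega> - Y \<omega> * Y \<omega>) / 2 = X \<omega> * Y \<omega>" for \<omega>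
    by (simp add: field_simps)
  ultimately show ?thesis by simp
qed

lemma ip_commute: "ip X Y = ip Y X" by (simp add: ip_def mult.commute)

lemma ip_add: "X \<in> G \<Longrightarrow> Y \<in> G \<Longrightarrow> Z \<in> G \<Longrightarrow> ip (\<lambda>\<omega>. X \<omega> + Y \<omega>) Z = ip X Z + ip Y Z"
  by (simp add: ip_def distrib_right ip_integrable)

lemma ip_diff: "X \<in> G \<Longrightarrow> Y \<in> G \<Longrightarrow> Z \<in> G \<Longrightarrow> ip (\<lambda>\<omega>. X \<omega> - Y \<omega>) Z = ip X Z - ip Y Z"
  by (simp add: ip_def left_diff_distrib ip_integrable)

lemma ip_scale: "ip (\<lambda>\<omega>. c * X \<omega>) Z = c * ip X Z"
  by (simp add: ip_def mult.assoc)

lemma ip_sum: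
  assumes "\<And>i. i \<in> I \<Longrightarrow> X i \<in> G" "Z \<in> G"
  shows "ip (\<lambda>\<omega>. \<Sum>i\<in>I. c i * X i \<omega>) Z = (\<Sum>i\<in>I. c i * ip (X i) Z)"
  using assms
  by (induction I rule: infinite_finite_induct)
    (auto simp: ip_add sum_mem scale_mem ip_scale, auto simp: ip_def)

lemma ip_sum_sum:
  assumes "\<And>i. i \<in> I \<Longrightarrow> X i \<in> G"
  shows "ip (\<lambda>\<omega>. \<Sum>i\<in>I. c i * X i \<omega>) (\<lambda>\<omega>. \<Sum>i\<in>I. c i * X i \<omega>) = (\<Sum>i\<in>I. \<Sum>j\<in>I. c i * c j * ip (X i) (X j))"
proof -
  have "ip (X i) (\<lambda>\<omega>. \<Sum>i\<in>I. c i * X i \<omega>) = (\<Sum>j\<in>I. c j * ip (X i) (X j))" if "i \<in> I" for i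
  proof -
    have "ip (X i) (\<lambda>\<omega>. \<Sum>i\<in>I. c i * X i \<omega>) = ip (\<lambda>\<omega>. \<Sum>i\<in>I. c i * X i \<omega>) (X i)" by (rule ip_commute)
    also have "\<dots> = (\<Sum>j\<in>I. c j * ip (X j) (X i))" using assms that by (intro ip_sum)
    also have "\<dots> = (\<Sum>j\<in>I. c j * ip (X i) (X j))" by (intro sum.cong refl arg_cong2[where f = "(*)"] ip_commute)
    finally show ?thesis .
  qed
  then show ?thesis using assms by (simp add: ip_sum sum_mem sum_distrib_left mult.assoc cong: sum.cong)
qed

lemma ip_nonneg: "ip X X \<ge> 0" unfolding ip_def by (rule integral_nonneg_AE) auto

lemma ip_Cauchy_Schwarz:
  assumes "X \<in> G" "Y \<in> G" shows "(ip X Y)\<^sup>2 \<le> ip X X * ip Y Y"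
proof -
  have sq: "ip (\<lambda>\<omega>. a * X \<omega> - b * Y \<omega>) (\<lambda>\<omega>. a * X \<omega> - b * Y \<omega>) = a * a * ip X X - 2 * (a * b * ip X Y) + b * b * ip Y Y" for a b
  proof -
    have 1: "ip (\<lambda>\<omega>. a * X \<omega> - b * Y \<omega>) Z = a * ip X Z - b * ip Y Z" if "Z \<in> G" for Z
      using that assms by (simp add: ip_diff scale_mem ip_scale)
    show ?thesis using assms by (simp add: 1 diff_mem scale_mem ip_commute[of X "\<lambda>\<omega>. a * X \<omega> - b * Y \<omega>"]
      ip_commute[of Y "\<lambda>\<omega>. a * X \<omega> - b * Y \<omega>"] ip_commute[of Y X] algebra_simps)
  qed
  show ?thesis
  proof (cases "ip Y Y = 0")
    case False
    then have "ip Y Y > 0" using ip_nonneg[of Y] by simp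
    moreover have "0 \<le> ip Y Y * (ip X X * ip Y Y - (ip X Y)\<^sup>2)"
      using ip_nonneg[of "\<lambda>\<omega>. ip Y Y * X \<omega> - ip X Y * Y \<omega>"] unfolding sq
      by (simp add: power2_eq_square algebra_simps)
    ultimately show ?thesis by (simp add: zero_le_mult_iff)
  next
    case True
    have "0 \<le> ip X X - 2 * (b * ip X Y)" for b
      using ip_nonneg[of "\<lambda>\<omega>. 1 * X \<omega> - b * Y \<omega>"] unfolding sq using True by simp
    \<comment> \<open>With this \<open>b\<close> the right-hand side would equal -1 unless
      \<open>ip X Y = 0\<close>.\<close>
    from this[of "(ip X X + 1) / (2 * ip X Y)"] have "ip X Y = 0"
      by (cases "ip X Y = 0") (auto simp: field_simps)
    then show ?thesis using True by simp
  qed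
qed

lemma ip_zero_AE:
  assumes "X \<in> G" "ip X X = 0" shows "AE \<omega> in P. X \<omega> = 0"
proof -
  have "AE \<omega> in P. X \<omega> * X \<omega> = 0"
    using assms(2) sq_integrable[OF assms(1)] unfolding ip_def
    by (subst (asm) integral_nonneg_eq_0_iff_AE) auto
  then show ?thesis by eventually_elim simp
qed

lemma AE_zero_ip: "X \<in> G \<Longrightarrow> AE \<omega> in P. X \<omega> = 0 \<Longrightarrow> ip X X = 0"
  unfolding ip_def using meas_mem[of X]
  by (subst integral_cong_AE[where g = "\<lambda>_. 0"]) auto

section \<open>Characteristic functions and tails of normal variables\<close>

lemma standardize:
  assumes X: "X \<in> G" and pos: "ip X X > 0"
  shows "distr P borel (\<lambda>\<omega>. X \<omega> / sqrt (ip X X)) = std_normal_distribution"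
  using X
proof (cases rule: normal_cases)
  case (1 \<sigma>)
  then have "sqrt (ip X X) = \<sigma>" by (simp add: ip_normal)
  moreover have "distributed P lborel (\<lambda>\<omega>. (X \<omega> - 0) / \<sigma>) std_normal_density"
    using 1 by (subst normal_standard_normal_convert[symmetric]) auto
  then have "distr P lborel (\<lambda>\<omega>. X \<omega> / \<sigma>) = density lborel std_normal_density"
    by (simp add: distributed_def)
  moreover have "distr P lborel (\<lambda>\<omega>. X \<omega> / \<sigma>) = distr P borel (\<lambda>\<omega>. X \<omega> / \<sigma>)"
    by (rule distr_cong) auto
  ultimately show ?thesis by simp
next
  case 2
  then show ?thesis using AE_zero_ip[OF X] pos by simp
qed

lemma char_mem:
  assumes X: "X \<in> G" shows "(CLINT \<omega>|P. iexp (t * X \<omega>)) = of_real (exp (- (t\<^sup>2 * ip X X) / 2))"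
proof (cases "ip X X = 0")
  case True
  then have "AE \<omega> in P. X \<omega> = 0" using ip_zero_AE X by blast
  then have "(CLINT \<omega>|P. iexp (t * X \<omega>)) = (CLINT \<omega>|P. 1)"
    using meas_mem[OF X] by (intro integral_cong_AE) auto
  then show ?thesis using True by (simp add: prob_space)
next
  case False
  then have pos: "ip X X > 0" using ip_nonneg[of X] by simp
  define s where "s = sqrt (ip X X)"
  have s: "s > 0" "s * s = ip X X" using pos by (auto simp: s_def)
  have "char std_normal_distribution (t * s) = char (distr P borel (\<lambda>\<omega>. X \<omega> / s)) (t * s)"
    using standardize[OF X pos] by (simp add: s_def)
  also have "\<dots> = (CLINT \<omega>|P. iexp (t * s * (X \<omega> / s)))"
    unfolding char_def using meas_mem[OF X] by (subst integral_distr) auto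
  also have "\<dots> = (CLINT \<omega>|P. iexp (t * X \<omega>))" using s by simp
  finally show ?thesis unfolding char_std_normal_distribution s(2)[symmetric]
    by (simp add: power2_eq_square mult_ac)
qed

lemma prob_standard:
  assumes X: "X \<in> G" and pos: "ip X X > 0" and A: "A \<in> sets borel"
  shows "prob {\<omega>\<in>space P. X \<omega> / sqrt (ip X X) \<in> A} = measure std_normal_distribution A"
proof -
  have [measurable]: "(\<lambda>\<omega>. X \<omega> / sqrt (ip X X)) \<in> borel_measurable P" using meas_mem[OF X] by simp
  have "prob ((\<lambda>\<omega>. X \<omega> / sqrt (ip X X)) -` A \<inter> space P) = measure (distr P borel (\<lambda>\<omega>. X \<omega> / sqrt (ip X X))) A"
    using A by (simp add: measure_distr)
  also have "\<dots> = measure std_normal_distribution A" using standardize[OF X pos] by simp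
  finally show ?thesis by (simp add: vimage_def Int_def conj_commute)
qed

text \<open>Comparing the densities of \<open>N(0,1)\<close> and \<open>N(0,2)\<close> on the tail avoids computing any integral.\<close>

lemma std_normal_tail:
  assumes "u \<ge> 0"
  shows "measure std_normal_distribution {x. \<bar>x\<bar> > u} \<le> 2 * exp (- u\<^sup>2 / 4)"
proof -
  have S: "{x::real. \<bar>x\<bar> > u} \<in> sets borel" by measurable
  have pt: "std_normal_density x \<le> 2 * exp (- u\<^sup>2 / 4) * normal_density 0 (sqrt 2) x" if "\<bar>x\<bar> > u" for x
  proof -
    have "u\<^sup>2 \<le> x\<^sup>2" using that assms by (metis abs_ge_zero abs_le_square_iff abs_of_nonneg less_imp_le)
    then have "exp (- x\<^sup>2 / 2) \<le> exp (- u\<^sup>2 / 4 + - x\<^sup>2 / 4)" by simp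
    also have "\<dots> = exp (- u\<^sup>2 / 4) * exp (- x\<^sup>2 / 4)" by (rule exp_add)
    finally have e: "exp (- x\<^sup>2 / 2) \<le> exp (- u\<^sup>2 / 4) * exp (- x\<^sup>2 / 4)" .
    have s: "sqrt (4 * pi) = sqrt 2 * sqrt (2 * pi)" by (simp add: real_sqrt_mult[symmetric])
    have "sqrt 2 \<le> 2" using real_sqrt_le_mono[of 2 4] by simp
    have "std_normal_density x = 1 / sqrt (2 * pi) * exp (- x\<^sup>2 / 2)" by (simp add: std_normal_density_def)
    also have "\<dots> \<le> 1 / sqrt (2 * pi) * (exp (- u\<^sup>2 / 4) * exp (- x\<^sup>2 / 4))"
      using e by (intro mult_left_mono) auto
    also have "\<dots> = sqrt 2 * (exp (- u\<^sup>2 / 4) * (1 / sqrt (4 * pi) * exp (- x\<^sup>2 / 4)))"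
      unfolding s by simp
    also have "\<dots> \<le> 2 * (exp (- u\<^sup>2 / 4) * (1 / sqrt (4 * pi) * exp (- x\<^sup>2 / 4)))"
      using \<open>sqrt 2 \<le> 2\<close> by (intro mult_right_mono) auto
    finally show ?thesis by (simp add: normal_density_def mult_ac)
  qed
  have "emeasure std_normal_distribution {x. \<bar>x\<bar> > u} = (\<integral>\<^sup>+x. ennreal (std_normal_density x) * indicator {x. \<bar>x\<bar> > u} x \<partial>lborel)"
    using S by (subst emeasure_density) auto
  also have "\<dots> \<le> (\<integral>\<^sup>+x. ennreal (2 * exp (- u\<^sup>2 / 4)) * ennreal (normal_density 0 (sqrt 2) x) \<partial>lborel)"
    using pt by (intro nn_integral_mono) (auto simp: indicator_def ennreal_mult[symmetric] intro!: ennreal_leI)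
  also have "\<dots> = ennreal (2 * exp (- u\<^sup>2 / 4)) * (\<integral>\<^sup>+x. ennreal (normal_density 0 (sqrt 2) x) \<partial>lborel)"
    by (rule nn_integral_cmult) simp
  also have "(\<integral>\<^sup>+x. ennreal (normal_density 0 (sqrt 2) x) \<partial>lborel) = 1"
    using integral_normal_density[of "sqrt 2" 0] integrable_normal_density[of "sqrt 2" 0]
    by (subst nn_integral_eq_integral) auto
  finally show ?thesis
    using prob_space_normal_density[of 1 0] by (simp add: measure_def enn2real_leI)
qed

text \<open>Only the interval \<open>(t, t + 1]\<close> is kept, with
  \<open>(t + 1)^2 \<le> 2 * t^2 + 2\<close> and \<open>sqrt (2 * pi) \<le> 3\<close>. The exponent
  \<open>t^2\<close> in place of \<open>t^2 / 2\<close> is harmless because \<open>t\<close> will be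
  a small multiple of \<open>sqrt (ln N)\<close>.\<close>

lemma std_normal_tail_lower:
  assumes "t \<ge> 0"
  shows "measure std_normal_distribution {t<..} \<ge> exp (- t\<^sup>2 - 1) / 3"
proof -
  have pt: "exp (- t\<^sup>2 - 1) / 3 \<le> std_normal_density x" if "t < x" "x \<le> t + 1" for x
  proof -
    have "x\<^sup>2 \<le> (t + 1)\<^sup>2" using that assms by (intro power_mono) auto
    also have "\<dots> \<le> 2 * t\<^sup>2 + 2"
      using sum_squares_bound[of t 1] by (simp add: power2_eq_square algebra_simps)
    finally have "exp (- t\<^sup>2 - 1) \<le> exp (- x\<^sup>2 / 2)" by simp
    moreover have "sqrt (2 * pi) \<le> sqrt 9" using pi_less_4 by (intro real_sqrt_le_mono) linarith
    then have "sqrt (2 * pi) \<le> 3" by simp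
    ultimately have "exp (- t\<^sup>2 - 1) * sqrt (2 * pi) \<le> exp (- x\<^sup>2 / 2) * 3" by (intro mult_mono) auto
    then show ?thesis by (simp add: std_normal_density_def field_simps)
  qed
  interpret N: prob_space std_normal_distribution by (rule prob_space_normal_density) simp
  have "ennreal (exp (- t\<^sup>2 - 1) / 3) = (\<integral>\<^sup>+x. ennreal (exp (- t\<^sup>2 - 1) / 3) * indicator {t<..t+1} x \<partial>lborel)"
    by (simp add: nn_integral_cmult_indicator)
  also have "\<dots> \<le> (\<integral>\<^sup>+x. ennreal (std_normal_density x) * indicator {t<..} x \<partial>lborel)"
    using pt by (intro nn_integral_mono) (auto simp: indicator_def intro!: ennreal_leI)
  also have "\<dots> = emeasure std_normal_distribution {t<..}"
    by (subst emeasure_density) auto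
  finally have "ennreal (exp (- t\<^sup>2 - 1) / 3) \<le> emeasure std_normal_distribution {t<..}" .
  then show ?thesis by (simp add: N.emeasure_eq_measure)
qed

lemma tail_bound:
  assumes X: "X \<in> G" and s: "ip X X \<le> s\<^sup>2" "s > 0" and u: "u \<ge> 0"
  shows "prob {\<omega>\<in>space P. \<bar>X \<omega>\<bar> > u} \<le> 2 * exp (- u\<^sup>2 / (4 * s\<^sup>2))"
proof (cases "ip X X = 0")
  case True
  then have "AE \<omega> in P. \<not> \<bar>X \<omega>\<bar> > u" using ip_zero_AE[OF X] u by auto
  then have "prob {\<omega>\<in>space P. \<bar>X \<omega>\<bar> > u} = 0" using meas_mem[OF X] by (subst prob_eq_0) auto
  then show ?thesis by simp
next
  case False
  then have pos: "ip X X > 0" using ip_nonneg[of X] by simp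
  define r where "r = sqrt (ip X X)"
  have r: "r > 0" "r\<^sup>2 = ip X X" using pos by (auto simp: r_def)
  have "{\<omega>\<in>space P. \<bar>X \<omega>\<bar> > u} = {\<omega>\<in>space P. X \<omega> / sqrt (ip X X) \<in> {x. \<bar>x\<bar> > u / r}}"
    using r unfolding r_def[symmetric] by (auto simp: abs_divide divide_less_cancel)
  moreover have "{x::real. \<bar>x\<bar> > u / r} \<in> sets borel" by measurable
  note prob_standard[OF X pos this]
  ultimately have "prob {\<omega>\<in>space P. \<bar>X \<omega>\<bar> > u} = measure std_normal_distribution {x. \<bar>x\<bar> > u / r}"
    by simp
  also have "\<dots> \<le> 2 * exp (- (u / r)\<^sup>2 / 4)" using u r by (intro std_normal_tail) auto
  also have "\<dots> \<le> 2 * exp (- u\<^sup>2 / (4 * s\<^sup>2))"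
  proof -
    have "u\<^sup>2 / s\<^sup>2 \<le> u\<^sup>2 / r\<^sup>2" using r s pos by (intro divide_left_mono) auto
    then show ?thesis by (simp add: power_divide)
  qed
  finally show ?thesis .
qed

lemma tail_lower:
  assumes X: "X \<in> G" and s: "ip X X \<ge> s\<^sup>2" "s > 0" and t: "t \<ge> 0"
  shows "prob {\<omega>\<in>space P. X \<omega> > s * t} \<ge> exp (- t\<^sup>2 - 1) / 3"
proof -
  have "0 < s\<^sup>2" using s by simp
  then have pos: "ip X X > 0" using s by linarith
  define r where "r = sqrt (ip X X)"
  have r: "r > 0" "s \<le> r" using pos s by (auto simp: r_def real_le_rsqrt)
  have "exp (- t\<^sup>2 - 1) / 3 \<le> measure std_normal_distribution {t<..}" using t by (rule std_normal_tail_lower)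
  also have "\<dots> = prob {\<omega>\<in>space P. X \<omega> / sqrt (ip X X) \<in> {t<..}}"
    by (rule prob_standard[symmetric, OF X pos]) auto
  also have "\<dots> \<le> prob {\<omega>\<in>space P. X \<omega> > s * t}"
  proof (rule finite_measure_mono)
    show "{\<omega>\<in>space P. X \<omega> / sqrt (ip X X) \<in> {t<..}} \<subseteq> {\<omega>\<in>space P. X \<omega> > s * t}"
    proof clarsimp
      fix \<omega> assume "t < X \<omega> / sqrt (ip X X)"
      then have "r * t < X \<omega>" using r unfolding r_def[symmetric] by (simp add: field_simps)
      moreover have "s * t \<le> r * t" using r t by (intro mult_right_mono)
      ultimately show "s * t < X \<omega>" by simp
    qed
    show "{\<omega>\<in>space P. X \<omega> > s * t} \<in> events" using meas_mem[OF X] by measurable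
  qed
  finally show ?thesis .
qed

section \<open>Independence and Gram-Schmidt orthogonalization\<close>

lemma indep_vars_uncorrelated:
  assumes X: "\<And>i. X i \<in> G" and unc: "\<And>i j. i \<noteq> j \<Longrightarrow> ip (X i) (X j) = 0"
  shows "indep_vars (\<lambda>_. borel) X (UNIV :: nat set)"
  unfolding indep_vars_def2 indep_sets_def
proof (intro conjI ballI allI impI)
  show "X i \<in> borel_measurable P" for i using X meas_mem by blast
  then show "{X i -` A \<inter> space P |A. A \<in> sets borel} \<subseteq> events" for i by auto
  fix J :: "nat set" and E assume J: "J \<subseteq> UNIV" "J \<noteq> {}" "finite J" and E: "E \<in> Pi J (\<lambda>i. {X i -` A \<inter> space P |A. A \<in> sets borel})"
  then have "\<forall>j\<in>J. \<exists>A. E j = X j -` A \<inter> space P \<and> A \<in> sets borel" by auto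
  then obtain A where A: "\<And>j. j \<in> J \<Longrightarrow> E j = X j -` A j \<inter> space P \<and> A j \<in> sets borel" by metis
  have "prob {\<omega>\<in>space P. \<forall>j\<in>J. X j \<omega> \<in> A j} = (\<Prod>j\<in>J. prob {\<omega>\<in>space P. X j \<omega> \<in> A j})"
  proof (rule char_factor_imp_indep)
    fix t
    define Y where "Y \<omega> = (\<Sum>j\<in>J. t j * X j \<omega>)" for \<omega>
    have Y: "Y \<in> G" unfolding Y_def using X by (intro sum_mem)
    \<comment> \<open>Mixed terms vanish, so the variance of a combination is a sum and its
      characteristic function a product.\<close>
    have "ip Y Y = (\<Sum>i\<in>J. \<Sum>j\<in>J. t i * t j * ip (X i) (X j))" unfolding Y_def using X by (intro ip_sum_sum)
    also have "\<dots> = (\<Sum>i\<in>J. \<Sum>j\<in>J. if j = i then (t i)\<^sup>2 * ip (X i) (X i) else 0)"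
      using unc by (intro sum.cong refl) (auto simp: power2_eq_square)
    also have "\<dots> = (\<Sum>i\<in>J. (t i)\<^sup>2 * ip (X i) (X i))" using J by (intro sum.cong refl) simp
    finally have "exp (- ip Y Y / 2) = (\<Prod>i\<in>J. exp (- ((t i)\<^sup>2 * ip (X i) (X i)) / 2))"
      using J by (simp add: exp_sum[symmetric] sum_negf sum_divide_distrib[symmetric])
    then have "of_real (exp (- ip Y Y / 2)) = (\<Prod>i\<in>J. complex_of_real (exp (- ((t i)\<^sup>2 * ip (X i) (X i)) / 2)))"
      by (simp only: of_real_prod[symmetric])
    then show "(CLINT \<omega>|P. iexp (\<Sum>j\<in>J. t j * X j \<omega>)) = (\<Prod>j\<in>J. CLINT \<omega>|P. iexp (t j * X j \<omega>))"
      using char_mem[OF Y, of 1] char_mem[OF X] by (simp only: Y_def[symmetric] mult_1 one_power2)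
  qed (use J A prob_space_axioms X meas_mem in auto)
  moreover have "{\<omega>\<in>space P. \<forall>j\<in>J. X j \<omega> \<in> A j} = (\<Inter>j\<in>J. E j)" using A J by auto
  moreover have "{\<omega>\<in>space P. X j \<omega> \<in> A j} = E j" if "j \<in> J" for j using A that by auto
  ultimately show "prob (\<Inter>j\<in>J. E j) = (\<Prod>j\<in>J. prob (E j))" by simp
qed

text \<open>When \<open>gs i\<close> degenerates to zero its coefficient is \<open>0\<close>, because \<open>x / 0 = 0\<close>.\<close>

fun gs :: "(nat \<Rightarrow> 'w \<Rightarrow> real) \<Rightarrow> nat \<Rightarrow> 'w \<Rightarrow> real" where
  "gs X n = (\<lambda>\<omega>. X n \<omega> - (\<Sum>i<n. (ip (X n) (gs X i) / ip (gs X i) (gs X i)) * gs X i \<omega>))"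

declare gs.simps [simp del]

definition gs_coeff :: "(nat \<Rightarrow> 'w \<Rightarrow> real) \<Rightarrow> ('w \<Rightarrow> real) \<Rightarrow> nat \<Rightarrow> real" where
  "gs_coeff X Y i = ip Y (gs X i) / ip (gs X i) (gs X i)"

lemma gs_eq: "gs X n \<omega> = X n \<omega> - (\<Sum>i<n. gs_coeff X (X n) i * gs X i \<omega>)"
  by (subst gs.simps) (simp add: gs_coeff_def)

lemma gs_mem: assumes "\<And>n. X n \<in> G" shows "gs X n \<in> G"
proof (induction n rule: less_induct)
  case (less n)
  have "(\<lambda>\<omega>. X n \<omega> - (\<Sum>i<n. gs_coeff X (X n) i * gs X i \<omega>)) \<in> G"
    using less assms by (intro diff_mem sum_mem) auto
  then show ?case unfolding gs_eq[of X n, abs_def] .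
qed

lemma gs_orth_aux:
  assumes X: "\<And>n. X n \<in> G"
  shows "i < n \<Longrightarrow> ip (gs X n) (gs X i) = 0"
proof (induction n arbitrary: i rule: less_induct)
  case (less n)
  have orth: "ip (gs X j) (gs X k) = 0" if "j < n" "k < n" "j \<noteq> k" for j k
    using less.IH[of j k] less.IH[of k j] that by (cases "k < j") (auto simp: ip_commute)
  have g: "gs X k \<in> G" for k using X by (rule gs_mem)
  have "ip (gs X n) (gs X i) = ip (X n) (gs X i) - (\<Sum>j<n. gs_coeff X (X n) j * ip (gs X j) (gs X i))"
    unfolding gs_eq[of X n, abs_def] using X g by (simp add: ip_diff ip_sum sum_mem)
  also have "(\<Sum>j<n. gs_coeff X (X n) j * ip (gs X j) (gs X i)) = (\<Sum>j<n. if j = i then gs_coeff X (X n) i * ip (gs X i) (gs X i) else 0)"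
    using orth less.prems by (intro sum.cong refl) auto
  also have "\<dots> = gs_coeff X (X n) i * ip (gs X i) (gs X i)" using less.prems by simp
  also have "ip (X n) (gs X i) - \<dots> = 0"
  \<comment> \<open>If \<open>gs X i\<close> is degenerate, Cauchy-Schwarz makes the numerator
    vanish too, so the convention \<open>x / 0 = 0\<close> does no harm.\<close>
  proof (cases "ip (gs X i) (gs X i) = 0")
    case True
    then have "(ip (X n) (gs X i))\<^sup>2 \<le> 0" using ip_Cauchy_Schwarz[OF X g, of n i] by simp
    then show ?thesis using True by simp
  qed (simp add: gs_coeff_def)
  finally show ?case .
qed

lemma gs_orth:
  assumes "\<And>n. X n \<in> G" "i \<noteq> j" shows "ip (gs X i) (gs X j) = 0"
proof (cases "i < j")
  case True
  then show ?thesis using gs_orth_aux[OF assms(1), of i j] ip_commute[of "gs X i" "gs X j"] by simp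
next
  case False
  then have "j < i" using assms(2) by simp
  then show ?thesis by (rule gs_orth_aux[OF assms(1)])
qed

lemma gs_indep:
  assumes X: "\<And>n. X n \<in> G"
  shows "indep_vars (\<lambda>_. borel) (gs X) UNIV"
proof (rule indep_vars_uncorrelated)
  show "gs X i \<in> G" for i by (rule gs_mem[OF X])
  show "ip (gs X i) (gs X j) = 0" if "i \<noteq> j" for i j by (rule gs_orth[OF X that])
qed

text \<open>The coefficient at \<open>i = n\<close> is 1 unless the innovation is degenerate; then
  it is 0 and the innovation vanishes only almost surely.\<close>

lemma gs_expansion:
  assumes X: "\<And>n. X n \<in> G"
  shows "AE \<omega> in P. X n \<omega> = (\<Sum>i\<le>n. gs_coeff X (X n) i * gs X i \<omega>)"
proof -
  have g: "gs X k \<in> G" for k using X by (rule gs_mem)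
  have "ip (X n) (gs X n) = ip (gs X n) (gs X n)"
  proof -
    have "ip (gs X n) (gs X n) = ip (X n) (gs X n) - (\<Sum>j<n. gs_coeff X (X n) j * ip (gs X j) (gs X n))"

      using ip_diff[of "X n" "\<lambda>\<omega>. \<Sum>i<n. gs_coeff X (X n) i * gs X i \<omega>" "gs X n"] X g
      by (simp add: gs_eq[of X n, symmetric] ip_sum sum_mem)
    also have "(\<Sum>j<n. gs_coeff X (X n) j * ip (gs X j) (gs X n)) = 0" using gs_orth[OF X] by (intro sum.neutral) auto
    finally show ?thesis by simp
  qed
  then have "AE \<omega> in P. gs X n \<omega> = gs_coeff X (X n) n * gs X n \<omega>"
    using ip_zero_AE[OF g, of n] by (cases "ip (gs X n) (gs X n) = 0") (auto simp: gs_coeff_def)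
  then show ?thesis
  proof eventually_elim
    fix \<omega> assume e: "gs X n \<omega> = gs_coeff X (X n) n * gs X n \<omega>"
    have "(\<Sum>i\<le>n. gs_coeff X (X n) i * gs X i \<omega>) = (\<Sum>i<n. gs_coeff X (X n) i * gs X i \<omega>) + gs X n \<omega>"
      using e by (simp only: lessThan_Suc_atMost[symmetric] sum.lessThan_Suc)
    then show "X n \<omega> = (\<Sum>i\<le>n. gs_coeff X (X n) i * gs X i \<omega>)" using gs_eq[of X n \<omega>] by linarith
  qed
qed

text \<open>The leading coefficient 1 is the point: bounding a Gram matrix below by a multiple of
  the identity then bounds the variance of the innovation from below.\<close>

lemma gs_span:
  "\<exists>c. c n = 1 \<and> gs X n = (\<lambda>\<omega>. \<Sum>i\<le>n. c i * X i \<omega>)"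
proof (induction n rule: less_induct)
  case (less n)
  then have "\<forall>i. \<exists>c. i < n \<longrightarrow> gs X i = (\<lambda>\<omega>. \<Sum>j\<le>i. c j * X j \<omega>)" by blast
  then obtain d where d: "\<And>i. i < n \<Longrightarrow> gs X i = (\<lambda>\<omega>. \<Sum>j\<le>i. d i j * X j \<omega>)" by metis
  define e where "e i j = (if j \<le> i then d i j else 0)" for i j
  have e: "gs X i \<omega> = (\<Sum>j<n. e i j * X j \<omega>)" if "i < n" for i \<omega>
    unfolding d[OF that] using that by (intro sum.mono_neutral_cong_left) (auto simp: e_def)
  define c where "c j = (if j = n then 1 else - (\<Sum>i<n. gs_coeff X (X n) i * e i j))" for j
  have "gs X n \<omega> = (\<Sum>j\<le>n. c j * X j \<omega>)" for \<omega>
  proof -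
    have "(\<Sum>i<n. gs_coeff X (X n) i * gs X i \<omega>) = (\<Sum>i<n. \<Sum>j<n. gs_coeff X (X n) i * e i j * X j \<omega>)"
      by (simp add: e sum_distrib_left mult.assoc)
    also have "\<dots> = (\<Sum>j<n. (\<Sum>i<n. gs_coeff X (X n) i * e i j) * X j \<omega>)"
      by (subst sum.swap) (simp add: sum_distrib_right)
    also have "\<dots> = - (\<Sum>j<n. c j * X j \<omega>)" by (simp add: c_def sum_negf)
    finally show ?thesis unfolding gs_eq[of X n] by (simp add: lessThan_Suc_atMost[symmetric] c_def)
  qed
  then show ?case by (intro exI[of _ c]) (auto simp: c_def)
qed

text \<open>
  Whatever the sign of \<open>X n - gs X n\<close>, one of the two tails of the independent innovation
  \<open>gs X n\<close> pushes \<open>X n\<close> out of the interval.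
\<close>

lemma small_ball_sequence:
  assumes X: "\<And>n. X n \<in> G" and s: "s > 0" and t: "t \<ge> 0"
    and var: "\<And>n. n < N \<Longrightarrow> ip (gs X n) (gs X n) \<ge> s\<^sup>2"
  shows "prob {\<omega>\<in>space P. \<forall>i<N. \<bar>X i \<omega>\<bar> \<le> s * t} \<le> (1 - exp (- t\<^sup>2 - 1) / 3) ^ N"
proof -
  define q where "q = exp (- t\<^sup>2 - 1) / 3"
  have e1: "exp (- t\<^sup>2 - 1) \<le> 1" using zero_le_power2[of t] by (subst exp_le_one_iff) linarith
  have q: "0 < q" "q \<le> 1" unfolding q_def using e1 by (simp, linarith)
  have g: "gs X k \<in> G" for k using X by (rule gs_mem)
  have gm[measurable]: "gs X k \<in> borel_measurable P" for k using g meas_mem by blast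
  have Xm[measurable]: "X k \<in> borel_measurable P" for k using X meas_mem by blast
  define A where "A n = {\<omega>\<in>space P. \<forall>i<n. \<bar>X i \<omega>\<bar> \<le> s * t}" for n
  have A[measurable]: "A n \<in> events" for n unfolding A_def by measurable
  have step: "prob (A (Suc n)) \<le> prob (A n) * (1 - q)" if n: "n < N" for n
  proof -
    define h where "h \<omega> = (\<Sum>i<n. gs_coeff X (X n) i * gs X i \<omega>)" for \<omega>
    have h[measurable]: "h \<in> borel_measurable P" unfolding h_def by measurable
    have Xn: "X n \<omega> = gs X n \<omega> + h \<omega>" for \<omega> by (simp add: gs_eq[of X n] h_def)
    \<comment> \<open>The innovations before \<open>n\<close> are jointly independent of the
      \<open>n\<close>-th. \<open>T\<close> is pulled back through a one-coordinate product space
      because independence is obtained for restricted families.\<close>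
    have ind: "prob ({\<omega>\<in>space P. (\<lambda>i\<in>{..<n}. gs X i \<omega>) \<in> S} \<inter> {\<omega>\<in>space P. gs X n \<omega> \<in> T}) =
        prob {\<omega>\<in>space P. (\<lambda>i\<in>{..<n}. gs X i \<omega>) \<in> S} * prob {\<omega>\<in>space P. gs X n \<omega> \<in> T}"
      if S: "S \<in> sets (PiM {..<n} (\<lambda>_. borel))" and T: "T \<in> sets borel" for S T
    proof -
      have "indep_var (PiM {..<n} (\<lambda>_. borel)) (\<lambda>\<omega>. restrict (\<lambda>i. gs X i \<omega>) {..<n})
          (PiM {n} (\<lambda>_. borel)) (\<lambda>\<omega>. restrict (\<lambda>i. gs X i \<omega>) {n})"
        by (rule indep_var_restrict[OF gs_indep[OF X]]) auto
      moreover have T': "(\<lambda>f. f n) -` T \<inter> space (PiM {n} (\<lambda>_. borel)) \<in> sets (PiM {n} (\<lambda>_. borel :: real measure))"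
        using T by (intro measurable_sets[OF measurable_component_singleton]) auto
      ultimately have "prob ((\<lambda>\<omega>. (restrict (\<lambda>i. gs X i \<omega>) {..<n}, restrict (\<lambda>i. gs X i \<omega>) {n})) -`
          (S \<times> ((\<lambda>f. f n) -` T \<inter> space (PiM {n} (\<lambda>_. borel)))) \<inter> space P) =
        prob ((\<lambda>\<omega>. restrict (\<lambda>i. gs X i \<omega>) {..<n}) -` S \<inter> space P) *
        prob ((\<lambda>\<omega>. restrict (\<lambda>i. gs X i \<omega>) {n}) -` ((\<lambda>f. f n) -` T \<inter> space (PiM {n} (\<lambda>_. borel))) \<inter> space P)"
        using S by (intro indep_varD)
      moreover have "(\<lambda>\<omega>. (restrict (\<lambda>i. gs X i \<omega>) {..<n}, restrict (\<lambda>i. gs X i \<omega>) {n})) -`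
          (S \<times> ((\<lambda>f. f n) -` T \<inter> space (PiM {n} (\<lambda>_. borel)))) \<inter> space P =
          {\<omega>\<in>space P. (\<lambda>i\<in>{..<n}. gs X i \<omega>) \<in> S} \<inter> {\<omega>\<in>space P. gs X n \<omega> \<in> T}"
        by (auto simp: space_PiM)
      moreover have "(\<lambda>\<omega>. restrict (\<lambda>i. gs X i \<omega>) {n}) -` ((\<lambda>f. f n) -` T \<inter> space (PiM {n} (\<lambda>_. borel))) \<inter> space P = {\<omega>\<in>space P. gs X n \<omega> \<in> T}"
        by (auto simp: space_PiM)
      moreover have "(\<lambda>\<omega>. restrict (\<lambda>i. gs X i \<omega>) {..<n}) -` S \<inter> space P = {\<omega>\<in>space P. (\<lambda>i\<in>{..<n}. gs X i \<omega>) \<in> S}"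
        by auto
      ultimately show ?thesis by simp
    qed
    \<comment> \<open>\<open>XX\<close> and \<open>hh\<close> recover the observations and the
      predictor from the innovations, exactly and not just almost surely, so \<open>A n\<close>
      together with the sign of \<open>h\<close> is an event of the earlier innovations.\<close>
    define XX where "XX i f = f i + (\<Sum>j<i. gs_coeff X (X i) j * f j)" for i and f :: "nat \<Rightarrow> real"
    define hh where "hh f = (\<Sum>i<n. gs_coeff X (X n) i * f i)" for f :: "nat \<Rightarrow> real"
    have XXm: "XX i \<in> borel_measurable (PiM {..<n} (\<lambda>_. borel))" if "i < n" for i
      unfolding XX_def using that by (intro borel_measurable_add borel_measurable_sum borel_measurable_times measurable_component_singleton) auto
    have hhm: "hh \<in> borel_measurable (PiM {..<n} (\<lambda>_. borel))"
      unfolding hh_def by (intro borel_measurable_sum borel_measurable_times measurable_component_singleton) auto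
    have XXe: "XX i (\<lambda>i\<in>{..<n}. gs X i \<omega>) = X i \<omega>" if "i < n" for i \<omega>
      using that by (simp add: XX_def gs_eq[of X i])
    have hhe: "hh (\<lambda>i\<in>{..<n}. gs X i \<omega>) = h \<omega>" for \<omega> by (simp add: hh_def h_def)
    have half: "prob (A n \<inter> {\<omega>\<in>space P. h \<omega> \<in> R} \<inter> {\<omega>\<in>space P. gs X n \<omega> \<in> T}) = prob (A n \<inter> {\<omega>\<in>space P. h \<omega> \<in> R}) * prob {\<omega>\<in>space P. gs X n \<omega> \<in> T}"
      if R: "R \<in> sets borel" and T: "T \<in> sets borel" for R T
    proof -
      define S where "S = {f \<in> space (PiM {..<n} (\<lambda>_. borel)). (\<forall>i\<in>{..<n}. XX i f \<in> {- (s * t)..s * t}) \<and> hh f \<in> R}"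
      have "S \<in> sets (PiM {..<n} (\<lambda>_. borel))"
        unfolding S_def using XXm hhm R
        by (intro sets.sets_Collect_conj sets.sets_Collect_finite_All) (auto intro!: measurable_sets_Collect simp: pred_def)
      moreover have "A n \<inter> {\<omega>\<in>space P. h \<omega> \<in> R} = {\<omega>\<in>space P. (\<lambda>i\<in>{..<n}. gs X i \<omega>) \<in> S}"
        by (auto simp: A_def S_def XXe hhe space_PiM abs_le_iff minus_le_iff PiE_def)
      ultimately show ?thesis using ind T by simp
    qed
    define A1 where "A1 = A n \<inter> {\<omega>\<in>space P. h \<omega> \<in> {0..}}"
    define A2 where "A2 = A n \<inter> {\<omega>\<in>space P. h \<omega> \<in> {..<0}}"
    have Am[measurable]: "A1 \<in> events" "A2 \<in> events" unfolding A1_def A2_def by measurable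
    define B1 where "B1 = A1 \<inter> {\<omega>\<in>space P. gs X n \<omega> \<in> {s * t<..}}"
    define B2 where "B2 = A2 \<inter> {\<omega>\<in>space P. gs X n \<omega> \<in> {..<- (s * t)}}"
    have Bm[measurable]: "B1 \<in> events" "B2 \<in> events" unfolding B1_def B2_def by measurable
    have "q \<le> prob {\<omega>\<in>space P. gs X n \<omega> \<in> {s * t<..}}"
      using tail_lower[OF g var[OF n] s t] by (simp add: q_def)
    then have "prob A1 * q \<le> prob A1 * prob {\<omega>\<in>space P. gs X n \<omega> \<in> {s * t<..}}" by (intro mult_left_mono) auto
    also have "\<dots> = prob B1" unfolding A1_def B1_def by (rule half[symmetric]) auto
    finally have b1: "prob A1 * q \<le> prob B1" .
    have "ip (\<lambda>\<omega>. - gs X n \<omega>) (\<lambda>\<omega>. - gs X n \<omega>) = ip (gs X n) (gs X n)" by (simp add: ip_def)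
    then have "q \<le> prob {\<omega>\<in>space P. - gs X n \<omega> > s * t}"
      using tail_lower[OF minus_mem[OF g[of n]] _ s t] var[OF n] by (simp add: q_def)
    moreover have "{\<omega>\<in>space P. - gs X n \<omega> > s * t} = {\<omega>\<in>space P. gs X n \<omega> \<in> {..<- (s * t)}}" by auto
    ultimately have "prob A2 * q \<le> prob A2 * prob {\<omega>\<in>space P. gs X n \<omega> \<in> {..<- (s * t)}}" by (intro mult_left_mono) auto
    also have "\<dots> = prob B2" unfolding A2_def B2_def by (rule half[symmetric]) auto
    finally have b2: "prob A2 * q \<le> prob B2" .
    have AA: "A n = A1 \<union> A2" by (auto simp: A1_def A2_def A_def)
    have pA: "prob (A n) = prob A1 + prob A2"
      unfolding AA by (rule finite_measure_Union) (auto simp: A1_def A2_def)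
    have "A (Suc n) \<inter> (B1 \<union> B2) = {}"
      using s t by (auto simp: A_def B1_def B2_def A1_def A2_def Xn less_Suc_eq abs_le_iff)
    then have "A (Suc n) \<subseteq> A n - (B1 \<union> B2)" by (auto simp: A_def)
    then have "prob (A (Suc n)) \<le> prob (A n - (B1 \<union> B2))" by (intro finite_measure_mono) auto
    also have "\<dots> = prob (A n) - prob (B1 \<union> B2)"
      by (intro finite_measure_Diff) (auto simp: B1_def B2_def A1_def A2_def)
    also have "prob (B1 \<union> B2) = prob B1 + prob B2"
      by (rule finite_measure_Union) (auto simp: B1_def B2_def A1_def A2_def)
    finally show ?thesis using b1 b2 pA by (simp add: algebra_simps)
  qed
  have "prob (A n) \<le> (1 - q) ^ n" if "n \<le> N" for n
    using that
  proof (induction n)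
    case (Suc n)
    then have "prob (A (Suc n)) \<le> prob (A n) * (1 - q)" by (intro step) auto
    also have "\<dots> \<le> (1 - q) ^ n * (1 - q)" using Suc q by (intro mult_right_mono) auto
    finally show ?case by (simp add: mult.commute)
  qed simp
  from this[of N] show ?thesis by (simp add: A_def q_def)
qed

end

section \<open>Upper bound by chaining\<close>

lemma continuous_map_mdist:
  assumes "continuous_map (mtopology_of M) euclideanreal z" "x \<in> mspace M" "e > 0"
  obtains \<delta> where "\<delta> > 0" "\<And>y. y \<in> mspace M \<Longrightarrow> mdist M x y < \<delta> \<Longrightarrow> \<bar>z x - z y\<bar> < e"
proof -
  interpret Metric_space "mspace M" "mdist M" by (rule Metric_space_mspace_mdist)
  have "continuous_map mtopology (mtopology_of (euclidean_metric :: real metric)) z"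
    using assms(1) unfolding mtopology_of_euclidean by (simp only: mtopology_of_def)
  then have "continuous_map mtopology Met_TC.mtopology z" by (simp only: mtopology_of_def mspace_euclidean_metric mdist_euclidean_metric)
  then have "\<exists>\<delta>>0. \<forall>y. y \<in> mspace M \<and> mdist M x y < \<delta> \<longrightarrow> dist (z x) (z y) < e"
    using assms(2,3) metric_continuous_map[OF Met_TC.Metric_space_axioms, of z] by blast
  then show ?thesis using that by (auto simp: dist_real_def)
qed

lemma power_half_bracket:
  fixes r :: real
  assumes "0 < r" "r \<le> (1 / 2) ^ k0"
  obtains k where "k \<ge> k0" "(1 / 2) ^ Suc k < r" "r \<le> (1 / 2) ^ k"
proof -
  have ex: "\<exists>n. (1 / 2) ^ Suc n < r"
  proof -
    obtain n where "(1 / 2) ^ n < r" using real_arch_pow_inv[of r "1/2"] assms by auto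
    then have "(1 / 2) ^ Suc n < r" using assms by simp
    then show ?thesis by blast
  qed
  define k where "k = (LEAST n. (1 / 2) ^ Suc n < r)"
  have 1: "(1 / 2) ^ Suc k < r" unfolding k_def by (rule LeastI_ex[OF ex])
  have 2: "k \<ge> k0"
  proof (rule ccontr)
    assume "\<not> k \<ge> k0"
    then have "(1 / 2 :: real) ^ k0 \<le> (1 / 2) ^ Suc k" by (intro power_decreasing) auto
    then show False using 1 assms by linarith
  qed
  have 3: "r \<le> (1 / 2) ^ k"
  proof (cases "k = k0")
    case True then show ?thesis using assms by simp
  next
    case False
    then obtain j where j: "k = Suc j" using 2 by (cases k) auto
    have "\<not> (1 / 2) ^ Suc j < r" using not_less_Least[of j "\<lambda>n. (1 / 2) ^ Suc n < r"] j by (simp add: k_def)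
    then show ?thesis unfolding j by simp
  qed
  show ?thesis using that[OF 2 1 3] .
qed

text \<open>Deterministic chaining for one path: follow net points \<open>t n\<close> approaching
  \<open>w\<close>, telescope the increments over the levels from \<open>k\<close> on, and close the
  gap by continuity. The two endpoints are joined at level \<open>k\<close>.\<close>

lemma chaining_modulus:
  fixes M :: "'p metric" and z :: "'p \<Rightarrow> real" and T :: "nat \<Rightarrow> 'p set"
  assumes cont: "continuous_map (mtopology_of M) euclideanreal z"
    and T: "\<And>k. T k \<subseteq> mspace M" "\<And>k x. x \<in> mspace M \<Longrightarrow> \<exists>y\<in>T k. mdist M x y \<le> (1 / 2) ^ k"
    and q: "0 < q" "q < 1" and H: "H \<ge> 0" and k0: "k0 \<ge> 1"
    and step: "\<And>k u v. k \<ge> k0 \<Longrightarrow> u \<in> T k \<Longrightarrow> v \<in> T k \<union> T (Suc k) \<Longrightarrow> mdist M u v \<le> 3 * (1 / 2) ^ k \<Longrightarrow>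
      \<bar>z u - z v\<bar> \<le> H * q ^ k * sqrt (real k)"
    and xy: "x \<in> mspace M" "y \<in> mspace M" "mdist M x y \<le> (1 / 2) ^ k" "k \<ge> k0"
  shows "\<bar>z x - z y\<bar> \<le> (2 / (1 - q)\<^sup>2 + 1) * (H * q ^ k * sqrt (real k))"
proof -
  define h where "h k = H * q ^ k * sqrt (real k)" for k
  \<comment> \<open>Since \<open>k \<ge> 1\<close>,
    \<open>sqrt (k + i) \<le> sqrt k * (i + 1)\<close>, and the series of
    \<open>(i + 1) * q ^ i\<close> sums to \<open>1 / (1 - q)^2\<close>.\<close>
  have hsum: "(\<Sum>i<n. h (k + i)) \<le> h k * (1 / (1 - q)\<^sup>2)" for n
  proof -
    have "h (k + i) \<le> h k * (real (Suc i) * q ^ i)" for i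
    proof -
      have "real (k + i) \<le> real k * (real (Suc i))\<^sup>2"
      proof -
        have "k + i \<le> k * (Suc i * Suc i)" using xy(4) k0 by (auto simp: algebra_simps trans_le_add1)
        then have "real (k + i) \<le> real (k * (Suc i * Suc i))" by (simp only: of_nat_le_iff)
        then show ?thesis by (simp only: of_nat_mult power2_eq_square)
      qed
      then have "sqrt (real (k + i)) \<le> sqrt (real k * (real (Suc i))\<^sup>2)" by (rule real_sqrt_le_mono)
      then have "sqrt (real (k + i)) \<le> sqrt (real k) * real (Suc i)" by (simp add: real_sqrt_mult)
      then have "H * q ^ (k + i) * sqrt (real (k + i)) \<le> H * q ^ (k + i) * (sqrt (real k) * real (Suc i))"
        using H q by (intro mult_left_mono) auto
      then show ?thesis by (simp add: h_def power_add mult_ac)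
    qed
    then have "(\<Sum>i<n. h (k + i)) \<le> (\<Sum>i<n. h k * (real (Suc i) * q ^ i))" by (intro sum_mono)
    also have "\<dots> = h k * (\<Sum>i<n. real (Suc i) * q ^ i)" by (simp add: sum_distrib_left)
    also have "(\<Sum>i<n. real (Suc i) * q ^ i) \<le> 1 / (1 - q)\<^sup>2"
    proof -
      have s: "(\<lambda>i. real (Suc i) * q ^ i) sums (1 / (1 - q)\<^sup>2)" using geometric_deriv_sums[of q] q by simp
      show ?thesis using sum_le_suminf[OF sums_summable[OF s], of "{..<n}"] sums_unique[OF s] q by simp
    qed
    then have "h k * (\<Sum>i<n. real (Suc i) * q ^ i) \<le> h k * (1 / (1 - q)\<^sup>2)"
      using H q by (intro mult_left_mono) (auto simp: h_def)
    finally show ?thesis .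
  qed
  have near: "\<exists>u\<in>T k. mdist M w u \<le> (1 / 2) ^ k \<and> \<bar>z w - z u\<bar> \<le> h k * (1 / (1 - q)\<^sup>2)" if w: "w \<in> mspace M" for w
  proof -
    define t where "t n = (SOME y. y \<in> T n \<and> mdist M w y \<le> (1 / 2) ^ n)" for n
    have t: "t n \<in> T n" "mdist M w (t n) \<le> (1 / 2) ^ n" for n
      using someI_ex[of "\<lambda>y. y \<in> T n \<and> mdist M w y \<le> (1 / 2) ^ n"] T(2)[OF w, of n] by (auto simp: t_def)
    have tM: "t n \<in> mspace M" for n using t T by auto
    have st: "\<bar>z (t n) - z (t (Suc n))\<bar> \<le> h n" if "n \<ge> k0" for n
      unfolding h_def
    proof (rule step[OF that])
      have "mdist M (t n) (t (Suc n)) \<le> mdist M (t n) w + mdist M w (t (Suc n))" by (rule mdist_triangle) (use tM w in auto)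
      also have "\<dots> \<le> (1 / 2) ^ n + (1 / 2) ^ Suc n" using t[of n] t(2)[of "Suc n"] by (intro add_mono) (auto simp: mdist_commute)
      also have "\<dots> \<le> 3 * (1 / 2) ^ n" by simp
      finally show "mdist M (t n) (t (Suc n)) \<le> 3 * (1 / 2) ^ n" .
    qed (use t in auto)
    have path: "\<bar>z (t k) - z (t (k + n))\<bar> \<le> (\<Sum>i<n. h (k + i))" for n
    proof (induction n)
      case (Suc n)
      then show ?case using st[of "k + n"] xy(4) by simp
    qed simp
    have "\<bar>z w - z (t k)\<bar> \<le> h k * (1 / (1 - q)\<^sup>2)"
    proof (rule field_le_epsilon)
      fix e :: real assume "e > 0"
      then obtain \<delta> where d: "\<delta> > 0" "\<And>y. y \<in> mspace M \<Longrightarrow> mdist M w y < \<delta> \<Longrightarrow> \<bar>z w - z y\<bar> < e"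
        using continuous_map_mdist[OF cont w] by blast
      obtain n where n: "(1 / 2) ^ n < \<delta>" using real_arch_pow_inv[of \<delta> "1/2"] d by auto
      have "(1 / 2 :: real) ^ (k + n) \<le> (1 / 2) ^ n" by (intro power_decreasing) auto
      then have "mdist M w (t (k + n)) < \<delta>" using t(2)[of "k + n"] n by linarith
      then have "\<bar>z w - z (t (k + n))\<bar> < e" using d(2) tM by blast
      then show "\<bar>z w - z (t k)\<bar> \<le> h k * (1 / (1 - q)\<^sup>2) + e" using path[of n] hsum[of n] by linarith
    qed
    then show ?thesis using t by blast
  qed
  obtain u where u: "u \<in> T k" "mdist M x u \<le> (1 / 2) ^ k" "\<bar>z x - z u\<bar> \<le> h k * (1 / (1 - q)\<^sup>2)" using near[OF xy(1)] by blast
  obtain v where v: "v \<in> T k" "mdist M y v \<le> (1 / 2) ^ k" "\<bar>z y - z v\<bar> \<le> h k * (1 / (1 - q)\<^sup>2)" using near[OF xy(2)] by blast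
  have uM: "u \<in> mspace M" "v \<in> mspace M" using u v T by auto
  \<comment> \<open>The longest link: three segments of length at most \<open>2 ^ (- k)\<close>
    each, hence the radius \<open>3 * (1 / 2) ^ k\<close> in the step hypothesis.\<close>
  have "mdist M u v \<le> mdist M u x + mdist M x v" by (rule mdist_triangle) (use uM xy in auto)
  moreover have "mdist M x v \<le> mdist M x y + mdist M y v" by (rule mdist_triangle) (use uM xy in auto)
  ultimately have "mdist M u v \<le> 3 * (1 / 2) ^ k" using u(2) v(2) xy(3) mdist_commute[of M u x] by linarith
  then have "\<bar>z u - z v\<bar> \<le> h k" unfolding h_def using u v xy by (intro step) auto
  then have "\<bar>z x - z y\<bar> \<le> 2 * (h k * (1 / (1 - q)\<^sup>2)) + h k" using u v by linarith
  then show ?thesis by (simp add: h_def algebra_simps)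
qed

section \<open>The linear span of the centred field\<close>

lemma gaussian_rv_add_const:
  assumes "prob_space P" "gaussian_rv P X"
  shows "gaussian_rv P (\<lambda>\<omega>. X \<omega> + k)"
proof -
  interpret prob_space P by fact
  have X: "X \<in> borel_measurable P" using assms(2) by (simp add: gaussian_rv_def)
  obtain \<mu> \<sigma> where
    d: "(\<sigma> > 0 \<and> distributed P lborel X (normal_density \<mu> \<sigma>)) \<or> (\<sigma> = 0 \<and> (AE \<omega> in P. X \<omega> = \<mu>))"
    using assms(2) unfolding gaussian_rv_def by (elim conjE exE) (rule that)
  from d have "(\<sigma> > 0 \<and> distributed P lborel (\<lambda>\<omega>. X \<omega> + k) (normal_density (\<mu> + k) \<sigma>)) \<or> (\<sigma> = 0 \<and> (AE \<omega> in P. X \<omega> + k = \<mu> + k))"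
  proof (elim disjE conjE)
    assume s: "\<sigma> > 0" "distributed P lborel X (normal_density \<mu> \<sigma>)"
    have "distributed P lborel (\<lambda>\<omega>. k + 1 * X \<omega>) (normal_density (k + 1 * \<mu>) (\<bar>1\<bar> * \<sigma>))"
      using s by (intro normal_density_affine) auto
    then have "distributed P lborel (\<lambda>\<omega>. X \<omega> + k) (normal_density (\<mu> + k) \<sigma>)" by (simp add: add.commute)
    then show ?thesis using s(1) by (intro disjI1 conjI)
  next
    assume s: "\<sigma> = 0" "AE \<omega> in P. X \<omega> = \<mu>"
    from s(2) have "AE \<omega> in P. X \<omega> + k = \<mu> + k" by eventually_elim simp
    then show ?thesis using s(1) by (intro disjI2 conjI)
  qed
  then have "\<exists>\<mu> \<sigma>. (\<sigma> > 0 \<and> distributed P lborel (\<lambda>\<omega>. X \<omega> + k) (normal_density \<mu> \<sigma>)) \<or> (\<sigma> = 0 \<and> (AE \<omega> in P. X \<omega> + k = \<mu>))"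
    by - (rule exI[of _ "\<mu> + k"], rule exI[of _ \<sigma>], assumption)
  moreover have "(\<lambda>\<omega>. X \<omega> + k) \<in> borel_measurable P" using X by simp
  ultimately show ?thesis unfolding gaussian_rv_def by (rule conjI[rotated])
qed

locale isotropic_gaussian = prob_space P + jacobi_params \<alpha> \<beta>
  for P :: "'w measure" and \<alpha> \<beta> :: real +
  fixes M :: "'p metric" and Z :: "'p \<Rightarrow> 'w \<Rightarrow> real" and b :: "nat \<Rightarrow> real"
    and l0 :: nat and \<gamma>1 \<gamma>2 \<nu> :: real
  assumes gaussian_field: "gaussian_field P (mspace M) Z"
    and isotropic: "isotropic_field P M Z"
    and b_nonneg: "\<And>l. b l \<ge> 0" and b_summable: "summable b"
    and cov: "\<And>x y. x \<in> mspace M \<Longrightarrow> y \<in> mspace M \<Longrightarrow>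
      (\<lambda>l. b l * (jacobi \<alpha> \<beta> l (cos (mdist M x y)) / jacobi \<alpha> \<beta> l 1)) sums covariance P (Z x) (Z y)"
    and gamma1: "\<gamma>1 > 0" and nu: "0 < \<nu>" "\<nu> < 2"
    and b_lower: "\<And>l. l \<ge> l0 \<Longrightarrow> \<gamma>1 \<le> b l * (1 + real l) powr (1 + \<nu>)"
    and b_upper: "\<And>l. l \<ge> l0 \<Longrightarrow> b l * (1 + real l) powr (1 + \<nu>) \<le> \<gamma>2"
begin

definition Zc :: "'p \<Rightarrow> 'w \<Rightarrow> real" where "Zc x \<omega> = Z x \<omega> - expectation (Z x)"

definition incr :: "'p \<Rightarrow> 'p \<Rightarrow> 'w \<Rightarrow> real" where "incr x y \<omega> = Z x \<omega> - Z y \<omega>"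

text \<open>Centred values make all members mean zero; increments of the field still belong to it
  because its mean is constant.\<close>

definition span :: "('w \<Rightarrow> real) set" where
  "span = {X. \<exists>F c. finite F \<and> F \<subseteq> mspace M \<and> X = (\<lambda>\<omega>. \<Sum>x\<in>F. c x * Zc x \<omega>)}"

lemma Z_meas: "x \<in> mspace M \<Longrightarrow> Z x \<in> borel_measurable P"
  using isotropic by (auto simp: isotropic_field_def second_order_field_def)

lemma Z_integrable:
  assumes "x \<in> mspace M" shows "integrable P (Z x)"
proof (rule square_integrable_imp_integrable)
  show "Z x \<in> borel_measurable P" using assms by (rule Z_meas)
  show "integrable P (\<lambda>\<omega>. (Z x \<omega>)\<^sup>2)"
    using isotropic assms by (simp add: isotropic_field_def second_order_field_def)
qed

lemma expectation_const: "x \<in> mspace M \<Longrightarrow> y \<in> mspace M \<Longrightarrow> expectation (Z x) = expectation (Z y)"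
proof -
  assume xy: "x \<in> mspace M" "y \<in> mspace M"
  obtain m where "\<forall>x\<in>mspace M. expectation (Z x) = m" using isotropic by (auto simp: isotropic_field_def)
  then show ?thesis using xy by simp
qed

lemma incr_Zc:
  assumes "x \<in> mspace M" "y \<in> mspace M" shows "incr x y = (\<lambda>\<omega>. Zc x \<omega> - Zc y \<omega>)"
proof
  show "incr x y \<omega> = Zc x \<omega> - Zc y \<omega>" for \<omega>
    unfolding incr_def Zc_def using expectation_const[OF assms] by simp
qed

lemma span_I: "finite F \<Longrightarrow> F \<subseteq> mspace M \<Longrightarrow> (\<lambda>\<omega>. \<Sum>x\<in>F. c x * Zc x \<omega>) \<in> span"
  unfolding span_def by (rule CollectI, rule exI, rule exI) (intro conjI; (assumption | rule refl))

lemma gaussian_space_span: "gaussian_space P span"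
proof
  fix X assume "X \<in> span"
  then obtain F c where F: "finite F" "F \<subseteq> mspace M" and X: "X = (\<lambda>\<omega>. \<Sum>x\<in>F. c x * Zc x \<omega>)" by (auto simp: span_def)
  have "X = (\<lambda>\<omega>. (\<Sum>x\<in>F. c x * Z x \<omega>) + - (\<Sum>x\<in>F. c x * expectation (Z x)))"
    unfolding X Zc_def by (simp add: right_diff_distrib sum_subtractf)
  moreover have "gaussian_rv P (\<lambda>\<omega>. \<Sum>x\<in>F. c x * Z x \<omega>)" using gaussian_field F by (auto simp: gaussian_field_def)
  ultimately show "gaussian_rv P X" by (simp only:) (rule gaussian_rv_add_const[OF prob_space_axioms])
  have "expectation X = (\<Sum>x\<in>F. c x * expectation (Zc x))"
    unfolding X using F Z_integrable by (subst Bochner_Integration.integral_sum) (auto simp: Zc_def[abs_def])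
  also have "\<dots> = 0" using F Z_integrable by (intro sum.neutral) (auto simp: Zc_def[abs_def] prob_space)
  finally show "expectation X = 0" .
next
  show "(\<lambda>_. 0) \<in> span" using span_I[of "{}"] by simp
next
  fix X Y assume XY: "X \<in> span" "Y \<in> span"
  obtain F c where F: "finite F" "F \<subseteq> mspace M" "X = (\<lambda>\<omega>. \<Sum>x\<in>F. c x * Zc x \<omega>)"
    using XY(1) by (auto simp: span_def)
  obtain E d where E: "finite E" "E \<subseteq> mspace M" "Y = (\<lambda>\<omega>. \<Sum>x\<in>E. d x * Zc x \<omega>)"
    using XY(2) by (auto simp: span_def)
  have e: "(\<Sum>x\<in>F. c x * Zc x \<omega>) = (\<Sum>x\<in>F \<union> E. (if x \<in> F then c x else 0) * Zc x \<omega>)"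
    "(\<Sum>x\<in>E. d x * Zc x \<omega>) = (\<Sum>x\<in>F \<union> E. (if x \<in> E then d x else 0) * Zc x \<omega>)" for \<omega>
    using F(1) E(1) by (auto intro!: sum.mono_neutral_cong_left)
  have "(\<lambda>\<omega>. X \<omega> + Y \<omega>) = (\<lambda>\<omega>. \<Sum>x\<in>F \<union> E. ((if x \<in> F then c x else 0) + (if x \<in> E then d x else 0)) * Zc x \<omega>)"
    unfolding F(3) E(3) e by (simp only: distrib_right sum.distrib)
  moreover have "(\<lambda>\<omega>. \<Sum>x\<in>F \<union> E. ((if x \<in> F then c x else 0) + (if x \<in> E then d x else 0)) * Zc x \<omega>) \<in> span"
    using F(1,2) E(1,2) by (intro span_I) auto
  ultimately show "(\<lambda>\<omega>. X \<omega> + Y \<omega>) \<in> span" by (simp only:)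
next
  fix X k assume "X \<in> span"
  then obtain F c where F: "finite F" "F \<subseteq> mspace M" and X: "X = (\<lambda>\<omega>. \<Sum>x\<in>F. c x * Zc x \<omega>)" by (auto simp: span_def)
  have "(\<lambda>\<omega>. k * X \<omega>) = (\<lambda>\<omega>. \<Sum>x\<in>F. (k * c x) * Zc x \<omega>)" unfolding X by (simp add: sum_distrib_left mult.assoc)
  moreover have "(\<lambda>\<omega>. \<Sum>x\<in>F. (k * c x) * Zc x \<omega>) \<in> span" using F by (rule span_I)
  ultimately show "(\<lambda>\<omega>. k * X \<omega>) \<in> span" by (simp only:)
qed

end

context isotropic_gaussian begin

sublocale gaussian_space P span by (rule gaussian_space_span)

lemma Zc_mem: "x \<in> mspace M \<Longrightarrow> Zc x \<in> span"
  using span_I[of "{x}" "\<lambda>_. 1"] by simp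

lemma incr_mem: "x \<in> mspace M \<Longrightarrow> y \<in> mspace M \<Longrightarrow> incr x y \<in> span"
  using diff_mem[OF Zc_mem Zc_mem, of x y] by (simp add: incr_Zc)

lemma ip_Zc:
  assumes "x \<in> mspace M" "y \<in> mspace M"
  shows "(\<lambda>l. b l * jac_cos \<alpha> \<beta> l (mdist M x y)) sums ip (Zc x) (Zc y)"
  using cov[OF assms] unfolding jacobi_eq_jac_cos by (simp add: ip_def Zc_def[abs_def] covariance_def)

lemma ip_incr_incr:
  assumes "x \<in> mspace M" "y \<in> mspace M" "u \<in> mspace M" "v \<in> mspace M"
  shows "ip (incr x y) (incr u v) = ip (Zc x) (Zc u) - ip (Zc x) (Zc v) - ip (Zc y) (Zc u) + ip (Zc y) (Zc v)"
proof -
  have 1: "ip (incr x y) W = ip (Zc x) W - ip (Zc y) W" if "W \<in> span" for W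
    using assms that by (simp add: incr_Zc ip_diff Zc_mem)
  have 2: "ip W (incr u v) = ip W (Zc u) - ip W (Zc v)" if "W \<in> span" for W
    using assms that ip_diff[OF Zc_mem Zc_mem that, of u v] by (simp add: incr_Zc ip_commute[of W])
  show ?thesis using assms by (simp add: 1 2 incr_mem Zc_mem)
qed

lemma incr_var_upper:
  "\<exists>K>0. \<forall>x\<in>mspace M. \<forall>y\<in>mspace M. mdist M x y \<le> 1 \<longrightarrow> ip (incr x y) (incr x y) \<le> K * mdist M x y powr \<nu>"
proof -
  obtain K where K: "K > 0" "\<And>r. 0 < r \<Longrightarrow> r \<le> 1 \<Longrightarrow> (\<Sum>l. b l * (1 - jac_cos \<alpha> \<beta> l r)) \<le> K * r powr \<nu>"
    using variogram_upper[OF b_nonneg b_summable nu b_upper] by blast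
  have "ip (incr x y) (incr x y) \<le> (2 * K) * mdist M x y powr \<nu>" if xy: "x \<in> mspace M" "y \<in> mspace M" "mdist M x y \<le> 1" for x y
  proof (cases "mdist M x y = 0")
    case True
    then have "x = y" using xy by simp
    then show ?thesis using True by (simp add: incr_def ip_def)
  next
    case False
    then have r: "0 < mdist M x y" using mdist_nonneg[of M x y] by linarith
    have dd: "mdist M w w = 0" if "w \<in> mspace M" for w using that by simp
    have s: "(\<lambda>l. b l) sums ip (Zc w) (Zc w)" if "w \<in> mspace M" for w
      using ip_Zc[OF that that] dd[OF that] by simp
    have "(\<lambda>l. b l - b l * jac_cos \<alpha> \<beta> l (mdist M x y) - b l * jac_cos \<alpha> \<beta> l (mdist M x y) + b l) sums ip (incr x y) (incr x y)"
      unfolding ip_incr_incr[OF xy(1,2,1,2)]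
      using ip_Zc[OF xy(2,1)] xy by (intro sums_add sums_diff s ip_Zc) (auto simp: mdist_commute)
    moreover have "b l - b l * jac_cos \<alpha> \<beta> l (mdist M x y) - b l * jac_cos \<alpha> \<beta> l (mdist M x y) + b l = 2 * (b l * (1 - jac_cos \<alpha> \<beta> l (mdist M x y)))" for l
      by (simp add: algebra_simps)
    ultimately have s2: "(\<lambda>l. 2 * (b l * (1 - jac_cos \<alpha> \<beta> l (mdist M x y)))) sums ip (incr x y) (incr x y)" by simp
    then have "summable (\<lambda>l. b l * (1 - jac_cos \<alpha> \<beta> l (mdist M x y)))" using sums_summable summable_mult_D by fastforce
    then have "ip (incr x y) (incr x y) = 2 * (\<Sum>l. b l * (1 - jac_cos \<alpha> \<beta> l (mdist M x y)))"
      using sums_unique[OF s2] by (simp add: suminf_mult)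
    then show ?thesis using K(2)[OF r xy(3)] by simp
  qed
  then show ?thesis using K(1) by (intro exI[of _ "2 * K"]) auto
qed

text \<open>Borel-Cantelli over the chaining links: the deviation allowed at scale
  \<open>2 ^ (- k)\<close> is a multiple of the standard deviation times \<open>sqrt k\<close>,
  enough to beat the number of links. Since \<open>k\<close> is comparable to
  \<open>|ln \<rho>|\<close>, the result has the form of the gauge.\<close>

lemma modulus_upper:
  assumes nets: "has_polynomial_nets M"
    and cont: "AE \<omega> in P. continuous_map (mtopology_of M) euclideanreal (\<lambda>x. Z x \<omega>)"
  shows "\<exists>C>0. AE \<omega> in P. \<exists>\<delta>>0. \<forall>x\<in>mspace M. \<forall>y\<in>mspace M. 0 < mdist M x y \<longrightarrow> mdist M x y \<le> \<delta> \<longrightarrow>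
    \<bar>Z x \<omega> - Z y \<omega>\<bar> \<le> C * (mdist M x y powr (\<nu> / 2) * sqrt \<bar>ln (mdist M x y)\<bar>)"
proof -
  obtain A B0 where AB: "A > 0" "B0 > 0" and "\<forall>k. \<exists>T. finite T \<and> T \<subseteq> mspace M \<and>
     real (card T) \<le> A * B0 ^ k \<and> (\<forall>x\<in>mspace M. \<exists>y\<in>T. mdist M x y \<le> (1 / 2) ^ k)"
    using nets unfolding has_polynomial_nets_def by blast
  then obtain T where T: "\<And>k. finite (T k)" "\<And>k. T k \<subseteq> mspace M" "\<And>k. real (card (T k)) \<le> A * B0 ^ k"
    "\<And>k x. x \<in> mspace M \<Longrightarrow> \<exists>y\<in>T k. mdist M x y \<le> (1 / 2) ^ k" by metis
  \<comment> \<open>\<open>B \<ge> 1\<close> makes \<open>B ^ k\<close> monotone in \<open>k\<close>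
    and \<open>ln (2 * B^2)\<close> positive.\<close>
  define B where "B = max B0 1"
  have B: "B \<ge> 1" by (simp add: B_def)
  have cT: "real (card (T k)) \<le> A * B ^ k" for k
    using T(3)[of k] AB by (intro order.trans[OF T(3)] mult_left_mono power_mono) (auto simp: B_def)
  obtain K where K: "K > 0" "\<And>x y. x \<in> mspace M \<Longrightarrow> y \<in> mspace M \<Longrightarrow> mdist M x y \<le> 1 \<Longrightarrow> ip (incr x y) (incr x y) \<le> K * mdist M x y powr \<nu>"
    using incr_var_upper by blast
  \<comment> \<open>\<open>q ^ k\<close> is \<open>(2 ^ (- k)) powr (\<nu> / 2)\<close>, the order
    of the standard deviation at that distance.\<close>
  define q :: real where "q = 2 powr (- \<nu> / 2)"
  have q: "0 < q" "q < 1" using nu powr_less_one[of 2 "- \<nu> / 2"] by (auto simp: q_def)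
  have qq: "((1 / 2) ^ k) powr \<nu> = (q ^ k)\<^sup>2" for k
  proof -
    have "(1 / 2 :: real) ^ k = 2 powr (- real k)" by (simp add: powr_minus powr_realpow power_one_over inverse_eq_divide)
    moreover have "q ^ k = 2 powr (- \<nu> / 2 * real k)" by (simp add: q_def powr_realpow[symmetric] powr_powr)
    ultimately show ?thesis by (simp add: power2_eq_square powr_powr powr_add[symmetric] mult.commute)
  qed
  \<comment> \<open>Tuned so that \<open>(h k)^2 / (4 * s^2) = k * ln (2 * B^2)\<close> with
    \<open>s = 3 * sqrt K * q ^ k\<close>. Each link then fails with probability at most
    \<open>2 * (1 / (2 * B^2)) ^ k\<close>, against a multiple of \<open>B ^ (2 * k)\<close>
    links.\<close>
  define H where "H = 6 * sqrt (K * ln (2 * B\<^sup>2))"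
  have lnB: "ln (2 * B\<^sup>2) > 0" using B one_le_power[of B 2] by (intro ln_gt_zero) linarith
  have H: "H > 0" using K lnB by (simp add: H_def)
  have H2: "H\<^sup>2 = 36 * K * ln (2 * B\<^sup>2)" using K lnB by (simp add: H_def power_mult_distrib)
  define h where "h k = H * q ^ k * sqrt (real k)" for k
  define I where "I k = {(u, v). u \<in> T k \<and> v \<in> T k \<union> T (Suc k) \<and> mdist M u v \<le> 3 * (1 / 2) ^ k}" for k
  define E where "E k = (\<Union>(u, v)\<in>I k. {\<omega>\<in>space P. \<bar>incr u v \<omega>\<bar> > h k})" for k
  have I_sub: "I k \<subseteq> T k \<times> (T k \<union> T (Suc k))" for k by (auto simp: I_def)
  have I_fin: "finite (I k)" for k using T(1) by (intro finite_subset[OF I_sub]) auto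
  have I_M: "u \<in> mspace M" "v \<in> mspace M" if "(u, v) \<in> I k" for u v k using that T(2) by (auto simp: I_def)
  have ev: "{\<omega>\<in>space P. \<bar>incr u v \<omega>\<bar> > h k} \<in> events" if "(u, v) \<in> I k" for u v k
    using meas_mem[OF incr_mem[OF I_M[OF that]]] by measurable
  have E_ev: "E k \<in> events" for k unfolding E_def using I_fin ev by (intro sets.finite_UN) auto
  \<comment> \<open>\<open>k \<ge> 2\<close> brings \<open>3 * (1 / 2) ^ k\<close> below 1, where
    the variance bound applies.\<close>
  have pE: "prob (E k) \<le> (2 * A\<^sup>2 * (1 + B)) * (1 / 2) ^ k" if k: "k \<ge> 2" for k
  proof -
    have p1: "prob {\<omega>\<in>space P. \<bar>incr u v \<omega>\<bar> > h k} \<le> 2 * (1 / (2 * B\<^sup>2)) ^ k" if uv: "(u, v) \<in> I k" for u v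
    proof -
      define s where "s = 3 * sqrt K * q ^ k"
      have s: "s > 0" using K q by (simp add: s_def)
      have d3: "mdist M u v \<le> 3 * (1 / 2) ^ k" using uv by (simp add: I_def)
      have "(1 / 2 :: real) ^ k \<le> (1 / 2) ^ 2" using k by (intro power_decreasing) auto
      then have d1: "mdist M u v \<le> 1" using d3 by (simp add: power2_eq_square)
      have "ip (incr u v) (incr u v) \<le> K * mdist M u v powr \<nu>" using I_M[OF uv] d1 by (intro K(2))
      also have "\<dots> \<le> K * (3 * (1 / 2) ^ k) powr \<nu>" using K nu d3 by (intro mult_left_mono powr_mono2) auto
      also have "\<dots> = K * (3 powr \<nu> * (q ^ k)\<^sup>2)" by (simp add: powr_mult qq)
      also have "\<dots> \<le> K * (3 powr 2 * (q ^ k)\<^sup>2)" using K nu by (intro mult_left_mono mult_right_mono powr_mono) auto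
      also have "\<dots> = s\<^sup>2" using K by (simp add: s_def power_mult_distrib powr_numeral)
      finally have "prob {\<omega>\<in>space P. \<bar>incr u v \<omega>\<bar> > h k} \<le> 2 * exp (- (h k)\<^sup>2 / (4 * s\<^sup>2))"
        using s H q I_M[OF uv] by (intro tail_bound incr_mem) (auto simp: h_def)
      also have "(h k)\<^sup>2 / (4 * s\<^sup>2) = real k * ln (2 * B\<^sup>2)"
        using K q by (simp add: h_def s_def power_mult_distrib H2 field_simps)
      then have "exp (- (h k)\<^sup>2 / (4 * s\<^sup>2)) = exp (- (real k * ln (2 * B\<^sup>2)))" by simp
      also have "\<dots> = (1 / (2 * B\<^sup>2)) ^ k"
        using B by (simp add: exp_minus exp_of_nat_mult exp_ln power_one_over inverse_eq_divide)
      finally show ?thesis by simp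
    qed
    have "prob (E k) \<le> (\<Sum>p\<in>I k. prob (case p of (u, v) \<Rightarrow> {\<omega>\<in>space P. \<bar>incr u v \<omega>\<bar> > h k}))"
      unfolding E_def using I_fin ev by (intro finite_measure_subadditive_finite) auto
    also have "\<dots> \<le> (\<Sum>p\<in>I k. 2 * (1 / (2 * B\<^sup>2)) ^ k)" using p1 by (intro sum_mono) auto
    also have "\<dots> = real (card (I k)) * (2 * (1 / (2 * B\<^sup>2)) ^ k)" by simp
    also have "\<dots> \<le> (A\<^sup>2 * (1 + B) * (B\<^sup>2) ^ k) * (2 * (1 / (2 * B\<^sup>2)) ^ k)"
    proof (intro mult_right_mono)
      have "card (I k) \<le> card (T k \<times> (T k \<union> T (Suc k)))" using I_sub T(1) by (intro card_mono) auto
      also have "\<dots> \<le> card (T k) * (card (T k) + card (T (Suc k)))" by (simp add: card_cartesian_product card_Un_le)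
      finally have "real (card (I k)) \<le> real (card (T k)) * (real (card (T k)) + real (card (T (Suc k))))"
        by (metis of_nat_add of_nat_le_iff of_nat_mult)
      also have "\<dots> \<le> (A * B ^ k) * (A * B ^ k + A * B ^ Suc k)" using AB B by (intro mult_mono add_mono cT) auto
      also have "\<dots> = A\<^sup>2 * (1 + B) * (B\<^sup>2) ^ k" by (simp add: power2_eq_square power_mult_distrib algebra_simps)
      finally show "real (card (I k)) \<le> A\<^sup>2 * (1 + B) * (B\<^sup>2) ^ k" .
    qed (use B in auto)
    also have "\<dots> = (2 * A\<^sup>2 * (1 + B)) * ((B\<^sup>2) * (1 / (2 * B\<^sup>2))) ^ k" by (simp only: power_mult_distrib)
    also have "(B\<^sup>2) * (1 / (2 * B\<^sup>2)) = 1 / 2" using B by simp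
    finally show ?thesis .
  qed
  have "summable (\<lambda>k. prob (E k))"
  proof (rule summable_comparison_test'[where N = 2])
    show "summable (\<lambda>k. (2 * A\<^sup>2 * (1 + B)) * (1 / 2 :: real) ^ k)" by (intro summable_mult summable_geometric) simp
  qed (use pE in auto)
  then have "AE \<omega> in P. \<forall>\<^sub>F k in sequentially. \<omega> \<in> space P - E k"
    using E_ev by (intro borel_cantelli_AE1) (auto simp: emeasure_eq_measure)
  \<comment> \<open>The factor 4 pays for \<open>q ^ k \<le> 2 * r powr (\<nu> / 2)\<close> and
    \<open>sqrt k \<le> 2 * sqrt |ln r|\<close>.\<close>
  define C where "C = (2 / (1 - q)\<^sup>2 + 1) * H * 4"
  have C: "C > 0" using H q by (auto simp: C_def intro!: mult_pos_pos add_nonneg_pos)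
  have "AE \<omega> in P. \<exists>\<delta>>0. \<forall>x\<in>mspace M. \<forall>y\<in>mspace M. 0 < mdist M x y \<longrightarrow> mdist M x y \<le> \<delta> \<longrightarrow>
    \<bar>Z x \<omega> - Z y \<omega>\<bar> \<le> C * (mdist M x y powr (\<nu> / 2) * sqrt \<bar>ln (mdist M x y)\<bar>)"
    using \<open>AE \<omega> in P. \<forall>\<^sub>F k in sequentially. \<omega> \<in> space P - E k\<close> cont
  proof eventually_elim
    fix \<omega> assume "\<forall>\<^sub>F k in sequentially. \<omega> \<in> space P - E k"
      and c: "continuous_map (mtopology_of M) euclideanreal (\<lambda>x. Z x \<omega>)"
    then obtain k1 where k1: "\<And>k. k \<ge> k1 \<Longrightarrow> \<omega> \<in> space P - E k" by (auto simp: eventually_sequentially)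
    define k0 where "k0 = max k1 1"
    have k0: "k0 \<ge> 1" by (simp add: k0_def)
    have step: "\<bar>Z u \<omega> - Z v \<omega>\<bar> \<le> H * q ^ k * sqrt (real k)"
      if "k \<ge> k0" "u \<in> T k" "v \<in> T k \<union> T (Suc k)" "mdist M u v \<le> 3 * (1 / 2) ^ k" for k u v
    proof -
      have "(u, v) \<in> I k" using that by (simp add: I_def)
      moreover have "\<omega> \<in> space P - E k" using k1[of k] that(1) by (simp add: k0_def)
      ultimately have "\<not> \<bar>incr u v \<omega>\<bar> > h k" by (auto simp: E_def)
      then show ?thesis by (simp add: incr_def h_def)
    qed
    show "\<exists>\<delta>>0. \<forall>x\<in>mspace M. \<forall>y\<in>mspace M. 0 < mdist M x y \<longrightarrow> mdist M x y \<le> \<delta> \<longrightarrow>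
      \<bar>Z x \<omega> - Z y \<omega>\<bar> \<le> C * (mdist M x y powr (\<nu> / 2) * sqrt \<bar>ln (mdist M x y)\<bar>)"
    proof (intro exI[of _ "(1 / 2) ^ k0"] conjI ballI impI)
      fix x y assume xy: "x \<in> mspace M" "y \<in> mspace M" "0 < mdist M x y" "mdist M x y \<le> (1 / 2) ^ k0"
      define r where "r = mdist M x y"
      obtain k where k: "k \<ge> k0" "(1 / 2) ^ Suc k < r" "r \<le> (1 / 2) ^ k"
        using power_half_bracket[of r k0] xy by (auto simp: r_def)
      have r0: "r > 0" using xy by (simp add: r_def)
      have main: "\<bar>Z x \<omega> - Z y \<omega>\<bar> \<le> (2 / (1 - q)\<^sup>2 + 1) * (H * q ^ k * sqrt (real k))"
        by (rule chaining_modulus[OF c T(2) T(4) q less_imp_le[OF H] k0 step xy(1,2)]) (use k in \<open>auto simp: r_def\<close>)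
      have qk: "q ^ k \<le> 2 * r powr (\<nu> / 2)"
      proof -
        have "(q ^ k)\<^sup>2 = ((1 / 2) ^ k) powr \<nu>" by (simp add: qq)
        also have "\<dots> \<le> (2 * r) powr \<nu>" using k nu by (intro powr_mono2) auto
        also have "\<dots> \<le> 4 * r powr \<nu>"
          using nu powr_mono[of \<nu> 2 2] by (simp add: powr_mult powr_numeral mult_right_mono)
        also have "\<dots> = (2 * r powr (\<nu> / 2))\<^sup>2" by (simp add: power_mult_distrib power2_eq_square powr_add[symmetric])
        finally show ?thesis by (rule power2_le_imp_le) auto
      qed
      have sk: "sqrt (real k) \<le> 2 * sqrt \<bar>ln r\<bar>"
      proof -
        have "ln r \<le> ln ((1 / 2) ^ k)" using k r0 by simp
        also have "\<dots> = - (real k * ln 2)" by (simp add: ln_realpow ln_div)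
        finally have "real k * ln 2 \<le> \<bar>ln r\<bar>" by linarith
        moreover have "real k * (1 / 4) \<le> real k * ln 2" using ln_2_less_1 ln2_ge_two_thirds by (intro mult_left_mono) auto
        ultimately have "real k \<le> 4 * \<bar>ln r\<bar>" by linarith
        then have "sqrt (real k) \<le> sqrt (4 * \<bar>ln r\<bar>)" by (rule real_sqrt_le_mono)
        then show ?thesis by (simp add: real_sqrt_mult)
      qed
      have "q ^ k * sqrt (real k) \<le> (2 * r powr (\<nu> / 2)) * (2 * sqrt \<bar>ln r\<bar>)" by (intro mult_mono qk sk) auto
      then have "(2 / (1 - q)\<^sup>2 + 1) * H * (q ^ k * sqrt (real k)) \<le> (2 / (1 - q)\<^sup>2 + 1) * H * ((2 * r powr (\<nu> / 2)) * (2 * sqrt \<bar>ln r\<bar>))"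
        using H by (intro mult_left_mono) auto
      then show "\<bar>Z x \<omega> - Z y \<omega>\<bar> \<le> C * (mdist M x y powr (\<nu> / 2) * sqrt \<bar>ln (mdist M x y)\<bar>)"
      proof -
        have e: "a * (H * u * v) = a * H * (u * v)" "a * H * ((2 * R) * (2 * S)) = (a * H * 4) * (R * S)" for a u v R S :: real by simp_all
        assume "(2 / (1 - q)\<^sup>2 + 1) * H * (q ^ k * sqrt (real k)) \<le> (2 / (1 - q)\<^sup>2 + 1) * H * ((2 * r powr (\<nu> / 2)) * (2 * sqrt \<bar>ln r\<bar>))"
        with main show ?thesis unfolding C_def r_def[symmetric] e by linarith
      qed
    qed simp
  qed
  then show ?thesis using C by blast
qed

end

section \<open>Lower bound along a geodesic\<close>

context isotropic_gaussian begin
context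
  fixes p :: "real \<Rightarrow> 'p"
  assumes p: "\<And>s t. s \<in> {0..1} \<Longrightarrow> t \<in> {0..1} \<Longrightarrow> p s \<in> mspace M \<and> mdist M (p s) (p t) = \<bar>s - t\<bar>"
begin

lemma ip_incr_arc:
  assumes "s \<in> {0..1}" "s + r \<in> {0..1}" "t \<in> {0..1}" "t + r \<in> {0..1}"
  shows "(\<lambda>l. b l * incr_kernel l r s t) sums ip (incr (p s) (p (s + r))) (incr (p t) (p (t + r)))"
proof -
  have pM: "p u \<in> mspace M" if "u \<in> {0..1}" for u using p[OF that that] by simp
  have Z: "(\<lambda>l. b l * jac_cos \<alpha> \<beta> l (u - v)) sums ip (Zc (p u)) (Zc (p v))" if "u \<in> {0..1}" "v \<in> {0..1}" for u v
    using ip_Zc[OF pM[OF that(1)] pM[OF that(2)]] p[OF that] by simp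
  have "(\<lambda>l. b l * jac_cos \<alpha> \<beta> l (s - t) - b l * jac_cos \<alpha> \<beta> l (s - (t + r)) - b l * jac_cos \<alpha> \<beta> l ((s + r) - t)
      + b l * jac_cos \<alpha> \<beta> l ((s + r) - (t + r))) sums ip (incr (p s) (p (s + r))) (incr (p t) (p (t + r)))"
    unfolding ip_incr_incr[OF pM[OF assms(1)] pM[OF assms(2)] pM[OF assms(3)] pM[OF assms(4)]]
    using assms by (intro sums_add sums_diff Z)
  moreover have "b l * jac_cos \<alpha> \<beta> l (s - t) - b l * jac_cos \<alpha> \<beta> l (s - (t + r)) - b l * jac_cos \<alpha> \<beta> l ((s + r) - t)
      + b l * jac_cos \<alpha> \<beta> l ((s + r) - (t + r)) = b l * incr_kernel l r s t" for l
  proof -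
    have e: "s - t - r = s - (t + r)" "s - t + r = (s + r) - t" "(s + r) - (t + r) = s - t" by simp_all
    show ?thesis unfolding incr_kernel_def e by (simp add: algebra_simps)
  qed
  ultimately show ?thesis by simp
qed

text \<open>All degrees contribute nonnegatively, so only the block \<open>n \<le> l < 2 * n\<close>
  is kept: \<open>n\<close> terms with \<open>b l\<close> at least of order
  \<open>n powr (- 1 - \<nu>)\<close> and a diagonally dominant kernel.
  \<open>2 powr (- 2 - \<nu>)\<close> combines \<open>1 + l \<le> 2 * n\<close> with the 1/2 from
  dominance.\<close>

lemma gram_lower:
  fixes \<theta> c :: "nat \<Rightarrow> real" and I :: "nat set" and r \<eta> :: real and n :: nat
  assumes \<theta>: "\<And>i. i \<in> I \<Longrightarrow> \<theta> i \<in> {0..1} \<and> \<theta> i + r \<in> {0..1}" and I: "finite I"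
    and n: "n \<ge> l0" "n \<ge> 1"
    and diag: "\<And>l. l \<ge> n \<Longrightarrow> \<bar>jac_cos \<alpha> \<beta> l r\<bar> \<le> 1 / 2"
    and eta: "4 * \<eta> * real (card I) \<le> 1 / 2" "\<eta> \<ge> 0"
    and off: "\<And>l i j. l \<ge> n \<Longrightarrow> i \<in> I \<Longrightarrow> j \<in> I \<Longrightarrow> i \<noteq> j \<Longrightarrow> \<bar>incr_kernel l r (\<theta> i) (\<theta> j)\<bar> \<le> 4 * \<eta>"
  defines "S \<equiv> \<lambda>\<omega>. \<Sum>i\<in>I. c i * incr (p (\<theta> i)) (p (\<theta> i + r)) \<omega>"
  shows "ip S S \<ge> \<gamma>1 * 2 powr (- 2 - \<nu>) * real n powr (- \<nu>) * (\<Sum>i\<in>I. (c i)\<^sup>2)"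
proof -
  define Q where "Q l = (\<Sum>i\<in>I. \<Sum>j\<in>I. c i * c j * incr_kernel l r (\<theta> i) (\<theta> j))" for l
  define C2 where "C2 = (\<Sum>i\<in>I. (c i)\<^sup>2)"
  have C2: "C2 \<ge> 0" by (auto simp: C2_def intro: sum_nonneg)
  have X: "incr (p (\<theta> i)) (p (\<theta> i + r)) \<in> span" if "i \<in> I" for i
    using \<theta>[OF that] p by (intro incr_mem) auto
  have "ip S S = (\<Sum>i\<in>I. \<Sum>j\<in>I. c i * c j * ip (incr (p (\<theta> i)) (p (\<theta> i + r))) (incr (p (\<theta> j)) (p (\<theta> j + r))))"
    unfolding S_def using X by (rule ip_sum_sum)
  moreover have "(\<lambda>l. \<Sum>i\<in>I. \<Sum>j\<in>I. c i * c j * (b l * incr_kernel l r (\<theta> i) (\<theta> j))) sums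
      (\<Sum>i\<in>I. \<Sum>j\<in>I. c i * c j * ip (incr (p (\<theta> i)) (p (\<theta> i + r))) (incr (p (\<theta> j)) (p (\<theta> j + r))))"
    using \<theta> by (intro sums_sum sums_mult ip_incr_arc) auto
  moreover have "(\<Sum>i\<in>I. \<Sum>j\<in>I. c i * c j * (b l * incr_kernel l r (\<theta> i) (\<theta> j))) = b l * Q l" for l
    by (simp add: Q_def sum_distrib_left mult_ac)
  ultimately have s: "(\<lambda>l. b l * Q l) sums ip S S" by simp
  have Q0: "Q l \<ge> 0" for l unfolding Q_def by (rule incr_kernel_nonneg)
  have Q1: "Q l \<ge> C2 / 2" if "l \<ge> n" for l
    unfolding Q_def C2_def using that by (intro incr_kernel_lower[OF diag I eta off])
  have b1: "b l \<ge> \<gamma>1 * (2 * real n) powr (- 1 - \<nu>)" if l: "l \<ge> n" "l < 2 * n" for l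
  proof -
    have "(2 * real n) powr (- 1 - \<nu>) \<le> (1 + real l) powr (- 1 - \<nu>)" using l nu by (intro powr_mono2') auto
    then have "\<gamma>1 * (2 * real n) powr (- 1 - \<nu>) \<le> \<gamma>1 * (1 + real l) powr (- 1 - \<nu>)" using gamma1 by (intro mult_left_mono) auto
    also have "\<dots> \<le> b l * (1 + real l) powr (1 + \<nu>) * (1 + real l) powr (- 1 - \<nu>)"
      using l n by (intro mult_right_mono b_lower) auto
    also have "\<dots> = b l * ((1 + real l) powr (1 + \<nu>) * (1 + real l) powr (- 1 - \<nu>))" by simp
    also have "(1 + real l) powr (1 + \<nu>) * (1 + real l) powr (- 1 - \<nu>) = 1" by (subst powr_add[symmetric]) simp
    finally show ?thesis by simp
  qed
  have "real n * (\<gamma>1 * (2 * real n) powr (- 1 - \<nu>) * (C2 / 2)) = (\<Sum>l=n..<2*n. \<gamma>1 * (2 * real n) powr (- 1 - \<nu>) * (C2 / 2))" by simp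
  also have "\<dots> \<le> (\<Sum>l=n..<2*n. b l * Q l)"
    using b1 Q1 C2 gamma1 b_nonneg by (intro sum_mono mult_mono) auto
  also have "\<dots> \<le> ip S S"
    using sum_le_suminf[OF sums_summable[OF s], of "{n..<2*n}"] sums_unique[OF s] b_nonneg Q0 by simp
  also have "real n * (\<gamma>1 * (2 * real n) powr (- 1 - \<nu>) * (C2 / 2)) = \<gamma>1 * 2 powr (- 2 - \<nu>) * real n powr (- \<nu>) * C2"
  proof -
    have 1: "(2 * real n) powr (- 1 - \<nu>) = 2 powr (- 1 - \<nu>) * real n powr (- 1 - \<nu>)" by (simp add: powr_mult)
    have 2: "real n * real n powr (- 1 - \<nu>) = real n powr (- \<nu>)" using n powr_add[of "real n" 1 "- 1 - \<nu>"] by simp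
    have 3: "2 powr (- 1 - \<nu>) / 2 = (2 :: real) powr (- 2 - \<nu>)"
      using powr_add[of 2 "- 2 - \<nu>" 1] by simp
    have "real n * (\<gamma>1 * (2 * real n) powr (- 1 - \<nu>) * (C2 / 2)) = \<gamma>1 * (2 powr (- 1 - \<nu>) / 2) * (real n * real n powr (- 1 - \<nu>)) * C2"
      unfolding 1 by simp
    then show ?thesis unfolding 2 3 .
  qed
  finally show ?thesis by (simp add: C2_def)
qed

lemma modulus_lower_arc:
  "\<exists>c>0. AE \<omega> in P. \<forall>\<delta>>0. \<exists>x\<in>mspace M. \<exists>y\<in>mspace M. 0 < mdist M x y \<and> mdist M x y \<le> \<delta> \<and> mdist M x y < 1 \<and>
    \<bar>Z x \<omega> - Z y \<omega>\<bar> \<ge> c * (mdist M x y powr (\<nu> / 2) * sqrt \<bar>ln (mdist M x y)\<bar>)"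
proof -
  obtain m C where m: "m > 0" and C: "C > 0"
    and decay: "\<And>l t. l \<ge> 1 \<Longrightarrow> 0 < t \<Longrightarrow> t \<le> 1 \<Longrightarrow> \<bar>jac_cos \<alpha> \<beta> l t\<bar> \<le> C * (real l * t) powr - m"
    using jac_cos_decay by blast
  \<comment> \<open>Increments of length \<open>M0 / n\<close> make \<open>R_l\<close> at most 1/2
    in modulus for all \<open>l \<ge> n\<close>.\<close>
  define M0 where "M0 = max 1 ((2 * C) powr (1 / m))"
  have M0: "M0 \<ge> 1" "C * M0 powr - m \<le> 1 / 2"
  proof -
    have "2 * C = ((2 * C) powr (1 / m)) powr m" using m C by (simp add: powr_powr)
    also have "\<dots> \<le> M0 powr m" using m by (intro powr_mono2) (auto simp: M0_def)
    finally have "2 * C \<le> M0 powr m" .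
    moreover have "M0 powr m > 0" by (simp add: M0_def)
    ultimately show "C * M0 powr - m \<le> 1 / 2" by (simp add: powr_minus field_simps)
  qed (simp add: M0_def)
  \<comment> \<open>Gives \<open>(q - 1) * m \<ge> 2\<close>: entries between different increments
    are then \<open>O(N^-2)\<close>, and a row of \<open>N\<close> of them stays small.\<close>
  define q where "q = 2 + nat \<lceil>2 / m\<rceil>"
  have q: "q \<ge> 2" "real q * m \<ge> 2 + m"
  proof -
    have "2 / m \<le> real (nat \<lceil>2 / m\<rceil>)" by (rule real_nat_ceiling_ge)
    then have "real q \<ge> 2 + 2 / m" by (simp add: q_def)
    then have "real q * m \<ge> (2 + 2 / m) * m" using m by (intro mult_right_mono) auto
    also have "(2 + 2 / m) * m = 2 * m + 2" using m by (simp add: field_simps)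
    finally show "real q * m \<ge> 2 + m" using m by linarith
  qed (simp add: q_def)
  define g0 where "g0 = sqrt (\<gamma>1 * 2 powr (- 2 - \<nu>))"
  have g0: "g0 > 0" "g0\<^sup>2 = \<gamma>1 * 2 powr (- 2 - \<nu>)" using gamma1 by (simp_all add: g0_def)
  \<comment> \<open>Makes \<open>r N \<le> 1 / (4 * N)\<close> and the off-diagonal total at most
    1/2, besides \<open>n N \<ge> l0\<close>.\<close>
  define N1 where "N1 = max (max l0 2) (max (nat \<lceil>4 * M0\<rceil>) (nat \<lceil>8 * C * 4 powr m\<rceil>))"
  have N1: "l0 \<le> N1" "2 \<le> N1" "4 * M0 \<le> real N1" "8 * C * 4 powr m \<le> real N1"
  proof -
    show "l0 \<le> N1" "2 \<le> N1" by (auto simp: N1_def)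
    have "nat \<lceil>4 * M0\<rceil> \<le> N1" "nat \<lceil>8 * C * 4 powr m\<rceil> \<le> N1"
      by (simp_all only: N1_def le_max_iff_disj order_refl simp_thms)
    then have "real (nat \<lceil>4 * M0\<rceil>) \<le> real N1" "real (nat \<lceil>8 * C * 4 powr m\<rceil>) \<le> real N1" by (simp_all only: of_nat_le_iff)
    then show "4 * M0 \<le> real N1" "8 * C * 4 powr m \<le> real N1"
      using real_nat_ceiling_ge[of "4 * M0"] real_nat_ceiling_ge[of "8 * C * 4 powr m"] by linarith+
  qed
  define n where "n N = N ^ q" for N :: nat
  define r where "r N = M0 / real (n N)" for N
  \<comment> \<open>Starting points spaced by \<open>1 / (2 * N)\<close> in
    \<open>[0, 1 / 2)\<close>. As \<open>r N \<le> 1 / (4 * N)\<close>, points of different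
    increments keep a distance of at least \<open>1 / (4 * N)\<close>.\<close>
  define \<theta> where "\<theta> N i = real i / (2 * real N)" for N i :: nat
  \<comment> \<open>Padded by zero because \<open>gs\<close> takes an infinite sequence.\<close>
  define X where "X N i = (if i < N then incr (p (\<theta> N i)) (p (\<theta> N i + r N)) else (\<lambda>_. 0))" for N i
  define s where "s N = g0 * real (n N) powr (- \<nu> / 2)" for N
  \<comment> \<open>Half of \<open>sqrt (ln N)\<close> turns the tail \<open>exp (- t^2)\<close>
    into \<open>N powr (- 1 / 4)\<close>.\<close>
  define t where "t N = sqrt (ln (real N)) / 2" for N :: nat
  have scales: "n N \<ge> N" "real (n N) \<ge> (real N)\<^sup>2" "r N > 0" "r N \<le> 1 / (4 * real N)" if N: "N \<ge> N1" for N
  proof -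
    have N2: "N \<ge> 2" "real N \<ge> 4 * M0" using N N1 by (auto intro: order.trans[OF N1(3)])
    have "N ^ 1 \<le> N ^ q" using q N2 by (intro power_increasing) auto
    then show a: "n N \<ge> N" by (simp add: n_def)
    have "N ^ 2 \<le> N ^ q" using q N2 by (intro power_increasing) auto
    then have "real (N ^ 2) \<le> real (n N)" unfolding n_def by (simp only: of_nat_le_iff)
    then show b: "real (n N) \<ge> (real N)\<^sup>2" by simp
    have n0: "real (n N) > 0" using a N2 by simp
    then show "r N > 0" using M0 by (simp add: r_def)
    have "M0 * (4 * real N) \<le> real N * real N" using N2 by (simp add: mult_right_mono)
    also have "\<dots> \<le> real (n N)" using b by (simp add: power2_eq_square)
    finally show "r N \<le> 1 / (4 * real N)" using n0 N2 by (simp add: r_def field_simps)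
  qed
  have th: "\<theta> N i \<in> {0..1} \<and> \<theta> N i + r N \<in> {0..1}" if N: "N \<ge> N1" and i: "i < N" for N i
  proof -
    have N2: "N \<ge> 2" using N N1 by simp
    have "\<theta> N i \<le> 1 / 2" using i N2 by (simp add: \<theta>_def field_simps)
    moreover have "r N \<le> 1 / 2"
    proof -
      have "1 / (4 * real N) \<le> 1 / 2" using N2 by (simp add: field_simps)
      then show ?thesis using scales(4)[OF N] by linarith
    qed
    moreover have "\<theta> N i \<ge> 0" by (simp add: \<theta>_def)
    ultimately show ?thesis using scales(3)[OF N] by auto
  qed
  have X_mem: "X N i \<in> span" if "N \<ge> N1" for N i
    using th[OF that, of i] p zero_mem by (auto simp: X_def intro!: incr_mem)
  have var: "ip (gs (X N) k) (gs (X N) k) \<ge> (s N)\<^sup>2" if N: "N \<ge> N1" and k: "k < N" for N k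
  proof -
    have N2: "N \<ge> 2" using N N1 by simp
    have nN: "real (n N) \<ge> 1" using scales(1)[OF N] N2 by simp
    \<comment> \<open>Bounds \<open>R_l\<close> for \<open>l \<ge> n N\<close> at distances between
      \<open>1 / (4 * N)\<close> and 1.\<close>
    define \<eta> where "\<eta> = C * (real (n N) / (4 * real N)) powr - m"
    have \<eta>0: "\<eta> \<ge> 0" using C by (simp add: \<eta>_def)
    have \<eta>1: "4 * \<eta> * real N \<le> 1 / 2"
    proof -
      have "real (n N) = real N powr real q" using N2 by (simp add: n_def powr_realpow)
      then have "real (n N) / (4 * real N) = real N powr (real q - 1) / 4" using N2 by (simp add: powr_diff)
      then have "(real (n N) / (4 * real N)) powr - m = (real N powr (real q - 1)) powr - m / 4 powr - m"
        by (simp only: powr_divide)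
      also have "\<dots> = real N powr ((real q - 1) * - m) * 4 powr m"
        by (simp add: powr_powr powr_minus[of 4] divide_inverse)
      also have "real N powr ((real q - 1) * - m) \<le> real N powr - 2"
        using N2 q by (intro powr_mono) (auto simp: algebra_simps)
      also have "real N powr - 2 = 1 / (real N * real N)" using N2 by (simp add: powr_minus powr_numeral power2_eq_square divide_inverse)
      finally have "(real (n N) / (4 * real N)) powr - m \<le> 1 / (real N * real N) * 4 powr m" by simp
      then have "\<eta> \<le> C * (1 / (real N * real N) * 4 powr m)" unfolding \<eta>_def using C by (intro mult_left_mono) auto
      then have "4 * \<eta> * real N \<le> 4 * (C * (1 / (real N * real N) * 4 powr m)) * real N" by (intro mult_right_mono mult_left_mono) auto
      also have "\<dots> = (4 * C * 4 powr m) / real N" using N2 by simp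
      also have "\<dots> \<le> 1 / 2"
      proof -
        have "8 * C * 4 powr m \<le> real N" using N1(4) N by linarith
        then show ?thesis using N2 by (simp add: field_simps)
      qed
      finally show ?thesis .
    qed
    have Jb: "\<bar>jac_cos \<alpha> \<beta> l u\<bar> \<le> \<eta>" if l: "l \<ge> n N" and u: "1 / (4 * real N) \<le> \<bar>u\<bar>" "\<bar>u\<bar> \<le> 1" for l u
    proof -
      have "1 / (4 * real N) > 0" using N2 by simp
      then have u0: "\<bar>u\<bar> > 0" using u(1) by linarith
      have l1: "l \<ge> 1" using l nN by linarith
      have "\<bar>jac_cos \<alpha> \<beta> l \<bar>u\<bar>\<bar> \<le> C * (real l * \<bar>u\<bar>) powr - m" using l1 u0 u by (intro decay)
      also have "\<dots> \<le> \<eta>" unfolding \<eta>_def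
      proof (intro mult_left_mono powr_mono2')
        have "real (n N) * (1 / (4 * real N)) \<le> real l * \<bar>u\<bar>" using l u by (intro mult_mono) auto
        then show "real (n N) / (4 * real N) \<le> real l * \<bar>u\<bar>" by simp
      qed (use m C nN N2 in auto)
      finally show ?thesis by simp
    qed
    have diag: "\<bar>jac_cos \<alpha> \<beta> l (r N)\<bar> \<le> 1 / 2" if l: "l \<ge> n N" for l
    proof -
      have l1: "l \<ge> 1" using l nN by linarith
      have r1: "r N \<le> 1" using th[OF N, of 0] N2 by (simp add: \<theta>_def)
      have "\<bar>jac_cos \<alpha> \<beta> l (r N)\<bar> \<le> C * (real l * r N) powr - m" using l1 r1 scales(3)[OF N] by (intro decay)
      also have "\<dots> \<le> C * M0 powr - m"
      proof (intro mult_left_mono powr_mono2')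
        have "real (n N) * r N \<le> real l * r N" using l scales(3)[OF N] by (intro mult_right_mono) auto
        then show "M0 \<le> real l * r N" using nN by (simp add: r_def)
      qed (use m C M0 in auto)
      finally show ?thesis using M0 by linarith
    qed
    have off: "\<bar>incr_kernel l (r N) (\<theta> N i) (\<theta> N j)\<bar> \<le> 4 * \<eta>" if l: "l \<ge> n N" and ij: "i < N" "j < N" "i \<noteq> j" for l i j
    proof -
      have d1: "\<bar>\<theta> N i - \<theta> N j\<bar> \<ge> 1 / (2 * real N)"
      proof -
        have "\<bar>real i - real j\<bar> \<ge> 1" using ij(3) by linarith
        then have "\<bar>real i - real j\<bar> / (2 * real N) \<ge> 1 / (2 * real N)" by (intro divide_right_mono) auto
        moreover have "\<bar>\<theta> N i - \<theta> N j\<bar> = \<bar>real i - real j\<bar> / (2 * real N)"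
          by (simp add: \<theta>_def diff_divide_distrib[symmetric] abs_divide)
        ultimately show ?thesis by simp
      qed
      have half: "1 / (2 * real N) = 1 / (4 * real N) + 1 / (4 * real N)" by simp
      have quarter: "1 / (4 * real N) \<le> 1 / 8" using N2 by (simp add: field_simps)
      have "0 \<le> \<theta> N i" "\<theta> N i \<le> 1 / 2" "0 \<le> \<theta> N j" "\<theta> N j \<le> 1 / 2"
        using ij N2 by (auto simp: \<theta>_def field_simps)
      then have d2: "\<bar>\<theta> N i - \<theta> N j\<bar> \<le> 1 / 2" by linarith
      have quarter0: "1 / (4 * real N) \<ge> 0" by simp
      note rr = scales(3,4)[OF N]
      have "\<bar>jac_cos \<alpha> \<beta> l (\<theta> N i - \<theta> N j)\<bar> \<le> \<eta>" using d1 d2 half quarter0 by (intro Jb l) linarith+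
      moreover have "\<bar>jac_cos \<alpha> \<beta> l (\<theta> N i - \<theta> N j - r N)\<bar> \<le> \<eta>" using d1 d2 half rr quarter by (intro Jb l) linarith+
      moreover have "\<bar>jac_cos \<alpha> \<beta> l (\<theta> N i - \<theta> N j + r N)\<bar> \<le> \<eta>" using d1 d2 half rr quarter by (intro Jb l) linarith+
      ultimately show ?thesis unfolding incr_kernel_def by linarith
    qed
    obtain c where c: "c k = 1" "gs (X N) k = (\<lambda>\<omega>. \<Sum>i\<le>k. c i * X N i \<omega>)" using gs_span by blast
    have "gs (X N) k = (\<lambda>\<omega>. \<Sum>i\<in>{..k}. c i * incr (p (\<theta> N i)) (p (\<theta> N i + r N)) \<omega>)"
      unfolding c(2) using k by (intro ext sum.cong refl) (auto simp: X_def)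
    moreover have "ip (\<lambda>\<omega>. \<Sum>i\<in>{..k}. c i * incr (p (\<theta> N i)) (p (\<theta> N i + r N)) \<omega>) (\<lambda>\<omega>. \<Sum>i\<in>{..k}. c i * incr (p (\<theta> N i)) (p (\<theta> N i + r N)) \<omega>)
        \<ge> \<gamma>1 * 2 powr (- 2 - \<nu>) * real (n N) powr (- \<nu>) * (\<Sum>i\<in>{..k}. (c i)\<^sup>2)"
    proof (rule gram_lower)
      show "n N \<ge> l0" "n N \<ge> 1" using scales(1)[OF N] N N1 N2 by linarith+
      have "4 * \<eta> * real (card {..k}) \<le> 4 * \<eta> * real N" using k \<eta>0 by (intro mult_left_mono) auto
      then show "4 * \<eta> * real (card {..k}) \<le> 1 / 2" using \<eta>1 by linarith
    qed (use th[OF N] k diag off \<eta>0 in auto)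
    moreover have "(\<Sum>i\<in>{..k}. (c i)\<^sup>2) \<ge> 1"
      using member_le_sum[of k "{..k}" "\<lambda>i. (c i)\<^sup>2"] c(1) by simp
    moreover have "(s N)\<^sup>2 = \<gamma>1 * 2 powr (- 2 - \<nu>) * real (n N) powr (- \<nu>)"
    proof -
      have "(s N)\<^sup>2 = g0\<^sup>2 * (real (n N) powr (- \<nu> / 2) * real (n N) powr (- \<nu> / 2))"
        by (simp add: s_def power2_eq_square)
      also have "real (n N) powr (- \<nu> / 2) * real (n N) powr (- \<nu> / 2) = real (n N) powr (- \<nu>)"
        by (subst powr_add[symmetric]) simp
      finally show ?thesis unfolding g0 .
    qed
    moreover have "\<gamma>1 * 2 powr (- 2 - \<nu>) * real (n N) powr (- \<nu>) * 1 \<le> \<gamma>1 * 2 powr (- 2 - \<nu>) * real (n N) powr (- \<nu>) * (\<Sum>i\<in>{..k}. (c i)\<^sup>2)"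
      using gamma1 calculation(3) by (intro mult_left_mono) auto
    ultimately show ?thesis by simp
  qed
  define A where "A N = {\<omega>\<in>space P. \<forall>i<N. \<bar>X N i \<omega>\<bar> \<le> s N * t N}" for N
  have Xm: "X N i \<in> borel_measurable P" if "N \<ge> N1" for N i using X_mem[OF that] by (rule meas_mem)
  have A_ev: "A N \<in> events" if "N \<ge> N1" for N
  proof -
    have [measurable]: "X N i \<in> borel_measurable P" for i using Xm[OF that] .
    show ?thesis unfolding A_def by measurable
  qed
  \<comment> \<open>From \<open>(1 - x) ^ N \<le> exp (- N * x) \<le> 1 / (N * x)\<close> with
    \<open>x = N powr (- 1 / 4) / (3 * exp 1)\<close>.\<close>
  define f where "f N = 3 * exp 1 * real N powr - (3 / 4)" for N :: nat
  have pA: "prob (A N) \<le> f N" if N: "N \<ge> N1" for N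
  proof -
    have N2: "N \<ge> 2" using N N1 by simp
    have sN: "s N > 0" using g0 scales(1)[OF N] N2 by (simp add: s_def)
    have tN: "t N \<ge> 0" "(t N)\<^sup>2 = ln (real N) / 4" using N2 by (auto simp: t_def power_divide)
    define x where "x = exp (- (t N)\<^sup>2 - 1) / 3"
    have "x = exp (- (ln (real N) / 4) + - 1) / 3" by (simp add: x_def tN)
    also have "\<dots> = exp (- (ln (real N) / 4)) * (exp (-1) / 3)" by (simp only: exp_add times_divide_eq_right)
    also have "exp (- (ln (real N) / 4)) = real N powr (- (1 / 4))" using N2 by (simp add: powr_def)
    finally have "x = real N powr (- (1 / 4)) * (exp (-1) / 3)" .
    then have xN: "real N * x = real N powr (3 / 4) * (exp (-1) / 3)"
      using powr_add[of "real N" 1 "- (1 / 4)"] N2 by simp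
    have "prob (A N) \<le> (1 - x) ^ N"
      unfolding A_def x_def using X_mem[OF N] sN tN(1) var[OF N] by (rule small_ball_sequence)
    also have "\<dots> \<le> (exp (- x)) ^ N"
    proof (rule power_mono)
      show "1 - x \<le> exp (- x)" using exp_ge_add_one_self[of "- x"] by simp
      have "- (t N)\<^sup>2 - 1 \<le> 0" using zero_le_power2[of "t N"] by linarith
      then have "exp (- (t N)\<^sup>2 - 1) \<le> 1" by simp
      then show "0 \<le> 1 - x" unfolding x_def by linarith
    qed
    also have "\<dots> = exp (- (real N * x))" by (simp add: exp_of_nat_mult[symmetric])
    also have "\<dots> \<le> 1 / (real N * x)"
    proof -
      have x0: "real N * x > 0" using N2 by (simp add: x_def)
      have "real N * x \<le> exp (real N * x)" using exp_ge_add_one_self[of "real N * x"] by linarith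
      then show ?thesis using x0 unfolding exp_minus inverse_eq_divide by (intro divide_left_mono) auto
    qed
    also have "\<dots> = f N"
    proof -
      have e1: "exp (- 1 :: real) = 1 / exp 1" by (simp only: exp_minus inverse_eq_divide)
      have e2: "real N powr - (3 / 4) = 1 / real N powr (3 / 4)" by (rule powr_minus_divide)
      show ?thesis unfolding xN f_def e1 e2 by simp
    qed
    finally show ?thesis .
  qed
  have "(\<lambda>N. real N powr - (3 / 4)) \<longlonglongrightarrow> 0"
    by (rule tendsto_neg_powr[OF _ filterlim_real_sequentially]) simp
  then have f0: "f \<longlonglongrightarrow> 0" unfolding f_def by (rule tendsto_mult_right_zero)
  \<comment> \<open>The bad event for all \<open>N \<ge> N0\<close> lies in each single
    \<open>A N\<close>, so it suffices that \<open>f\<close> tends to 0. The sum of \<open>f\<close>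
    diverges, so Borel-Cantelli along all \<open>N\<close> would not apply.\<close>
  have infinitely: "AE \<omega> in P. \<exists>N\<ge>N0. \<omega> \<notin> A N" if N0: "N0 \<ge> N1" for N0
  proof -
    have ev: "(\<Inter>N\<in>{N0..}. A N) \<in> events" using A_ev N0 by (intro sets.countable_INT') auto
    have "prob (\<Inter>N\<in>{N0..}. A N) \<le> 0"
    proof (rule tendsto_lowerbound[OF f0])
      show "\<forall>\<^sub>F N in sequentially. prob (\<Inter>N\<in>{N0..}. A N) \<le> f N"
      proof (rule eventually_sequentiallyI[of N0])
        fix N assume N: "N \<ge> N0"
        have "prob (\<Inter>N\<in>{N0..}. A N) \<le> prob (A N)" using N N0 by (intro finite_measure_mono A_ev) auto
        also have "\<dots> \<le> f N" using N N0 by (intro pA) auto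
        finally show "prob (\<Inter>N\<in>{N0..}. A N) \<le> f N" .
      qed
    qed simp
    then have "prob (\<Inter>N\<in>{N0..}. A N) = 0" by (simp add: measure_le_0_iff)
    then have "AE \<omega> in P. \<omega> \<notin> (\<Inter>N\<in>{N0..}. A N)" using ev by (intro AE_not_in) (simp add: null_sets_def emeasure_eq_measure)
    then show ?thesis by eventually_elim auto
  qed
  have "AE \<omega> in P. \<forall>N0. N0 \<ge> N1 \<longrightarrow> (\<exists>N\<ge>N0. \<omega> \<notin> A N)"
    unfolding AE_all_countable using infinitely by (intro allI AE_impI) auto
  \<comment> \<open>Solves \<open>2 * c * M0 powr (\<nu> / 2) * sqrt q = g0\<close>, which equates
    \<open>s N * t N\<close> with \<open>c\<close> times the gauge at \<open>r N\<close> once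
    \<open>|ln r|\<close> is replaced by its bound \<open>q * ln N\<close>.\<close>
  define c where "c = g0 / (2 * (M0 powr (\<nu> / 2) * sqrt (real q)))"
  have M0p: "M0 powr (\<nu> / 2) > 0" using M0 by simp
  have c: "c > 0" using g0 q M0p by (simp add: c_def)
  show ?thesis
  proof (intro exI[of _ c] conjI c)
    show "AE \<omega> in P. \<forall>\<delta>>0. \<exists>x\<in>mspace M. \<exists>y\<in>mspace M. 0 < mdist M x y \<and> mdist M x y \<le> \<delta> \<and> mdist M x y < 1 \<and>
      \<bar>Z x \<omega> - Z y \<omega>\<bar> \<ge> c * (mdist M x y powr (\<nu> / 2) * sqrt \<bar>ln (mdist M x y)\<bar>)"
      using \<open>AE \<omega> in P. \<forall>N0. N0 \<ge> N1 \<longrightarrow> (\<exists>N\<ge>N0. \<omega> \<notin> A N)\<close> AE_space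
    proof eventually_elim
      fix \<omega> assume inf: "\<forall>N0. N0 \<ge> N1 \<longrightarrow> (\<exists>N\<ge>N0. \<omega> \<notin> A N)" and sp: "\<omega> \<in> space P"
      show "\<forall>\<delta>>0. \<exists>x\<in>mspace M. \<exists>y\<in>mspace M. 0 < mdist M x y \<and> mdist M x y \<le> \<delta> \<and> mdist M x y < 1 \<and>
        \<bar>Z x \<omega> - Z y \<omega>\<bar> \<ge> c * (mdist M x y powr (\<nu> / 2) * sqrt \<bar>ln (mdist M x y)\<bar>)"
      proof (intro allI impI)
        fix \<delta> :: real assume \<delta>: "\<delta> > 0"
        define N0 where "N0 = max N1 (nat \<lceil>1 / \<delta>\<rceil>)"
        obtain N where N: "N \<ge> N0" "\<omega> \<notin> A N" using inf[rule_format, of N0] by (auto simp: N0_def)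
        have NN: "N \<ge> N1" using N by (simp add: N0_def)
        have N2: "N \<ge> 2" using NN N1 by simp
        obtain i where i: "i < N" "\<bar>X N i \<omega>\<bar> > s N * t N" using N(2) sp by (auto simp: A_def not_le)
        define x y where "x = p (\<theta> N i)" and "y = p (\<theta> N i + r N)"
        have xy: "x \<in> mspace M" "y \<in> mspace M" "mdist M x y = r N"
          using th[OF NN i(1)] p scales(3)[OF NN] by (auto simp: x_def y_def)
        have r\<delta>: "r N \<le> \<delta>"
        proof -
          have "1 / \<delta> \<le> real (nat \<lceil>1 / \<delta>\<rceil>)" by (rule real_nat_ceiling_ge)
          also have "\<dots> \<le> real N" using N(1) unfolding N0_def of_nat_le_iff by simp
          finally have "1 / real N \<le> \<delta>" using \<delta> N2 by (simp add: field_simps)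
          moreover have "1 / (4 * real N) \<le> 1 / real N" using N2 by (simp add: field_simps)
          ultimately show ?thesis using scales(4)[OF NN] by linarith
        qed
        have r1: "r N < 1"
        proof -
          have "1 / (4 * real N) < 1" using N2 by (simp add: field_simps)
          then show ?thesis using scales(4)[OF NN] by linarith
        qed
        have nN: "real (n N) > 0" using scales(1)[OF NN] N2 by simp
        \<comment> \<open>\<open>M0 \<ge> 1\<close> makes \<open>r N\<close> no smaller than
          \<open>N powr (- q)\<close>.\<close>
        have ln: "\<bar>ln (r N)\<bar> \<le> real q * ln (real N)"
        proof -
          have "ln (r N) \<le> 0" using r1 scales(3)[OF NN] by simp
          then have "\<bar>ln (r N)\<bar> = ln (real (n N)) - ln M0" using nN M0 by (simp add: r_def ln_div)
          also have "\<dots> \<le> ln (real (n N))" using M0 by simp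
          also have "\<dots> = real q * ln (real N)" using N2 by (simp add: n_def ln_realpow)
          finally show ?thesis .
        qed
        have "r N powr (\<nu> / 2) * sqrt \<bar>ln (r N)\<bar> \<le> r N powr (\<nu> / 2) * sqrt (real q * ln (real N))"
          using ln by (intro mult_left_mono real_sqrt_le_mono) auto
        also have "\<dots> = (M0 powr (\<nu> / 2) * real (n N) powr (- \<nu> / 2)) * (sqrt (real q) * (2 * t N))"
        proof -
          have "r N powr (\<nu> / 2) = M0 powr (\<nu> / 2) / real (n N) powr (\<nu> / 2)" by (simp only: r_def powr_divide)
          moreover have "real (n N) powr (- \<nu> / 2) = 1 / real (n N) powr (\<nu> / 2)"
            using powr_minus_divide[of "real (n N)" "\<nu> / 2"] by simp
          moreover have "sqrt (real q * ln (real N)) = sqrt (real q) * (2 * t N)" by (simp add: real_sqrt_mult t_def)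
          ultimately show ?thesis by simp
        qed
        finally have "c * (r N powr (\<nu> / 2) * sqrt \<bar>ln (r N)\<bar>) \<le> c * ((M0 powr (\<nu> / 2) * real (n N) powr (- \<nu> / 2)) * (sqrt (real q) * (2 * t N)))"
          using c by (intro mult_left_mono) auto
        also have "\<dots> = s N * t N" using M0p q by (simp add: c_def s_def)
        also have "\<dots> \<le> \<bar>Z x \<omega> - Z y \<omega>\<bar>" using i by (simp add: X_def incr_def x_def y_def)
        finally show "\<exists>x\<in>mspace M. \<exists>y\<in>mspace M. 0 < mdist M x y \<and> mdist M x y \<le> \<delta> \<and> mdist M x y < 1 \<and>
          \<bar>Z x \<omega> - Z y \<omega>\<bar> \<ge> c * (mdist M x y powr (\<nu> / 2) * sqrt \<bar>ln (mdist M x y)\<bar>)"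
          using xy r\<delta> r1 scales(3)[OF NN] by (intro bexI[of _ x] bexI[of _ y]) auto
      qed
    qed
  qed
qed

end
end

section \<open>Zero-one law\<close>

context isotropic_gaussian begin

context
  fixes D :: "nat \<Rightarrow> 'p"
  assumes D: "\<And>j. D j \<in> mspace M"
begin

definition rho :: "nat \<Rightarrow> nat \<Rightarrow> real" where "rho j k = mdist M (D j) (D k)"

text \<open>Encodes that the limsup of the modulus over pairs of \<open>D\<close> is at most
  \<open>c\<close>, with quantifiers over naturals so that measurability is automatic. The radii
  \<open>1 / (m + 2)\<close> stay below 1, where the gauge is positive.\<close>

definition modulus_le :: "real \<Rightarrow> (nat \<Rightarrow> real) \<Rightarrow> bool" where
  "modulus_le c f \<longleftrightarrow> (\<forall>n::nat. \<exists>m::nat. \<forall>j k. 0 < rho j k \<longrightarrow> rho j k \<le> 1 / (real m + 2) \<longrightarrow>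
     \<bar>f j - f k\<bar> \<le> (c + 1 / (real n + 1)) * (rho j k powr (\<nu> / 2) * sqrt \<bar>ln (rho j k)\<bar>))"

text \<open>A Hoelder term is negligible against the gauge:
  \<open>H * \<rho> powr (\<nu> / 2)\<close> is at most \<open>e\<close> times the gauge as soon as
  \<open>sqrt |ln \<rho>| \<ge> H / e\<close>. Half of the slack in \<open>modulus_le\<close> pays
  for it.\<close>

lemma modulus_le_add_holder:
  assumes f: "modulus_le c f" and g: "\<And>j k. rho j k \<le> 1 \<Longrightarrow> \<bar>g j - g k\<bar> \<le> H * rho j k powr (\<nu> / 2)"
  shows "modulus_le c (\<lambda>j. f j + g j)"
  unfolding modulus_le_def
proof
  fix n :: nat
  define e where "e = 1 / (2 * (real n + 1))"
  have e: "e > 0" "1 / (real (2 * n + 1) + 1) = e" "e + e = 1 / (real n + 1)"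
    by (simp_all add: e_def divide_simps)
  obtain m1 where m1: "\<And>j k. 0 < rho j k \<Longrightarrow> rho j k \<le> 1 / (real m1 + 2) \<Longrightarrow>
     \<bar>f j - f k\<bar> \<le> (c + e) * (rho j k powr (\<nu> / 2) * sqrt \<bar>ln (rho j k)\<bar>)"
    using f[unfolded modulus_le_def, rule_format, of "2 * n + 1"] unfolding e(2) by blast
  \<comment> \<open>\<open>\<rho> \<le> 1 / m2\<close> forces
    \<open>|ln \<rho>| \<ge> (H / e)^2\<close>.\<close>
  define m2 where "m2 = nat \<lceil>exp ((H / e)\<^sup>2)\<rceil>"
  define m where "m = max m1 m2"
  show "\<exists>m::nat. \<forall>j k. 0 < rho j k \<longrightarrow> rho j k \<le> 1 / (real m + 2) \<longrightarrow>
     \<bar>(f j + g j) - (f k + g k)\<bar> \<le> (c + 1 / (real n + 1)) * (rho j k powr (\<nu> / 2) * sqrt \<bar>ln (rho j k)\<bar>)"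
  proof (rule exI[of _ m], intro allI impI)
    fix j k assume r: "0 < rho j k" "rho j k \<le> 1 / (real m + 2)"
    define R where "R = rho j k"
    have mm: "1 / (real m + 2) \<le> 1 / (real m1 + 2)" "1 / (real m + 2) \<le> 1 / (real m2 + 2)" "1 / (real m + 2) \<le> 1"
      by (auto intro!: divide_left_mono simp: m_def)
    have "exp ((H / e)\<^sup>2) \<le> real m2" unfolding m2_def by (rule real_nat_ceiling_ge)
    also have "\<dots> \<le> 1 / R"
    proof -
      have Rp: "R > 0" using r(1) unfolding R_def .
      have "R \<le> 1 / (real m2 + 2)" using r(2) mm(2) unfolding R_def by (rule order.trans)
      then have "R * (real m2 + 2) \<le> 1" by (subst (asm) pos_le_divide_eq) auto
      then have "real m2 * R \<le> 1" using Rp by (simp add: distrib_left mult.commute)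
      then show ?thesis using Rp by (subst pos_le_divide_eq)
    qed
    finally have "ln (exp ((H / e)\<^sup>2)) \<le> ln (1 / R)" using r by (subst ln_le_cancel_iff) (auto simp: R_def)
    then have "(H / e)\<^sup>2 \<le> \<bar>ln R\<bar>" using r by (simp add: ln_div R_def)
    then have "sqrt ((H / e)\<^sup>2) \<le> sqrt \<bar>ln R\<bar>" by (rule real_sqrt_le_mono)
    then have "\<bar>H / e\<bar> \<le> sqrt \<bar>ln R\<bar>" by (simp only: real_sqrt_abs)
    then have "H / e \<le> sqrt \<bar>ln R\<bar>" using abs_ge_self[of "H / e"] by linarith
    then have "H \<le> e * sqrt \<bar>ln R\<bar>" using e(1) by (simp add: pos_divide_le_eq mult.commute)
    then have "H * R powr (\<nu> / 2) \<le> e * sqrt \<bar>ln R\<bar> * R powr (\<nu> / 2)" by (intro mult_right_mono) auto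
    moreover have "\<bar>g j - g k\<bar> \<le> H * R powr (\<nu> / 2)"
      unfolding R_def by (rule g) (use r(2) mm(3) in linarith)
    moreover have "e * sqrt \<bar>ln R\<bar> * R powr (\<nu> / 2) = e * (R powr (\<nu> / 2) * sqrt \<bar>ln R\<bar>)" by simp
    ultimately have "\<bar>g j - g k\<bar> \<le> e * (R powr (\<nu> / 2) * sqrt \<bar>ln R\<bar>)" by linarith
    moreover have "\<bar>f j - f k\<bar> \<le> (c + e) * (R powr (\<nu> / 2) * sqrt \<bar>ln R\<bar>)"
      unfolding R_def by (rule m1) (use r mm in linarith)+
    ultimately have "\<bar>(f j + g j) - (f k + g k)\<bar> \<le> (c + e) * (R powr (\<nu> / 2) * sqrt \<bar>ln R\<bar>) + e * (R powr (\<nu> / 2) * sqrt \<bar>ln R\<bar>)"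
      by linarith
    also have "\<dots> = (c + 1 / (real n + 1)) * (R powr (\<nu> / 2) * sqrt \<bar>ln R\<bar>)"
      unfolding e(3)[symmetric] by (simp add: distrib_right)
    finally show "\<bar>(f j + g j) - (f k + g k)\<bar> \<le> (c + 1 / (real n + 1)) * (rho j k powr (\<nu> / 2) * sqrt \<bar>ln (rho j k)\<bar>)"
      unfolding R_def .
  qed
qed

lemma modulus_le_mono:
  assumes "modulus_le c f" "c \<le> c'" shows "modulus_le c' f"
  unfolding modulus_le_def
proof
  fix n :: nat
  obtain m :: nat where m: "\<And>j k. 0 < rho j k \<Longrightarrow> rho j k \<le> 1 / (real m + 2) \<Longrightarrow>
     \<bar>f j - f k\<bar> \<le> (c + 1 / (real n + 1)) * (rho j k powr (\<nu> / 2) * sqrt \<bar>ln (rho j k)\<bar>)"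
    using assms(1) unfolding modulus_le_def by blast
  have "(c + 1 / (real n + 1)) * (rho j k powr (\<nu> / 2) * sqrt \<bar>ln (rho j k)\<bar>) \<le> (c' + 1 / (real n + 1)) * (rho j k powr (\<nu> / 2) * sqrt \<bar>ln (rho j k)\<bar>)" for j k
    using assms(2) by (intro mult_right_mono) auto
  then show "\<exists>m::nat. \<forall>j k. 0 < rho j k \<longrightarrow> rho j k \<le> 1 / (real m + 2) \<longrightarrow>
     \<bar>f j - f k\<bar> \<le> (c' + 1 / (real n + 1)) * (rho j k powr (\<nu> / 2) * sqrt \<bar>ln (rho j k)\<bar>)"
    using m by (intro exI[of _ m] allI impI) (rule order.trans)
qed

definition obs :: "nat \<Rightarrow> 'w \<Rightarrow> real" where "obs j = Zc (D j)"

definition gs_loading :: "nat \<Rightarrow> nat \<Rightarrow> real" where "gs_loading j i = gs_coeff obs (obs j) i"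

lemma obs_mem: "obs j \<in> span" unfolding obs_def using D by (rule Zc_mem)

lemma gs_obs_mem: "gs obs i \<in> span" by (rule gs_mem[OF obs_mem])

lemma gs_obs_meas: "gs obs i \<in> borel_measurable P" by (rule meas_mem[OF gs_obs_mem])

text \<open>The expansion is lower triangular, so the same \<open>N\<close> leading terms can be
  split off from every observation, also from those with index below \<open>N\<close>.\<close>

lemma gs_loading_upper_zero: assumes "j < i" shows "gs_loading j i = 0"
proof -
  have "obs j = (\<lambda>\<omega>. gs obs j \<omega> + (\<Sum>k<j. gs_coeff obs (obs j) k * gs obs k \<omega>))"
    by (rule ext) (simp add: gs_eq[of obs j])
  then have "ip (obs j) (gs obs i) = ip (\<lambda>\<omega>. gs obs j \<omega> + (\<Sum>k<j. gs_coeff obs (obs j) k * gs obs k \<omega>)) (gs obs i)" by (rule arg_cong)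
  also have "\<dots> = ip (gs obs j) (gs obs i) + (\<Sum>k<j. gs_coeff obs (obs j) k * ip (gs obs k) (gs obs i))"
    using gs_obs_mem by (simp add: ip_add ip_sum sum_mem)
  also have "\<dots> = 0" using assms gs_orth[OF obs_mem] by (simp add: sum.neutral)
  finally show ?thesis by (simp add: gs_loading_def gs_coeff_def)
qed

lemma gs_loading_holder: "\<exists>C\<ge>0. \<forall>j k. rho j k \<le> 1 \<longrightarrow> \<bar>gs_loading j i - gs_loading k i\<bar> \<le> C * rho j k powr (\<nu> / 2)"
proof -
  obtain K where K: "K > 0" "\<And>x y. x \<in> mspace M \<Longrightarrow> y \<in> mspace M \<Longrightarrow> mdist M x y \<le> 1 \<Longrightarrow> ip (incr x y) (incr x y) \<le> K * mdist M x y powr \<nu>"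
    using incr_var_upper by blast
  define V where "V = ip (gs obs i) (gs obs i)"
  have V: "V \<ge> 0" unfolding V_def by (rule ip_nonneg)
  \<comment> \<open>For a degenerate innovation \<open>V = 0\<close>, and both sides vanish by the
    convention for division.\<close>
  have "\<bar>gs_loading j i - gs_loading k i\<bar> \<le> (sqrt (K * V) / V) * rho j k powr (\<nu> / 2)" if r: "rho j k \<le> 1" for j k
  proof -
    have "ip (incr (D j) (D k)) (gs obs i) = ip (obs j) (gs obs i) - ip (obs k) (gs obs i)"
      unfolding incr_Zc[OF D D] obs_def[symmetric] using obs_mem gs_obs_mem by (intro ip_diff)
    then have e: "gs_loading j i - gs_loading k i = ip (incr (D j) (D k)) (gs obs i) / V"
      by (simp add: gs_loading_def gs_coeff_def V_def diff_divide_distrib)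
    have "(ip (incr (D j) (D k)) (gs obs i))\<^sup>2 \<le> ip (incr (D j) (D k)) (incr (D j) (D k)) * V"
      unfolding V_def by (rule ip_Cauchy_Schwarz[OF incr_mem[OF D D] gs_obs_mem])
    also have "\<dots> \<le> (K * rho j k powr \<nu>) * V"
      using V K(2)[OF D D] r unfolding rho_def by (intro mult_right_mono) auto
    also have "\<dots> = (sqrt (K * V) * rho j k powr (\<nu> / 2))\<^sup>2"
    proof -
      have "(rho j k powr (\<nu> / 2))\<^sup>2 = rho j k powr \<nu>" by (simp add: power2_eq_square powr_add[symmetric])
      then show ?thesis unfolding power_mult_distrib using K(1) V by simp
    qed
    finally have "\<bar>ip (incr (D j) (D k)) (gs obs i)\<bar> \<le> sqrt (K * V) * rho j k powr (\<nu> / 2)"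
      using K(1) V abs_le_square_iff[of "ip (incr (D j) (D k)) (gs obs i)" "sqrt (K * V) * rho j k powr (\<nu> / 2)"] by simp
    then have "\<bar>ip (incr (D j) (D k)) (gs obs i)\<bar> / V \<le> sqrt (K * V) * rho j k powr (\<nu> / 2) / V" using V by (rule divide_right_mono)
    then show ?thesis unfolding e using V by (simp add: abs_divide)
  qed
  moreover have "sqrt (K * V) / V \<ge> 0" using K(1) V by simp
  ultimately show ?thesis by blast
qed

definition tail_obs :: "nat \<Rightarrow> 'w \<Rightarrow> nat \<Rightarrow> real" where
  "tail_obs N \<omega> j = (\<Sum>i\<in>{N..j}. gs_loading j i * gs obs i \<omega>)"

text \<open>The leading \<open>N\<close> terms form, path by path, a Hoelder function of exponent
  \<open>\<nu> / 2\<close> with a finite random constant \<open>H\<close>, so adding or removing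
  them leaves every level unchanged.\<close>

lemma modulus_le_tail_obs: "modulus_le c (tail_obs 0 \<omega>) \<longleftrightarrow> modulus_le c (tail_obs N \<omega>)"
proof -
  define g where "g j = (\<Sum>i<N. gs_loading j i * gs obs i \<omega>)" for j
  have eq: "tail_obs 0 \<omega> j = tail_obs N \<omega> j + g j" for j
  proof (cases "N \<le> j")
    case True
    have "(\<Sum>i\<in>{0..j}. gs_loading j i * gs obs i \<omega>) = (\<Sum>i\<in>{..<N} \<union> {N..j}. gs_loading j i * gs obs i \<omega>)"
      using True by (intro sum.cong) auto
    also have "\<dots> = g j + tail_obs N \<omega> j" unfolding g_def tail_obs_def by (intro sum.union_disjoint) auto
    finally show ?thesis by (simp add: tail_obs_def)
  next
    case False
    have "(\<Sum>i\<in>{0..j}. gs_loading j i * gs obs i \<omega>) = g j" unfolding g_def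
      using False gs_loading_upper_zero by (intro sum.mono_neutral_left) auto
    then show ?thesis using False by (simp add: tail_obs_def)
  qed
  obtain C where C: "\<And>i. C i \<ge> 0" "\<And>i j k. rho j k \<le> 1 \<Longrightarrow> \<bar>gs_loading j i - gs_loading k i\<bar> \<le> C i * rho j k powr (\<nu> / 2)"
    using gs_loading_holder by metis
  define H where "H = (\<Sum>i<N. C i * \<bar>gs obs i \<omega>\<bar>)"
  have g: "\<bar>g j - g k\<bar> \<le> H * rho j k powr (\<nu> / 2)" if "rho j k \<le> 1" for j k
  proof -
    have "g j - g k = (\<Sum>i<N. (gs_loading j i - gs_loading k i) * gs obs i \<omega>)" by (simp add: g_def left_diff_distrib sum_subtractf)
    also have "\<bar>\<dots>\<bar> \<le> (\<Sum>i<N. \<bar>(gs_loading j i - gs_loading k i) * gs obs i \<omega>\<bar>)" by (rule sum_abs)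
    also have "\<dots> \<le> (\<Sum>i<N. (C i * rho j k powr (\<nu> / 2)) * \<bar>gs obs i \<omega>\<bar>)"
      unfolding abs_mult using C that by (intro sum_mono mult_right_mono) auto
    also have "\<dots> = H * rho j k powr (\<nu> / 2)" by (simp add: H_def sum_distrib_left mult_ac)
    finally show ?thesis .
  qed
  have e1: "tail_obs 0 \<omega> = (\<lambda>j. tail_obs N \<omega> j + g j)" by (rule ext) (rule eq)
  have e2: "tail_obs N \<omega> = (\<lambda>j. tail_obs 0 \<omega> j + - g j)" by (rule ext) (simp add: eq)
  show ?thesis
  proof
    assume "modulus_le c (tail_obs 0 \<omega>)"
    then have "modulus_le c (\<lambda>j. tail_obs 0 \<omega> j + - g j)"
      by (rule modulus_le_add_holder) (use g in \<open>simp add: abs_minus_commute\<close>)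
    then show "modulus_le c (tail_obs N \<omega>)" using e2 by simp
  next
    assume "modulus_le c (tail_obs N \<omega>)"
    then have "modulus_le c (\<lambda>j. tail_obs N \<omega> j + g j)" by (rule modulus_le_add_holder) (rule g)
    then show "modulus_le c (tail_obs 0 \<omega>)" using e1 by simp
  qed
qed

text \<open>The measurable space is arbitrary because the event must be placed in the sigma-algebra
  of the innovations from \<open>N\<close> on, for each \<open>N\<close>, as well as in that of
  \<open>P\<close>.\<close>

lemma modulus_le_measurable:
  assumes "\<And>i. N \<le> i \<Longrightarrow> gs obs i \<in> borel_measurable S"
  shows "{\<omega>\<in>space S. modulus_le c (tail_obs N \<omega>)} \<in> sets S"
proof -
  have [measurable]: "(\<lambda>\<omega>. tail_obs N \<omega> j) \<in> borel_measurable S" for j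
    unfolding tail_obs_def using assms by (intro borel_measurable_sum borel_measurable_times) auto
  show ?thesis unfolding modulus_le_def by measurable
qed

lemma modulus_zero_one: "prob {\<omega>\<in>space P. modulus_le c (tail_obs 0 \<omega>)} \<in> {0, 1}"
proof -
  define A where "A i = {gs obs i -` B \<inter> space P |B. B \<in> sets (borel :: real measure)}" for i
  have A_sets: "A i = sets (vimage_algebra (space P) (gs obs i) borel)" for i
    by (simp add: A_def sets_vimage_algebra2)
  have sa: "sigma_algebra (space P) (A i)" for i
    using sets.sigma_algebra_axioms[of "vimage_algebra (space P) (gs obs i) borel"] by (simp add: A_sets)
  have ind: "indep_sets A UNIV"
    using gs_indep[OF obs_mem] unfolding indep_vars_def2 A_def by simp
  have tail: "{\<omega>\<in>space P. modulus_le c (tail_obs 0 \<omega>)} \<in> tail_events A"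
    unfolding tail_events_def
  proof
    fix N
    define S where "S = sigma (space P) (\<Union>i\<in>{N..}. A i)"
    have sub: "(\<Union>i\<in>{N..}. A i) \<subseteq> Pow (space P)" by (auto simp: A_def)
    have sS: "sets S = sigma_sets (space P) (\<Union>i\<in>{N..}. A i)" "space S = space P"
      unfolding S_def using sub by (simp_all add: sets_measure_of space_measure_of)
    have "gs obs i \<in> borel_measurable S" if "N \<le> i" for i
    proof (rule measurableI)
      fix B :: "real set" assume "B \<in> sets borel"
      then have "gs obs i -` B \<inter> space P \<in> A i" by (auto simp: A_def)
      then show "gs obs i -` B \<inter> space S \<in> sets S" unfolding sS using that by (intro sigma_sets.Basic) auto
    qed simp
    then have "{\<omega>\<in>space S. modulus_le c (tail_obs N \<omega>)} \<in> sets S" by (rule modulus_le_measurable)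
    then show "{\<omega>\<in>space P. modulus_le c (tail_obs 0 \<omega>)} \<in> sigma_sets (space P) (\<Union>i\<in>{N..}. A i)"
      unfolding sS modulus_le_tail_obs[of c _ N] .
  qed
  show ?thesis using kolmogorov_0_1_law[OF sa ind tail] by blast
qed

lemma tail_obs_AE: "AE \<omega> in P. \<forall>j k. \<bar>tail_obs 0 \<omega> j - tail_obs 0 \<omega> k\<bar> = \<bar>Z (D j) \<omega> - Z (D k) \<omega>\<bar>"
proof -
  have "AE \<omega> in P. \<forall>j. obs j \<omega> = tail_obs 0 \<omega> j"
    unfolding AE_all_countable
  proof
    fix j show "AE \<omega> in P. obs j \<omega> = tail_obs 0 \<omega> j"
      using gs_expansion[OF obs_mem, where n = j] by (simp add: tail_obs_def gs_loading_def atLeast0AtMost)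
  qed
  then show ?thesis
  proof eventually_elim
    fix \<omega> assume e: "\<forall>j. obs j \<omega> = tail_obs 0 \<omega> j"
    show "\<forall>j k. \<bar>tail_obs 0 \<omega> j - tail_obs 0 \<omega> k\<bar> = \<bar>Z (D j) \<omega> - Z (D k) \<omega>\<bar>"
    proof (intro allI)
      fix j k
      have "tail_obs 0 \<omega> j - tail_obs 0 \<omega> k = incr (D j) (D k) \<omega>" using e incr_Zc[OF D[of j] D[of k]] by (simp add: obs_def)
      then show "\<bar>tail_obs 0 \<omega> j - tail_obs 0 \<omega> k\<bar> = \<bar>Z (D j) \<omega> - Z (D k) \<omega>\<bar>" by (simp add: incr_def)
    qed
  qed
qed

text \<open>\<open>\<kappa>\<close> is the infimum of the nonnegative levels that hold almost
  surely. Monotonicity reduces the uncountable family of levels to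
  \<open>\<kappa> + 1 / (n + 1)\<close> and \<open>\<kappa> - 1 / (n + 1)\<close>, so a single null
  set serves all \<open>c\<close>.\<close>

lemma modulus_constant:
  assumes upper: "AE \<omega> in P. modulus_le C (\<lambda>j. Z (D j) \<omega>)" and C: "C \<ge> 0"
  shows "\<exists>\<kappa>\<ge>0. AE \<omega> in P. (\<forall>c>\<kappa>. modulus_le c (\<lambda>j. Z (D j) \<omega>)) \<and> (\<forall>c. 0 \<le> c \<longrightarrow> c < \<kappa> \<longrightarrow> \<not> modulus_le c (\<lambda>j. Z (D j) \<omega>))"
proof -
  define E where "E c = {\<omega>\<in>space P. modulus_le c (tail_obs 0 \<omega>)}" for c
  have E_ev: "E c \<in> events" for c unfolding E_def using gs_obs_meas by (intro modulus_le_measurable)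
  have E01: "prob (E c) = 0 \<or> prob (E c) = 1" for c using modulus_zero_one[of c] by (simp add: E_def)
  have same: "AE \<omega> in P. \<forall>c. modulus_le c (tail_obs 0 \<omega>) \<longleftrightarrow> modulus_le c (\<lambda>j. Z (D j) \<omega>)"
    using tail_obs_AE by eventually_elim (simp add: modulus_le_def)
  define K where "K = {c. 0 \<le> c \<and> prob (E c) = 1}"
  have "AE \<omega> in P. \<omega> \<in> E C" using upper same AE_space by eventually_elim (simp add: E_def)
  then have "prob (E C) = 1" using E_ev by (simp add: prob_eq_1)
  then have CK: "C \<in> K" using C by (simp add: K_def)
  have bdd: "bdd_below K" by (rule bdd_belowI[of _ 0]) (simp add: K_def)
  define \<kappa> where "\<kappa> = Inf K"
  have k0: "\<kappa> \<ge> 0" unfolding \<kappa>_def using CK by (intro cInf_greatest) (auto simp: K_def)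
  have up: "AE \<omega> in P. \<forall>n::nat. modulus_le (\<kappa> + 1 / (real n + 1)) (tail_obs 0 \<omega>)"
    unfolding AE_all_countable
  proof
    fix n :: nat
    have "Inf K < \<kappa> + 1 / (real n + 1)" by (simp add: \<kappa>_def)
    then obtain c where c: "c \<in> K" "c < \<kappa> + 1 / (real n + 1)" using CK bdd cInf_less_iff[of K] by blast
    have "AE \<omega> in P. \<omega> \<in> E c" using c(1) E_ev by (simp add: K_def prob_eq_1[symmetric])
    then show "AE \<omega> in P. modulus_le (\<kappa> + 1 / (real n + 1)) (tail_obs 0 \<omega>)"
      by eventually_elim (use c(2) modulus_le_mono in \<open>auto simp: E_def\<close>)
  qed
  have low: "AE \<omega> in P. \<forall>n::nat. 0 \<le> \<kappa> - 1 / (real n + 1) \<longrightarrow> \<not> modulus_le (\<kappa> - 1 / (real n + 1)) (tail_obs 0 \<omega>)"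
    unfolding AE_all_countable
  proof (intro allI AE_impI)
    fix n :: nat assume nn: "0 \<le> \<kappa> - 1 / (real n + 1)"
    have "\<kappa> - 1 / (real n + 1) \<notin> K"
    proof
      assume "\<kappa> - 1 / (real n + 1) \<in> K"
      then have "\<kappa> \<le> \<kappa> - 1 / (real n + 1)" unfolding \<kappa>_def using bdd by (rule cInf_lower)
      moreover have "1 / (real n + 1) > 0" by simp
      ultimately show False by linarith
    qed
    then have "prob (E (\<kappa> - 1 / (real n + 1))) = 0" using E01 nn by (auto simp: K_def)
    then have "AE \<omega> in P. \<omega> \<notin> E (\<kappa> - 1 / (real n + 1))"
      using E_ev by (intro AE_not_in) (simp add: null_sets_def emeasure_eq_measure)
    then show "AE \<omega> in P. \<not> modulus_le (\<kappa> - 1 / (real n + 1)) (tail_obs 0 \<omega>)"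
      using AE_space by eventually_elim (simp add: E_def)
  qed
  have "AE \<omega> in P. (\<forall>c>\<kappa>. modulus_le c (\<lambda>j. Z (D j) \<omega>)) \<and> (\<forall>c. 0 \<le> c \<longrightarrow> c < \<kappa> \<longrightarrow> \<not> modulus_le c (\<lambda>j. Z (D j) \<omega>))"
    using up low same
  proof eventually_elim
    fix \<omega> assume u: "\<forall>n::nat. modulus_le (\<kappa> + 1 / (real n + 1)) (tail_obs 0 \<omega>)"
      and l: "\<forall>n::nat. 0 \<le> \<kappa> - 1 / (real n + 1) \<longrightarrow> \<not> modulus_le (\<kappa> - 1 / (real n + 1)) (tail_obs 0 \<omega>)"
      and s: "\<forall>c. modulus_le c (tail_obs 0 \<omega>) \<longleftrightarrow> modulus_le c (\<lambda>j. Z (D j) \<omega>)"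
    show "(\<forall>c>\<kappa>. modulus_le c (\<lambda>j. Z (D j) \<omega>)) \<and> (\<forall>c. 0 \<le> c \<longrightarrow> c < \<kappa> \<longrightarrow> \<not> modulus_le c (\<lambda>j. Z (D j) \<omega>))"
    proof (intro conjI allI impI notI)
      fix c assume "c > \<kappa>"
      then obtain n where n: "1 / (real n + 1) < c - \<kappa>"
        using reals_Archimedean[of "c - \<kappa>"] by (auto simp: inverse_eq_divide add.commute)
      then show "modulus_le c (\<lambda>j. Z (D j) \<omega>)" using u s modulus_le_mono[of "\<kappa> + 1 / (real n + 1)" "tail_obs 0 \<omega>" c] by auto
    next
      fix c assume c: "0 \<le> c" "c < \<kappa>" "modulus_le c (\<lambda>j. Z (D j) \<omega>)"
      then obtain n where n: "1 / (real n + 1) < \<kappa> - c"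
        using reals_Archimedean[of "\<kappa> - c"] by (auto simp: inverse_eq_divide add.commute)
      then have "modulus_le (\<kappa> - 1 / (real n + 1)) (tail_obs 0 \<omega>)" using c s modulus_le_mono[of c "tail_obs 0 \<omega>"] by auto
      then show False using l n c by auto
    qed
  qed
  then show ?thesis using k0 by blast
qed

end
end

section \<open>The limit\<close>

context isotropic_gaussian begin

section \<open>From the dense sequence to all pairs, for a fixed sample path\<close>

context
  fixes D :: "nat \<Rightarrow> 'p" and z :: "'p \<Rightarrow> real" and \<kappa> c :: real
  assumes D: "\<And>j. D j \<in> mspace M"
    and dense: "\<And>x e. x \<in> mspace M \<Longrightarrow> e > 0 \<Longrightarrow> \<exists>j. mdist M x (D j) < e"
    and cont: "continuous_map (mtopology_of M) euclideanreal z"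
    and kappa: "\<kappa> \<ge> 0" and c: "c > 0"
    and up: "\<And>c. \<kappa> < c \<Longrightarrow> modulus_le D c (\<lambda>j. z (D j))"
    and low: "\<And>c. 0 \<le> c \<Longrightarrow> c < \<kappa> \<Longrightarrow> \<not> modulus_le D c (\<lambda>j. z (D j))"
    and pairs: "\<And>\<delta>. \<delta> > 0 \<Longrightarrow> \<exists>x\<in>mspace M. \<exists>y\<in>mspace M. 0 < mdist M x y \<and> mdist M x y \<le> \<delta> \<and> mdist M x y < 1 \<and>
      \<bar>z x - z y\<bar> \<ge> c * (mdist M x y powr (\<nu> / 2) * sqrt \<bar>ln (mdist M x y)\<bar>)"
begin

definition gauge :: "real \<Rightarrow> real" where "gauge r = r powr (\<nu> / 2) * sqrt \<bar>ln r\<bar>"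

lemma gauge_pos: "0 < r \<Longrightarrow> r < 1 \<Longrightarrow> gauge r > 0"
  by (auto simp: gauge_def)

lemma modulus_sup_ge:
  assumes "x \<in> mspace M" "y \<in> mspace M" "0 < mdist M x y" "mdist M x y \<le> \<epsilon>" "mdist M x y < 1"
    and "\<bar>z x - z y\<bar> \<ge> a * gauge (mdist M x y)"
  shows "modulus_sup M \<nu> z \<epsilon> \<ge> ereal a"
proof -
  have "a \<le> \<bar>z x - z y\<bar> / gauge (mdist M x y)"
    using assms(6) gauge_pos[OF assms(3,5)] by (simp add: pos_le_divide_eq)
  then show ?thesis unfolding modulus_sup_def gauge_def
    by (intro SUP_upper2[of "(x, y)"]) (use assms in auto)
qed

lemma modulus_sup_ge_c: "\<epsilon> > 0 \<Longrightarrow> modulus_sup M \<nu> z \<epsilon> \<ge> ereal c"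
  using pairs[of \<epsilon>] modulus_sup_ge[of _ _ \<epsilon> c] unfolding gauge_def by blast

lemma modulus_sup_ge_below:
  assumes a: "0 \<le> a" "a < \<kappa>" and e: "\<epsilon> > 0"
  shows "modulus_sup M \<nu> z \<epsilon> \<ge> ereal a"
proof -
  obtain n :: nat where n: "\<And>m. \<exists>j k. 0 < mdist M (D j) (D k) \<and> mdist M (D j) (D k) \<le> 1 / (real m + 2) \<and>
     \<not> \<bar>z (D j) - z (D k)\<bar> \<le> (a + 1 / (real n + 1)) * gauge (mdist M (D j) (D k))"
    using low[OF a] unfolding modulus_le_def[OF D] rho_def[OF D] gauge_def by auto
  define m where "m = nat \<lceil>1 / \<epsilon>\<rceil>"
  obtain j k where jk: "0 < mdist M (D j) (D k)" "mdist M (D j) (D k) \<le> 1 / (real m + 2)"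
     "\<bar>z (D j) - z (D k)\<bar> > (a + 1 / (real n + 1)) * gauge (mdist M (D j) (D k))"
    using n[of m] by (auto simp: not_le)
  have "1 / \<epsilon> \<le> real m" unfolding m_def by (rule real_nat_ceiling_ge)
  then have "1 \<le> \<epsilon> * real m" using e by (simp add: field_simps)
  then have me: "1 / (real m + 2) \<le> \<epsilon>" using e by (simp add: field_simps)
  have m1: "1 / (real m + 2) < 1" by simp
  have "a * gauge (mdist M (D j) (D k)) \<le> (a + 1 / (real n + 1)) * gauge (mdist M (D j) (D k))"
    by (intro mult_right_mono) (auto simp: gauge_def)
  then have "a * gauge (mdist M (D j) (D k)) \<le> \<bar>z (D j) - z (D k)\<bar>" using jk(3) by linarith
  moreover have "mdist M (D j) (D k) \<le> \<epsilon>" "mdist M (D j) (D k) < 1" using jk(2) me m1 by linarith+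
  ultimately show ?thesis by (intro modulus_sup_ge[OF D D jk(1)])
qed

text \<open>If some close pair exceeded the level, continuity of \<open>z\<close> and of the gauge
  would carry the excess to a nearby pair of the sequence.\<close>

lemma modulus_sup_le_above:
  assumes a: "\<kappa> < a"
  shows "\<exists>\<epsilon>0>0. \<forall>\<epsilon>\<le>\<epsilon>0. modulus_sup M \<nu> z \<epsilon> \<le> ereal a"
proof -
  \<comment> \<open>Leaves room between \<open>\<kappa>\<close> and \<open>a\<close> for the slack
    \<open>1 / (n + 1)\<close> of \<open>modulus_le\<close>.\<close>
  define b where "b = (\<kappa> + a) / 2"
  have b: "\<kappa> < b" "b < a" using a by (simp_all add: b_def field_simps)
  obtain n where n: "1 / (real n + 1) < a - b"
    using reals_Archimedean[of "a - b"] b by (auto simp: inverse_eq_divide add.commute)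
  obtain m :: nat where m: "\<And>j k. 0 < mdist M (D j) (D k) \<Longrightarrow> mdist M (D j) (D k) \<le> 1 / (real m + 2) \<Longrightarrow>
     \<bar>z (D j) - z (D k)\<bar> \<le> (b + 1 / (real n + 1)) * gauge (mdist M (D j) (D k))"
    using up[OF b(1)] unfolding modulus_le_def[OF D] rho_def[OF D] gauge_def by blast
  have pt: "\<bar>z x - z y\<bar> \<le> a * gauge (mdist M x y)"
    if x: "x \<in> mspace M" and y: "y \<in> mspace M" and r: "0 < mdist M x y" "mdist M x y < 1 / (real m + 2)" for x y
  proof (rule ccontr)
    define R where "R = mdist M x y"
    define gap where "gap = \<bar>z x - z y\<bar> - a * gauge R"
    assume "\<not> ?thesis"
    then have gap: "gap > 0" by (simp add: gap_def R_def)
    have "isCont (\<lambda>r. a * gauge r) R" unfolding gauge_def using r by (auto intro!: continuous_intros simp: R_def)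
    then obtain \<eta>1 where e1: "\<eta>1 > 0" "\<And>r. \<bar>r - R\<bar> < \<eta>1 \<Longrightarrow> \<bar>a * gauge r - a * gauge R\<bar> < gap / 3"
      using gap unfolding continuous_at_eps_delta dist_real_def by (metis divide_pos_pos zero_less_numeral)
    obtain \<delta>x where dx: "\<delta>x > 0" "\<And>w. w \<in> mspace M \<Longrightarrow> mdist M x w < \<delta>x \<Longrightarrow> \<bar>z x - z w\<bar> < gap / 3"
      using continuous_map_mdist[OF cont x, of "gap / 3"] gap by auto
    obtain \<delta>y where dy: "\<delta>y > 0" "\<And>w. w \<in> mspace M \<Longrightarrow> mdist M y w < \<delta>y \<Longrightarrow> \<bar>z y - z w\<bar> < gap / 3"
      using continuous_map_mdist[OF cont y, of "gap / 3"] gap by auto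
    define L where "L = 1 / (real m + 2)"
    \<comment> \<open>\<open>R\<close> keeps the approximating pair apart, \<open>L - R\<close>
      keeps it within the radius \<open>L\<close>, and the others keep gauge and values within a
      third of the excess.\<close>
    define mn where "mn = Min {\<eta>1, \<delta>x, \<delta>y, R, L - R}"
    define e where "e = mn / 2"
    have "mn > 0" using e1(1) dx(1) dy(1) r by (simp add: mn_def R_def L_def)
    then have e: "e > 0" "mn = 2 * e" by (simp_all add: e_def)
    have mn: "mn \<le> \<eta>1" "mn \<le> \<delta>x" "mn \<le> \<delta>y" "mn \<le> R" "mn \<le> L - R"
      unfolding mn_def by (rule Min_le; simp)+
    obtain j where j: "mdist M x (D j) < e" using dense[OF x e(1)] by blast
    obtain k where k: "mdist M y (D k) < e" using dense[OF y e(1)] by blast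
    define r where "r = mdist M (D j) (D k)"
    have "r \<le> mdist M (D j) x + mdist M x (D k)" unfolding r_def using D x by (intro mdist_triangle) auto
    moreover have "mdist M x (D k) \<le> R + mdist M y (D k)" unfolding R_def using D x y by (intro mdist_triangle) auto
    moreover have "R \<le> mdist M x (D j) + mdist M (D j) y" unfolding R_def using D x y by (intro mdist_triangle) auto
    moreover have "mdist M (D j) y \<le> r + mdist M (D k) y" unfolding r_def using D y by (intro mdist_triangle) auto
    ultimately have rR: "r < R + 2 * e" "R < r + 2 * e" using j k mdist_commute[of M "D j" x] mdist_commute[of M "D k" y] by linarith+
    have r0: "0 < r" "r \<le> L" "\<bar>r - R\<bar> < \<eta>1" using rR e mn by linarith+
    have zx: "\<bar>z x - z (D j)\<bar> < gap / 3" by (rule dx(2)[OF D]) (use j e mn in linarith)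
    have zy: "\<bar>z y - z (D k)\<bar> < gap / 3" by (rule dy(2)[OF D]) (use k e mn in linarith)
    have "\<bar>z (D j) - z (D k)\<bar> \<le> (b + 1 / (real n + 1)) * gauge r" using m[of j k] r0 unfolding r_def L_def by blast
    also have "\<dots> \<le> a * gauge r" using n by (intro mult_right_mono) (auto simp: gauge_def)
    finally have "\<bar>z (D j) - z (D k)\<bar> \<le> a * gauge r" .
    moreover have "\<bar>z x - z y\<bar> = a * gauge R + gap" by (simp add: gap_def)
    moreover have "gap = 3 * (gap / 3)" by simp
    ultimately show False using e1(2)[OF r0(3)] zx zy by linarith
  qed
  \<comment> \<open>\<open>pt\<close> needs a strict inequality to leave room for approximation,
    hence \<open>m + 3\<close>.\<close>
  have "modulus_sup M \<nu> z \<epsilon> \<le> ereal a" if \<epsilon>: "\<epsilon> \<le> 1 / (real m + 3)" for \<epsilon>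
    unfolding modulus_sup_def
  proof (rule SUP_least, clarify)
    fix x y assume xy: "x \<in> mspace M" "y \<in> mspace M" "0 < mdist M x y" "mdist M x y \<le> \<epsilon>"
    have "1 / (real m + 3) < 1 / (real m + 2)" by (intro divide_strict_left_mono) auto
    then have lt: "mdist M x y < 1 / (real m + 2)" using xy \<epsilon> by linarith
    moreover have "1 / (real m + 2) < 1" by simp
    ultimately have "gauge (mdist M x y) > 0" using xy by (intro gauge_pos) linarith+
    then have "\<bar>z x - z y\<bar> / gauge (mdist M x y) \<le> a" using pt[OF xy(1-3) lt] by (simp add: pos_divide_le_eq)
    then show "ereal (\<bar>z x - z y\<bar> / (mdist M x y powr (\<nu> / 2) * sqrt \<bar>ln (mdist M x y)\<bar>)) \<le> ereal a"
      unfolding gauge_def by simp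
  qed
  then show ?thesis by (intro exI[of _ "1 / (real m + 3)"]) auto
qed

lemma modulus_sup_tendsto: "(modulus_sup M \<nu> z \<longlongrightarrow> ereal \<kappa>) (at_right 0)"
proof (rule order_tendstoI)
  fix a assume "a < ereal \<kappa>"
  then obtain b where b: "a < ereal b" "ereal b < ereal \<kappa>" using ereal_dense2 by blast
  show "\<forall>\<^sub>F \<epsilon> in at_right 0. a < modulus_sup M \<nu> z \<epsilon>"
    unfolding eventually_at_right_field
  proof (intro exI[of _ 1] conjI allI impI)
    fix \<epsilon> :: real assume e: "0 < \<epsilon>"
    have "ereal b \<le> modulus_sup M \<nu> z \<epsilon>"
    proof (cases "0 \<le> b")
      case True then show ?thesis using b e by (intro modulus_sup_ge_below) auto
    next
      \<comment> \<open>\<open>low\<close> speaks only of nonnegative levels. For negative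
        \<open>b\<close> the bound by \<open>c\<close> applies; it also excludes the value of an
        empty supremum.\<close>
      case False
      then have "ereal b \<le> ereal c" using c by simp
      also have "\<dots> \<le> modulus_sup M \<nu> z \<epsilon>" using e by (rule modulus_sup_ge_c)
      finally show ?thesis .
    qed
    then show "a < modulus_sup M \<nu> z \<epsilon>" using b(1) by (rule less_le_trans[rotated])
  qed simp
next
  fix a assume "ereal \<kappa> < a"
  then obtain b where b: "ereal \<kappa> < ereal b" "ereal b < a" using ereal_dense2 by blast
  then obtain \<epsilon>0 where "\<epsilon>0 > 0" "\<And>\<epsilon>. \<epsilon> \<le> \<epsilon>0 \<Longrightarrow> modulus_sup M \<nu> z \<epsilon> \<le> ereal b" using modulus_sup_le_above[of b] by auto
  then have "modulus_sup M \<nu> z \<epsilon> < a" if "\<epsilon> < \<epsilon>0" for \<epsilon>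
    using b(2) that le_less_trans[of "modulus_sup M \<nu> z \<epsilon>" "ereal b" a] by simp
  then show "\<forall>\<^sub>F \<epsilon> in at_right 0. modulus_sup M \<nu> z \<epsilon> < a"
    unfolding eventually_at_right_field using \<open>\<epsilon>0 > 0\<close> by blast
qed

text \<open>The source of the positivity of \<open>\<kappa>\<close>.\<close>

lemma c_le_kappa: "c \<le> \<kappa>"
proof (rule ccontr)
  assume "\<not> c \<le> \<kappa>"
  then obtain b where b: "\<kappa> < b" "b < c" using dense_order_class.dense[of \<kappa> c] by auto
  obtain \<epsilon>0 where "\<epsilon>0 > 0" "\<And>\<epsilon>. \<epsilon> \<le> \<epsilon>0 \<Longrightarrow> modulus_sup M \<nu> z \<epsilon> \<le> ereal b" using modulus_sup_le_above[OF b(1)] by auto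
  then have "modulus_sup M \<nu> z \<epsilon>0 \<le> ereal b" "ereal c \<le> modulus_sup M \<nu> z \<epsilon>0" using modulus_sup_ge_c by auto
  then have "ereal c \<le> ereal b" by (rule order.trans[rotated])
  then show False using b by simp
qed

end

theorem exact_modulus:
  assumes arc: "has_geodesic_arc M" and nets: "has_polynomial_nets M"
    and cont: "AE \<omega> in P. continuous_map (mtopology_of M) euclideanreal (\<lambda>x. Z x \<omega>)"
  shows "\<exists>\<kappa>::real. \<kappa> > 0 \<and> (AE \<omega> in P. (modulus_sup M \<nu> (\<lambda>x. Z x \<omega>) \<longlongrightarrow> ereal \<kappa>) (at_right 0))"
proof -
  obtain p where p: "\<And>s t. s \<in> {0..1::real} \<Longrightarrow> t \<in> {0..1} \<Longrightarrow> p s \<in> mspace M \<and> mdist M (p s) (p t) = \<bar>s - t\<bar>"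
    using arc unfolding has_geodesic_arc_def by blast
  obtain c where c: "c > 0" and pairs: "AE \<omega> in P. \<forall>\<delta>>0. \<exists>x\<in>mspace M. \<exists>y\<in>mspace M. 0 < mdist M x y \<and> mdist M x y \<le> \<delta> \<and> mdist M x y < 1 \<and>
    \<bar>Z x \<omega> - Z y \<omega>\<bar> \<ge> c * (mdist M x y powr (\<nu> / 2) * sqrt \<bar>ln (mdist M x y)\<bar>)"
    using modulus_lower_arc[OF p] by blast
  obtain C where C: "C > 0" and upper: "AE \<omega> in P. \<exists>\<delta>>0. \<forall>x\<in>mspace M. \<forall>y\<in>mspace M. 0 < mdist M x y \<longrightarrow> mdist M x y \<le> \<delta> \<longrightarrow>
    \<bar>Z x \<omega> - Z y \<omega>\<bar> \<le> C * (mdist M x y powr (\<nu> / 2) * sqrt \<bar>ln (mdist M x y)\<bar>)"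
    using modulus_upper[OF nets cont] by blast
  have "\<forall>k. \<exists>T. finite T \<and> T \<subseteq> mspace M \<and> (\<forall>x\<in>mspace M. \<exists>y\<in>T. mdist M x y \<le> (1 / 2) ^ k)"
    using nets unfolding has_polynomial_nets_def by meson
  then obtain T where T: "\<And>k. finite (T k)" "\<And>k. T k \<subseteq> mspace M"
    "\<And>k x. x \<in> mspace M \<Longrightarrow> \<exists>y\<in>T k. mdist M x y \<le> (1 / 2) ^ k" by metis
  define S where "S = (\<Union>k. T k)"
  have S_count: "countable S" unfolding S_def using T(1) by (auto intro: countable_finite)
  have "p 0 \<in> mspace M" using p[of 0 0] by simp
  then have S_ne: "S \<noteq> {}" using T(3)[of "p 0" 0] by (auto simp: S_def)
  \<comment> \<open>Enumerates the union of the nets, which is dense because the mesh tends to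
    0.\<close>
  define D where "D = from_nat_into S"
  have D_range: "range D = S" unfolding D_def by (rule range_from_nat_into[OF S_ne S_count])
  have D: "D j \<in> mspace M" for j using D_range T(2) by (auto simp: S_def)
  have dense: "\<exists>j. mdist M x (D j) < e" if x: "x \<in> mspace M" and e: "e > 0" for x e
  proof -
    obtain k where k: "(1 / 2) ^ k < e" using real_arch_pow_inv[of e "1/2"] e by auto
    obtain y where y: "y \<in> T k" "mdist M x y \<le> (1 / 2) ^ k" using T(3)[OF x] by blast
    have "y \<in> range D" unfolding D_range S_def using y by blast
    then obtain j where "D j = y" by blast
    then show ?thesis using y k by (intro exI[of _ j]) simp
  qed
  have upper_D: "AE \<omega> in P. modulus_le D C (\<lambda>j. Z (D j) \<omega>)"
    using upper
  proof eventually_elim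
    fix \<omega> assume "\<exists>\<delta>>0. \<forall>x\<in>mspace M. \<forall>y\<in>mspace M. 0 < mdist M x y \<longrightarrow> mdist M x y \<le> \<delta> \<longrightarrow>
      \<bar>Z x \<omega> - Z y \<omega>\<bar> \<le> C * (mdist M x y powr (\<nu> / 2) * sqrt \<bar>ln (mdist M x y)\<bar>)"
    then obtain \<delta> where d: "\<delta> > 0" "\<And>x y. x \<in> mspace M \<Longrightarrow> y \<in> mspace M \<Longrightarrow> 0 < mdist M x y \<Longrightarrow> mdist M x y \<le> \<delta> \<Longrightarrow>
      \<bar>Z x \<omega> - Z y \<omega>\<bar> \<le> C * (mdist M x y powr (\<nu> / 2) * sqrt \<bar>ln (mdist M x y)\<bar>)" by blast
    define m where "m = nat \<lceil>1 / \<delta>\<rceil>"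
    have "1 / \<delta> \<le> real m" unfolding m_def by (rule real_nat_ceiling_ge)
    then have "1 \<le> \<delta> * real m" using d by (simp add: field_simps)
    then have me: "1 / (real m + 2) \<le> \<delta>" using d by (simp add: field_simps)
    show "modulus_le D C (\<lambda>j. Z (D j) \<omega>)"
      unfolding modulus_le_def[OF D] rho_def[OF D]
    proof (intro allI exI[of _ m] impI)
      fix n j k assume r: "0 < mdist M (D j) (D k)" "mdist M (D j) (D k) \<le> 1 / (real m + 2)"
      have "\<bar>Z (D j) \<omega> - Z (D k) \<omega>\<bar> \<le> C * (mdist M (D j) (D k) powr (\<nu> / 2) * sqrt \<bar>ln (mdist M (D j) (D k))\<bar>)"
        using r me by (intro d D) linarith+
      also have "\<dots> \<le> (C + 1 / (real n + 1)) * (mdist M (D j) (D k) powr (\<nu> / 2) * sqrt \<bar>ln (mdist M (D j) (D k))\<bar>)"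
        by (intro mult_right_mono) auto
      finally show "\<bar>Z (D j) \<omega> - Z (D k) \<omega>\<bar> \<le> (C + 1 / (real n + 1)) * (mdist M (D j) (D k) powr (\<nu> / 2) * sqrt \<bar>ln (mdist M (D j) (D k))\<bar>)" .
    qed
  qed
  obtain \<kappa> where kappa: "\<kappa> \<ge> 0" and const: "AE \<omega> in P. (\<forall>c>\<kappa>. modulus_le D c (\<lambda>j. Z (D j) \<omega>)) \<and> (\<forall>c. 0 \<le> c \<longrightarrow> c < \<kappa> \<longrightarrow> \<not> modulus_le D c (\<lambda>j. Z (D j) \<omega>))"
    using modulus_constant[where D = D, OF D upper_D less_imp_le[OF C]] by blast
  \<comment> \<open>\<open>c \<le> \<kappa>\<close> does not depend on \<open>\<omega>\<close> but
    is derived on a path; holding almost surely under a probability measure, it holds.\<close>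
  have "AE \<omega> in P. c \<le> \<kappa> \<and> (modulus_sup M \<nu> (\<lambda>x. Z x \<omega>) \<longlongrightarrow> ereal \<kappa>) (at_right 0)"
    using const pairs cont
  proof eventually_elim
    fix \<omega> assume const: "(\<forall>c>\<kappa>. modulus_le D c (\<lambda>j. Z (D j) \<omega>)) \<and> (\<forall>c. 0 \<le> c \<longrightarrow> c < \<kappa> \<longrightarrow> \<not> modulus_le D c (\<lambda>j. Z (D j) \<omega>))"
      and pairs: "\<forall>\<delta>>0. \<exists>x\<in>mspace M. \<exists>y\<in>mspace M. 0 < mdist M x y \<and> mdist M x y \<le> \<delta> \<and> mdist M x y < 1 \<and>
        \<bar>Z x \<omega> - Z y \<omega>\<bar> \<ge> c * (mdist M x y powr (\<nu> / 2) * sqrt \<bar>ln (mdist M x y)\<bar>)"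
      and cont: "continuous_map (mtopology_of M) euclideanreal (\<lambda>x. Z x \<omega>)"
    note facts = D dense cont kappa c const[THEN conjunct1, rule_format] const[THEN conjunct2, rule_format] pairs[rule_format]
    show "c \<le> \<kappa> \<and> (modulus_sup M \<nu> (\<lambda>x. Z x \<omega>) \<longlongrightarrow> ereal \<kappa>) (at_right 0)"
      using c_le_kappa[OF facts] modulus_sup_tendsto[OF facts] by blast
  qed
  then have "AE \<omega> in P. c \<le> \<kappa>" "AE \<omega> in P. (modulus_sup M \<nu> (\<lambda>x. Z x \<omega>) \<longlongrightarrow> ereal \<kappa>) (at_right 0)" by auto
  then show ?thesis using c by (intro exI[of _ \<kappa>]) auto
qed

end

theorem theorem3p1:
  fixes P :: "'w measure" and M :: "'p metric" and Z :: "'p \<Rightarrow> 'w \<Rightarrow> real"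
    and d l0 :: nat and \<alpha> \<beta> \<gamma>1 \<gamma>2 \<nu> :: real and b :: "nat \<Rightarrow> real"
  assumes "prob_space P"
    and "d \<ge> 2"
    and "compact_two_point_homogeneous d \<alpha> \<beta> M"
    and "gaussian_field P (mspace M) Z"
    and "isotropic_field P M Z"
    and "mean_square_continuous P M Z"
    and "AE \<omega> in P. continuous_map (mtopology_of M) euclideanreal (\<lambda>x. Z x \<omega>)"
    and "\<And>l. b l \<ge> 0"
    and "summable b"
    and "\<And>x1 x2. x1 \<in> mspace M \<Longrightarrow> x2 \<in> mspace M \<Longrightarrow>
      (\<lambda>l. b l * (jacobi \<alpha> \<beta> l (cos (mdist M x1 x2)) / jacobi \<alpha> \<beta> l 1))
        sums covariance P (Z x1) (Z x2)"
    and "l0 \<ge> 1" and "\<gamma>1 > 0" and "\<gamma>2 > 0" and "0 < \<nu>" and "\<nu> < 2"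
    and "\<And>l. l \<ge> l0 \<Longrightarrow>
      \<gamma>1 \<le> b l * (1 + real l) powr (1 + \<nu>) \<and> b l * (1 + real l) powr (1 + \<nu>) \<le> \<gamma>2"
  shows "\<exists>\<kappa>::real. \<kappa> > 0 \<and>
    (AE \<omega> in P. (modulus_sup M \<nu> (\<lambda>x. Z x \<omega>) \<longlongrightarrow> ereal \<kappa>) (at_right 0))"
proof -
  note geometry = compact_two_point_homogeneous_geometry[OF assms(3)]
  have jp: "jacobi_params \<alpha> \<beta>" by unfold_locales (rule geometry)+
  have "isotropic_gaussian P \<alpha> \<beta> M Z b l0 \<gamma>1 \<gamma>2 \<nu>"
    by (intro isotropic_gaussian.intro isotropic_gaussian_axioms.intro assms(1) jp) (use assms in blast)+
  then show ?thesis using geometry(1,2) assms(7) by (rule isotropic_gaussian.exact_modulus)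
qed

end
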